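(* Let $d\ge1$, let $I_1,\dots,I_d\subset\mathbb R$ be open intervals (bounded or unbounded), $\mathbf I=I_1\times\dots\times I_d$, and let $\mathbf n=(n_1,\dots,n_d)\in\mathbb N^d$ be such that $n_i\ge2$ for $i=1,\dots,d$. Let $f\colon\mathbf I\to\mathbb R$ be a function. Then $f$ is box-$\mathbf n$-convex if and only if for every $\boldsymbol\alpha=(\alpha_1,\dots,\alpha_d)\in\mathbf I$, with $\mathbf J^{\boldsymbol\alpha}=\mathbf I\cap\prod_{i=1}^d(\alpha_i,\infty)$, there exist a pseudo-polynomial $W_{\boldsymbol\alpha}\colon\mathbf J^{\boldsymbol\alpha}\to\mathbb R$ of degree $(n_1-1,\dots,n_d-1)$ and a Borel measure $\mu_{\boldsymbol\alpha}$ on $\mathbf I$, which is finite on compact sets, such that $$f(x_1,\dots,x_d)=W_{\boldsymbol\alpha}(x_1,\dots,x_d)+\int_{\mathbf J^{\boldsymbol\alpha}}\prod_{j=1}^d\frac{(x_j-u_j)_+^{n_j-1}}{(n_j-1)!}\,d\mu_{\boldsymbol\alpha}(u_1,\dots,u_d)$$ for all $(x_1,\dots,x_d)\in\mathbf J^{\boldsymbol\alpha}$.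
   Context: $\mathbb N=\{0,1,2,\dots\}$; $x_+=\max\{0,x\}$ and $(x-u)_+^m=((x-u)_+)^m$; Borel measures are nonnegative. Divided differences: for a real function $g$ of one variable and pairwise distinct points, $[x_0;g]=g(x_0)$ and $[x_0,\dots,x_n;g]=\dfrac{[x_1,\dots,x_n;g]-[x_0,\dots,x_{n-1};g]}{x_n-x_0}$ for $n\ge1$. Multiple divided differences: for $f\colon\mathbf I\to\mathbb R$, $\mathbf n\in\mathbb N^d$, and vectors $\mathbf x_i=(x_{i0},\dots,x_{in_i})\in I_i^{n_i+1}$ with pairwise distinct coordinates ($i=1,\dots,d$), $[\mathbf x_1;\dots;\mathbf x_d;f]$ is defined by induction on $d$: for $d=1$ it is $[x_{10},\dots,x_{1n_1};f]$; for $d>1$ it is $[x_{d0},\dots,x_{dn_d};g]$, where $g(x)=[\mathbf x_1;\dots;\mathbf x_{d-1};f(\cdot,\dots,\cdot,x)]$ for $x\in I_d$. $f$ is box-$\mathbf n$-convex if $[\mathbf x_1;\dots;\mathbf x_d;f]\ge0$ for all such $\mathbf x_1,\dots,\mathbf x_d$. On a product of intervals $\mathbf J=\prod_i J_i$, a pseudo-polynomial of degree $(m_1,\dots,m_d)$ is a function $W(x_1,\dots,x_d)=\sum_{i=1}^d\sum_{k=0}^{m_i}A_{ik}(x_1,\dots,x_{i-1},x_{i+1},\dots,x_d)\,x_i^k$, where $A_{ik}\colon\prod_{j\ne i}J_j\to\mathbb R$ are arbitrary functions (constants if $d=1$). *)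

theory Defs
  imports "HOL-Analysis.Analysis"
begin

text \<open>
  Coordinates are indexed by \<open>0, \<dots>, d - 1\<close>, and a point of a product \<open>I\<^sub>0 \<times> \<dots> \<times> I\<^sub>d\<^sub>-\<^sub>1\<close> is an
  extensional function in \<open>PiE {..<d} I\<close>, so that the dimension \<open>d\<close> is an ordinary variable on
  which one can recurse. The type \<open>nat \<Rightarrow> real\<close> carries the product topology; as the coordinates
  from \<open>d\<close> on are frozen at \<open>undefined\<close>, the subspace topology on \<open>PiE {..<d} UNIV\<close> is that of
  Euclidean \<open>d\<close>-space, and \<open>compact\<close> and \<open>borel\<close> have their usual meaning there.
\<close>

text \<open>\<open>divdiff n x g\<close> is \<open>[x 0, \<dots>, x n; g]\<close>.\<close>

primrec divdiff :: "nat \<Rightarrow> (nat \<Rightarrow> real) \<Rightarrow> (real \<Rightarrow> real) \<Rightarrow> real" where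
  "divdiff 0 x g = g (x 0)"
| "divdiff (Suc n) x g =
     (divdiff n (\<lambda>j. x (Suc j)) g - divdiff n x g) / (x (Suc n) - x 0)"

text \<open>
  \<open>X i j\<close> is the \<open>j\<close>-th node in the coordinate \<open>i\<close>. The recursion is started at \<open>d = 0\<close>, where
  \<open>\<lambda>_. undefined\<close> is the only point; at \<open>d = 1\<close> this gives \<open>[X 0 0, \<dots>, X 0 (n 0); f]\<close>.
\<close>

primrec multi_divdiff ::
  "nat \<Rightarrow> (nat \<Rightarrow> nat) \<Rightarrow> (nat \<Rightarrow> nat \<Rightarrow> real) \<Rightarrow> ((nat \<Rightarrow> real) \<Rightarrow> real) \<Rightarrow> real" where
  "multi_divdiff 0 n X f = f (\<lambda>_. undefined)"
| "multi_divdiff (Suc d) n X f =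
     divdiff (n d) (X d) (\<lambda>t. multi_divdiff d n X (\<lambda>y. f (y(d := t))))"

definition box_convex ::
  "nat \<Rightarrow> (nat \<Rightarrow> nat) \<Rightarrow> (nat \<Rightarrow> real set) \<Rightarrow> ((nat \<Rightarrow> real) \<Rightarrow> real) \<Rightarrow> bool" where
  "box_convex d n I f \<longleftrightarrow>
     (\<forall>X. (\<forall>i<d. X i ` {..n i} \<subseteq> I i \<and> inj_on (X i) {..n i}) \<longrightarrow> 0 \<le> multi_divdiff d n X f)"

text \<open>\<open>A i k\<close> is applied to the point \<open>x\<close> with its \<open>i\<close>-th coordinate removed.\<close>

definition pseudo_polynomial ::
  "nat \<Rightarrow> (nat \<Rightarrow> nat) \<Rightarrow> (nat \<Rightarrow> real set) \<Rightarrow> ((nat \<Rightarrow> real) \<Rightarrow> real) \<Rightarrow> bool" where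
  "pseudo_polynomial d m J W \<longleftrightarrow>
     (\<exists>A :: nat \<Rightarrow> nat \<Rightarrow> (nat \<Rightarrow> real) \<Rightarrow> real. \<forall>x \<in> PiE {..<d} J.
        W x = (\<Sum>i<d. \<Sum>k\<le>m i. A i k (restrict x ({..<d} - {i})) * x i ^ k))"

definition borel_measure_on :: "'a::topological_space set \<Rightarrow> 'a measure \<Rightarrow> bool" where
  "borel_measure_on S \<mu> \<longleftrightarrow> sets \<mu> = sets (restrict_space borel S)"

definition finite_on_compacts :: "'a::topological_space set \<Rightarrow> 'a measure \<Rightarrow> bool" where
  "finite_on_compacts S \<mu> \<longleftrightarrow> (\<forall>K. compact K \<and> K \<subseteq> S \<longrightarrow> emeasure \<mu> K < \<infinity>)"

definition spline_kernel :: "nat \<Rightarrow> (nat \<Rightarrow> nat) \<Rightarrow> (nat \<Rightarrow> real) \<Rightarrow> (nat \<Rightarrow> real) \<Rightarrow> real" where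
  "spline_kernel d n x u = (\<Prod>j<d. max 0 (x j - u j) ^ (n j - 1) / fact (n j - 1))"

end

theory Submission
  imports Defs "HOL-Computational_Algebra.Polynomial" "HOL-Probability.Helly_Selection"
begin

text \<open>
  Sufficiency: divided differences of the right orders annihilate the pseudo-polynomial, and turn the
  kernel into a product of B-splines, which are nonnegative by their recurrence.

  Necessity: on finite grids \<open>f\<close> satisfies a discrete Taylor formula, an identity between finitely
  supported functionals whose masses are divided differences of \<open>f\<close>, hence nonnegative. Summed
  over a box they telescope, so they are bounded independently of the grid. Along refining grids the
  discrete measures have a vague limit \<open>\<mu>\<close>; lifting them to the real line through a continuous
  surjection from a Cantor set reduces this compactness to Helly's selection theorem. No continuity
  of \<open>f\<close> is available, so the limit formula first holds only on a countable set exhausted by the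
  grids. It is stated after composition with \<open>\<Prod>\<^sub>i (1 - P\<^sub>i)\<close>, where \<open>P\<^sub>i\<close> is Lagrange
  interpolation at \<open>n\<^sub>i\<close> fixed nodes in the \<open>i\<close>-th coordinate. To reach an arbitrary point \<open>x\<close>, its
  coordinates are added to the countable set; the new limit measure gives the same integrals as \<open>\<mu>\<close>
  on a dense set, hence by continuity also at \<open>x\<close>. Thus \<open>f\<close> minus the kernel integral is
  annihilated by \<open>\<Prod>\<^sub>i (1 - P\<^sub>i)\<close>, that is, it is a pseudo-polynomial.
\<close>

text \<open>The representations themselves cannot be carried to a limit: the coefficients of a
  pseudo-polynomial are arbitrary functions, so these parts have no compactness. Passing to Lagrange
  remainders removes them and leaves a formula in the measure alone. Its kernel is continuous,
  because each order is at least 2, so vague convergence can be tested on it. A second obstacle sits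
  at the lower faces \<open>u i = \<alpha> i\<close>. Grid masses stay bounded near them, because
  the intervals are open and contain points below \<alpha>, but nothing prevents mass from
  accumulating on the faces, which lie outside the domain of integration. There the remainder helps
  again: to the left of all evaluation points the truncated power is a polynomial of degree n_i - 1,
  which interpolation at n_i nodes reproduces. Mass on a lower face therefore contributes
  nothing.\<close>

section \<open>Divided differences on finite sets\<close>

definition dd_weight :: "real set \<Rightarrow> real \<Rightarrow> real" where
  "dd_weight S x = (if x \<in> S then 1 / (\<Prod>r\<in>S - {x}. x - r) else 0)"

lemma dd_weight_outside: "x \<notin> S \<Longrightarrow> dd_weight S x = 0"
  by (simp add: dd_weight_def)

lemma dd_weight_remove:
  assumes "finite S" "a \<in> S"
  shows "dd_weight (S - {a}) x = (x - a) * dd_weight S x"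
proof (cases "x \<in> S \<and> x \<noteq> a")
  case True
  then have "S - {x} = insert a (S - {a} - {x})" using assms by auto
  then have "(\<Prod>r\<in>S - {x}. x - r) = (x - a) * (\<Prod>r\<in>S - {a} - {x}. x - r)"
    using assms by (simp add: prod.insert_remove)
  then show ?thesis using True by (simp add: dd_weight_def)
qed (auto simp: dd_weight_def)

lemma dd_weight_rec:
  assumes "finite S" "a \<in> S" "b \<in> S"
  shows "(b - a) * dd_weight S x = dd_weight (S - {a}) x - dd_weight (S - {b}) x"
  using assms by (simp add: dd_weight_remove algebra_simps)

lemma dd_sum_superset:
  assumes "finite T" "S \<subseteq> T"
  shows "(\<Sum>x\<in>T. dd_weight S x * \<phi> x) = (\<Sum>x\<in>S. dd_weight S x * \<phi> x)"
  using assms by (intro sum.mono_neutral_right) (auto simp: dd_weight_outside)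

lemma dd_sum_linear_factor:
  assumes "finite S" "a \<in> S"
  shows "(\<Sum>x\<in>S. dd_weight S x * ((x - a) * \<phi> x)) = (\<Sum>x\<in>S - {a}. dd_weight (S - {a}) x * \<phi> x)"
proof -
  have "(\<Sum>x\<in>S. dd_weight S x * ((x - a) * \<phi> x)) = (\<Sum>x\<in>S. dd_weight (S - {a}) x * \<phi> x)"
    by (intro sum.cong refl) (simp add: dd_weight_remove[OF assms])
  also have "\<dots> = (\<Sum>x\<in>S - {a}. dd_weight (S - {a}) x * \<phi> x)"
    using assms by (intro dd_sum_superset) auto
  finally show ?thesis .
qed

lemma dd_sum_rec:
  assumes "finite S" "a \<in> S" "b \<in> S"
  shows "(b - a) * (\<Sum>x\<in>S. dd_weight S x * \<phi> x) =
    (\<Sum>x\<in>S - {a}. dd_weight (S - {a}) x * \<phi> x) - (\<Sum>x\<in>S - {b}. dd_weight (S - {b}) x * \<phi> x)"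
proof -
  have "(b - a) * (\<Sum>x\<in>S. dd_weight S x * \<phi> x) =
      (\<Sum>x\<in>S. dd_weight (S - {a}) x * \<phi> x) - (\<Sum>x\<in>S. dd_weight (S - {b}) x * \<phi> x)"
    unfolding sum_subtractf[symmetric] sum_distrib_left
    by (intro sum.cong refl) (simp add: dd_weight_remove[OF assms(1,2)] dd_weight_remove[OF assms(1,3)] algebra_simps)
  then show ?thesis using dd_sum_superset[OF assms(1), of "S - {a}" \<phi>] dd_sum_superset[OF assms(1), of "S - {b}" \<phi>]
    by simp
qed

text \<open>The recursion drops the first and the last node, but the closed form depends only on the
  set of nodes. Later arguments can therefore drop whichever two nodes are convenient.\<close>

lemma divdiff_eq_sum:
  assumes "inj_on X {..n}"
  shows "divdiff n X g = (\<Sum>s\<in>X ` {..n}. dd_weight (X ` {..n}) s * g s)"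
  using assms
proof (induction n arbitrary: X)
  case 0
  then show ?case by (simp add: dd_weight_def)
next
  case (Suc n)
  let ?S = "X ` {..Suc n}"
  have inj: "inj_on X {..n}" "inj_on (\<lambda>j. X (Suc j)) {..n}"
    using Suc.prems by (auto simp: inj_on_def)
  have "(\<lambda>j. X (Suc j)) ` {..n} = X ` (Suc ` {..n})" by (simp add: image_image)
  also have "Suc ` {..n} = {..Suc n} - {0}" by (auto simp: image_iff) (metis Suc_pred atMost_iff le_zero_eq not_less_eq_eq not_gr_zero)
  finally have 1: "(\<lambda>j. X (Suc j)) ` {..n} = ?S - {X 0}"
    using Suc.prems by (subst (asm) inj_on_image_set_diff[of X "{..Suc n}"]) auto
  have "{..n} = {..Suc n} - {Suc n}" by auto
  then have 2: "X ` {..n} = ?S - {X (Suc n)}"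
    using inj_on_image_set_diff[OF Suc.prems, of "{..Suc n}" "{Suc n}"] by simp
  have ne: "X (Suc n) - X 0 \<noteq> 0" using Suc.prems by (auto simp: inj_on_def)
  have "(X (Suc n) - X 0) * (\<Sum>s\<in>?S. dd_weight ?S s * g s) =
     divdiff n (\<lambda>j. X (Suc j)) g - divdiff n X g"
    by (subst dd_sum_rec) (simp_all only: Suc.IH[OF inj(1)] Suc.IH[OF inj(2)] 1 2, auto)
  then show ?case using ne by (simp add: field_simps)
qed

lemma dd_sum_const:
  assumes "finite S" "2 \<le> card S"
  shows "(\<Sum>x\<in>S. dd_weight S x) = 0"
  using assms
proof (induction "card S" arbitrary: S rule: less_induct)
  case less
  obtain a where a: "a \<in> S" using less.prems by fastforce
  have "S - {a} \<noteq> {}" using less.prems a card_Diff_singleton[of a S] by (intro notI) (simp)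
  then obtain b where b: "b \<in> S" "b \<noteq> a" by blast
  have *: "(b - a) * (\<Sum>x\<in>S. dd_weight S x) =
     (\<Sum>x\<in>S - {a}. dd_weight (S - {a}) x) - (\<Sum>x\<in>S - {b}. dd_weight (S - {b}) x)"
    using dd_sum_rec[of S a b "\<lambda>_. 1"] less.prems a b by simp
  have "(\<Sum>x\<in>S - {a}. dd_weight (S - {a}) x) = (\<Sum>x\<in>S - {b}. dd_weight (S - {b}) x)"
  proof (cases "card S = 2")
    case True
    then have "S = {a, b}" using a b less.prems(1) 
      by (metis card_2_iff insert_iff singletonD insert_commute)
    then show ?thesis using b by (auto simp: dd_weight_def insert_Diff_if)
  next
    case False
    then show ?thesis using less a b by (simp add: card_gt_0_iff)
  qed
  then show ?case using * b by simp
qed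

text \<open>In \<open>p = p(a) + (x - a) q\<close> the factor \<open>x - a\<close> deletes the node
  \<open>a\<close>, so the degree and the number of nodes fall together.\<close>

lemma dd_sum_poly:
  assumes "finite S" "degree p + 1 < card S"
  shows "(\<Sum>x\<in>S. dd_weight S x * poly p x) = 0"
  using assms
proof (induction "degree p" arbitrary: p S)
  case 0
  then obtain c where "p = [:c:]" by (metis degree_eq_zeroE)
  then show ?case using 0 dd_sum_const[of S] by (simp flip: sum_distrib_right)
next
  case (Suc k)
  obtain a where a: "a \<in> S" using Suc.prems by fastforce
  define q where "q = synthetic_div p a"
  have p: "poly p x = poly p a + (x - a) * poly q x" for x
    using arg_cong[OF synthetic_div_correct'[of a p], of "\<lambda>p. poly p x"]
    by (simp add: q_def algebra_simps)
  have dq: "degree q = k" using Suc.hyps(2) by (simp add: q_def degree_synthetic_div)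
  have "(\<Sum>x\<in>S. dd_weight S x * poly p x) = (\<Sum>x\<in>S. dd_weight S x * poly p a)
      + (\<Sum>x\<in>S. dd_weight S x * ((x - a) * poly q x))"
    unfolding sum.distrib[symmetric] by (intro sum.cong refl) (subst p, simp add: algebra_simps)
  also have "(\<Sum>x\<in>S. dd_weight S x * poly p a) = 0"
    using dd_sum_const[of S] Suc by (simp flip: sum_distrib_right)
  also have "(\<Sum>x\<in>S. dd_weight S x * ((x - a) * poly q x)) = 0"
    using Suc.hyps Suc.prems a dq by (simp add: dd_sum_linear_factor)
  finally show ?case by simp
qed

lemma dd_sum_power:
  assumes "finite S" "k + 1 < card S"
  shows "(\<Sum>x\<in>S. dd_weight S x * x ^ k) = 0"
  using dd_sum_poly[of S "monom 1 k"] assms by (simp add: poly_monom degree_monom_eq)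

text \<open>As a function of \<open>u\<close> this is a positive multiple of the B-spline with knots
  \<open>S\<close>. For \<open>u\<close> between the extreme knots \<open>a\<close> and
  \<open>b\<close>, its recurrence gives a nonnegative combination of the B-splines with knots
  \<open>S - {a}\<close> and \<open>S - {b}\<close>.\<close>

lemma dd_sum_truncated_power_nonneg:
  assumes "finite S" "card S = m + 2" "1 \<le> m"
  shows "0 \<le> (\<Sum>x\<in>S. dd_weight S x * max 0 (x - u) ^ m)"
proof -
  \<comment> \<open>The strict cut makes \<open>h 0\<close> the indicator of \<open>{u<..}\<close>,
    from which the induction can start; \<open>max 0 (x - u) ^ 0\<close> would be constantly
    1.\<close>
  define h where "h k x = (if u < x then (x - u) ^ k else 0)" for k and x :: real
  have main: "0 \<le> (\<Sum>x\<in>S. dd_weight S x * h m x)" if "finite S" "card S = m + 2" for S m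
    using that
  proof (induction m arbitrary: S)
    case 0
    then obtain a b where ab: "S = {a, b}" "a < b"
      by (metis One_nat_def Suc_1 add_0 card_2_iff insert_commute linorder_neqE)
    have "dd_weight S a = - dd_weight S b" "0 < dd_weight S b"
      using ab by (auto simp: dd_weight_def insert_Diff_if field_simps)
    then show ?case using ab by (auto simp: h_def)
  next
    case (Suc m)
    define a b where "a = Min S" and "b = Max S"
    have S: "S \<noteq> {}" using Suc by auto
    have ab: "a \<in> S" "b \<in> S" "\<And>x. x \<in> S \<Longrightarrow> a \<le> x \<and> x \<le> b"
      using Suc S by (auto simp: a_def b_def)
    have "a \<noteq> b"
    proof
      assume "a = b"
      then have "S \<subseteq> {a}" using ab by force
      then show False using Suc.prems card_mono[of "{a}" S] by simp
    qed
    then have lt: "a < b" using ab by force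
    show ?case
    proof (cases "u < a \<or> b \<le> u")
      case True
      then show ?thesis
      proof
        assume "u < a"
        then have "h (Suc m) x = poly ([:- u, 1:] ^ Suc m) x" if "x \<in> S" for x
          using ab(3)[OF that] by (simp add: h_def algebra_simps)
        then have "(\<Sum>x\<in>S. dd_weight S x * h (Suc m) x) =
            (\<Sum>x\<in>S. dd_weight S x * poly ([:- u, 1:] ^ Suc m) x)"
          by (intro sum.cong) auto
        also have "\<dots> = 0"
          using Suc.prems by (intro dd_sum_poly) (auto simp: degree_linear_power simp del: power_Suc)
        finally show ?thesis by simp
      next
        assume "b \<le> u"
        then have "h (Suc m) x = 0" if "x \<in> S" for x using ab(3)[OF that] by (simp add: h_def)
        then show ?thesis by simp
      qed
    next
      case False
      \<comment> \<open>This writes \<open>x - u\<close> through \<open>x - a\<close> and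
        \<open>x - b\<close>; inside a divided difference these factors delete the node
        \<open>a\<close> or \<open>b\<close>, and both coefficients are nonnegative here.\<close>
      have eq: "(b - a) * h (Suc m) x = (b - u) * ((x - a) * h m x) + (u - a) * ((x - b) * h m x)" for x
        by (simp add: h_def algebra_simps)
      have "(b - a) * (\<Sum>x\<in>S. dd_weight S x * h (Suc m) x)
        = (\<Sum>x\<in>S. dd_weight S x * ((b - a) * h (Suc m) x))"
        by (simp add: sum_distrib_left algebra_simps)
      also have "\<dots> = (b - u) * (\<Sum>x\<in>S. dd_weight S x * ((x - a) * h m x))
          + (u - a) * (\<Sum>x\<in>S. dd_weight S x * ((x - b) * h m x))"
        by (simp only: eq) (simp add: sum_distrib_left algebra_simps sum.distrib sum_subtractf)
      also have "\<dots> \<ge> 0"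
        using Suc ab False by (auto simp: dd_sum_linear_factor intro!: add_nonneg_nonneg mult_nonneg_nonneg)
      finally show ?thesis using lt by (simp add: zero_le_mult_iff)
    qed
  qed
  have "max 0 (x - u) ^ m = h m x" for x
    using assms by (auto simp: h_def max_def)
  then show ?thesis using main[OF assms(1,2)] by simp
qed

section \<open>Discrete Taylor expansion on a finite grid\<close>

definition top_elems :: "nat \<Rightarrow> real set \<Rightarrow> real set" where
  "top_elems n S = {x \<in> S. card {y \<in> S. x < y} < n}"

lemma top_elems_subset: "top_elems n S \<subseteq> S"
  by (auto simp: top_elems_def)

lemma finite_top_elems: "finite S \<Longrightarrow> finite (top_elems n S)"
  by (simp add: top_elems_def)

lemma top_elems_upper:
  assumes "finite S" "x \<in> top_elems n S" "y \<in> S" "x \<le> y"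
  shows "y \<in> top_elems n S"
proof -
  have "card {z \<in> S. y < z} \<le> card {z \<in> S. x < z}"
    using assms by (intro card_mono) auto
  then show ?thesis using assms by (auto simp: top_elems_def)
qed

lemma top_elems_insert_max:
  assumes "finite S" "\<And>x. x \<in> S \<Longrightarrow> x < z"
  shows "top_elems (Suc n) (insert z S) = insert z (top_elems n S)"
proof -
  have "{y \<in> insert z S. x < y} = insert z {y \<in> S. x < y}" if "x \<in> S" for x
    using assms(2)[OF that] by auto
  moreover have "z \<notin> S" using assms by auto
  ultimately have "card {y \<in> insert z S. x < y} = Suc (card {y \<in> S. x < y})" if "x \<in> S" for x
    using assms that by simp
  then have "x \<in> top_elems (Suc n) (insert z S) \<longleftrightarrow> x \<in> top_elems n S" if "x \<in> S" for x
    using that by (simp add: top_elems_def)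
  moreover have empty: "{y \<in> insert z S. z < y} = {}" using assms(2) by force
  have "z \<in> top_elems (Suc n) (insert z S)" unfolding top_elems_def mem_Collect_eq empty by simp
  ultimately show ?thesis using top_elems_subset[of "Suc n" "insert z S"] top_elems_subset[of n S] by blast
qed

lemma card_top_elems:
  assumes "finite S" "n \<le> card S"
  shows "card (top_elems n S) = n"
  using assms
proof (induction S arbitrary: n rule: finite_linorder_max_induct)
  case empty
  then show ?case by (simp add: top_elems_def)
next
  case (insert z S)
  have z: "z \<notin> S" using insert by auto
  show ?case
  proof (cases n)
    case 0
    then show ?thesis by (simp add: top_elems_def)
  next
    case (Suc m)
    then have "m \<le> card S" using insert z by simp
    moreover have "z \<notin> top_elems m S" using z by (auto simp: top_elems_def)
    ultimately show ?thesis using insert Suc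
      by (simp add: top_elems_insert_max finite_top_elems)
  qed
qed

lemma top_elems_eqI:
  assumes "finite S" "Z \<subseteq> S" "card Z = n" "\<And>x z. x \<in> S - Z \<Longrightarrow> z \<in> Z \<Longrightarrow> x < z"
  shows "top_elems n S = Z"
proof -
  have Z: "finite Z" using assms finite_subset by blast
  have "z \<in> top_elems n S" if "z \<in> Z" for z
  proof -
    have "{y \<in> S. z < y} \<subset> Z" using assms(4) that by force
    then have "card {y \<in> S. z < y} < n" using psubset_card_mono[OF Z] assms by blast
    then show ?thesis using that assms by (auto simp: top_elems_def)
  qed
  moreover have "x \<in> Z" if "x \<in> top_elems n S" for x
  proof (rule ccontr)
    assume "x \<notin> Z"
    then have "Z \<subseteq> {y \<in> S. x < y}" using assms that by (auto simp: top_elems_def)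
    then have "n \<le> card {y \<in> S. x < y}" using assms by (auto intro: card_mono)
    then show False using that by (simp add: top_elems_def)
  qed
  ultimately show ?thesis by blast
qed

lemma top_elems_remove_Min:
  assumes "finite S" "Suc n \<le> card S"
  shows "top_elems (Suc n) S - {Min (top_elems (Suc n) S)} = top_elems n S"
proof (rule sym, rule top_elems_eqI)
  let ?T = "top_elems (Suc n) S"
  have T: "finite ?T" "card ?T = Suc n" using assms by (auto intro: finite_top_elems card_top_elems)
  then have ne: "?T \<noteq> {}" by auto
  show "card (?T - {Min ?T}) = n" using T ne by simp
  fix x z assume x: "x \<in> S - (?T - {Min ?T})" and z: "z \<in> ?T - {Min ?T}"
  have mz: "Min ?T < z" using z T by (metis Diff_iff Min_le insert_iff order_less_le)
  show "x < z"
  proof (rule ccontr)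
    assume "\<not> x < z"
    then have "x \<in> ?T" using top_elems_upper[OF assms(1), of z _ x] x z by auto
    then show False using x mz \<open>\<not> x < z\<close> by auto
  qed
qed (use assms top_elems_subset in auto)

section \<open>Difference functionals on a grid and their dual kernels\<close>

definition preds :: "nat \<Rightarrow> real set \<Rightarrow> real \<Rightarrow> real set" where
  "preds n G s = top_elems n (G \<inter> {..<s})"

definition atoms :: "nat \<Rightarrow> real set \<Rightarrow> real set" where
  "atoms n G = {s \<in> G. n \<le> card (G \<inter> {..<s})}"

text \<open>By \<open>dd_weight_rec\<close> this is the divided difference over the \<open>n\<close>
  points ending at \<open>s\<close> minus the one over the \<open>n\<close> predecessors of
  \<open>s\<close>. Up to a factorial it plays the role of an increment of the derivative of order
  \<open>n - 1\<close>, and the factor in front is what makes sums over consecutive \<open>s\<close>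
  telescope.\<close>

definition diff_weight :: "nat \<Rightarrow> real set \<Rightarrow> real \<Rightarrow> real \<Rightarrow> real" where
  "diff_weight n G s x = (s - Min (preds n G s)) * dd_weight (insert s (preds n G s)) x"

text \<open>A grid version of the truncated power of order \<open>n - 1\<close> at \<open>s\<close>,
  whose equal factors are spread over the last \<open>n - 1\<close> grid points before
  \<open>s\<close>. It is dual to \<open>diff_weight\<close>: on atoms, the functional at
  \<open>z\<close> gives 1 on the kernel at \<open>z\<close> and 0 on the kernels at other
  points.\<close>

definition discrete_kernel :: "nat \<Rightarrow> real set \<Rightarrow> real \<Rightarrow> real \<Rightarrow> real" where
  "discrete_kernel n G s x =
     (if x < s then 0 else \<Prod>r\<in>preds n G s - {Min (preds n G s)}. x - r)"

lemma finite_preds: "finite G \<Longrightarrow> finite (preds n G s)"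
  by (simp add: preds_def finite_top_elems)

lemma finite_atoms: "finite G \<Longrightarrow> finite (atoms n G)"
  by (simp add: atoms_def)

lemma atoms_subset: "atoms n G \<subseteq> G"
  by (auto simp: atoms_def)

lemma preds_subset: "preds n G s \<subseteq> G \<inter> {..<s}"
  unfolding preds_def by (rule top_elems_subset)

lemma card_preds: "finite G \<Longrightarrow> s \<in> atoms n G \<Longrightarrow> card (preds n G s) = n"
  by (simp add: preds_def atoms_def card_top_elems)

lemma preds_insert_max:
  assumes "\<And>x. x \<in> G \<Longrightarrow> x < z" "s \<in> G"
  shows "preds n (insert z G) s = preds n G s"
proof -
  have "insert z G \<inter> {..<s} = G \<inter> {..<s}" using assms by fastforce
  then show ?thesis by (simp add: preds_def)
qed

lemma preds_max:
  assumes "\<And>x. x \<in> G \<Longrightarrow> x < z"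
  shows "preds n (insert z G) z = top_elems n G"
proof -
  have "insert z G \<inter> {..<z} = G" using assms by fastforce
  then show ?thesis by (simp add: preds_def)
qed

lemma atoms_insert_max:
  assumes "finite G" "\<And>x. x \<in> G \<Longrightarrow> x < z"
  shows "atoms n (insert z G) = (if n \<le> card G then insert z (atoms n G) else atoms n G)"
proof -
  have "insert z G \<inter> {..<s} = G \<inter> {..<s}" if "s \<in> G" for s using assms that by fastforce
  moreover have "insert z G \<inter> {..<z} = G" using assms by fastforce
  ultimately show ?thesis using assms(2) by (auto simp: atoms_def)
qed

lemma diff_weight_insert_max:
  assumes "\<And>x. x \<in> G \<Longrightarrow> x < z" "s \<in> G"
  shows "diff_weight n (insert z G) s x = diff_weight n G s x"
  using preds_insert_max[OF assms, of n] by (simp add: diff_weight_def)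

lemma discrete_kernel_insert_max:
  assumes "\<And>x. x \<in> G \<Longrightarrow> x < z" "s \<in> G"
  shows "discrete_kernel n (insert z G) s x = discrete_kernel n G s x"
  using preds_insert_max[OF assms, of n] by (simp add: discrete_kernel_def)

lemma diff_weight_outside:
  assumes "s \<in> G" "x \<notin> G"
  shows "diff_weight n G s x = 0"
proof -
  have "x \<notin> insert s (preds n G s)" using assms preds_subset[of n G s] by auto
  then show ?thesis by (simp add: diff_weight_def dd_weight_outside)
qed

lemma diff_weight_annihilates:
  assumes "finite G" "s \<in> atoms n G" "degree p < n"
  shows "(\<Sum>x\<in>G. diff_weight n G s x * poly p x) = 0"
proof -
  let ?N = "insert s (preds n G s)"
  have N: "?N \<subseteq> G" "finite ?N" "s \<notin> preds n G s"
    using assms preds_subset[of n G s] finite_preds[of G n s] atoms_subset[of n G] by auto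
  have "(\<Sum>x\<in>?N. dd_weight ?N x * poly p x) = 0"
    using assms N by (intro dd_sum_poly) (auto simp: card_preds finite_preds)
  then have "(\<Sum>x\<in>G. dd_weight ?N x * poly p x) = 0"
    unfolding dd_sum_superset[OF assms(1) N(1)] .
  then show ?thesis by (simp add: diff_weight_def mult.assoc flip: sum_distrib_left)
qed

text \<open>On the nodes of a later difference, a discrete kernel coincides with a polynomial: the
  intermediate grid points are zeros of its product.\<close>

lemma discrete_kernel_annihilated:
  assumes G: "finite G" and s: "s \<in> atoms n G" and z: "z \<in> atoms n G" and "s < z" "1 \<le> n"
  shows "(\<Sum>x\<in>G. diff_weight n G z x * discrete_kernel n G s x) = 0"
proof -
  let ?P = "preds n G s" and ?N = "insert z (preds n G z)"
  define q where "q = Min ?P"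
  have P: "finite ?P" "card ?P = n" "?P \<subseteq> G \<inter> {..<s}"
    using assms by (simp_all only: finite_preds card_preds preds_subset)
  have "?P \<noteq> {}" using P assms by auto
  then have q: "q \<in> ?P" "\<And>r. r \<in> ?P \<Longrightarrow> q \<le> r" using P by (auto simp: q_def)
  define p where "p = (\<Prod>r\<in>?P - {q}. [:- r, 1:])"
  have deg: "degree p < n"
    using P q assms by (simp add: p_def degree_prod_sum_eq sum.If_cases)
  \<comment> \<open>A node at or below \<open>q\<close> would put \<open>q\<close> among the
    \<open>n\<close> largest grid points before \<open>z\<close>. But \<open>s\<close> and the other
    \<open>n - 1\<close> predecessors of \<open>s\<close> are already \<open>n\<close> grid points
    strictly between \<open>q\<close> and \<open>z\<close>.\<close>
  have nodes: "q < x" if "x \<in> ?N" for x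
  proof (rule ccontr)
    assume "\<not> q < x"
    then have x: "x \<in> preds n G z" "x \<le> q" using that \<open>s < z\<close> q P by auto
    have "q \<in> G \<inter> {..<z}" using P(3) q(1) \<open>s < z\<close> by auto
    then have "q \<in> preds n G z"
      using top_elems_upper[OF _ x(1)[unfolded preds_def] _ x(2)] G by (simp add: preds_def)
    then have "card {y \<in> G \<inter> {..<z}. q < y} < n" by (simp add: preds_def top_elems_def)
    moreover have "insert s (?P - {q}) \<subseteq> {y \<in> G \<inter> {..<z}. q < y}"
      using P q s \<open>s < z\<close> atoms_subset[of n G] by (auto simp: order_less_le)
    then have "card (insert s (?P - {q})) \<le> card {y \<in> G \<inter> {..<z}. q < y}"
      using G by (intro card_mono) auto
    moreover have "s \<notin> ?P" using P by auto
    then have "card (insert s (?P - {q})) = n" using P q assms by simp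
    ultimately show False by simp
  qed
  have eq: "discrete_kernel n G s x = poly p x" if "x \<in> G" "q < x" for x
  proof (cases "x < s")
    case True
    have "x \<in> ?P" using top_elems_upper[OF _ q(1)[unfolded preds_def], of x] that True G
      by (simp add: preds_def)
    then have "x \<in> ?P - {q}" using that by auto
    then have "poly p x = 0" using P by (auto simp: p_def poly_prod intro!: prod_zero)
    then show ?thesis using True by (simp add: discrete_kernel_def)
  next
    case False
    then show ?thesis by (simp add: discrete_kernel_def p_def poly_prod q_def)
  qed
  have "diff_weight n G z x * discrete_kernel n G s x = diff_weight n G z x * poly p x" if "x \<in> G" for x
  proof (cases "x \<in> ?N")
    case True
    then show ?thesis using eq[OF that nodes] by simp
  next
    case False
    then show ?thesis by (simp add: diff_weight_def dd_weight_outside)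
  qed
  then have "(\<Sum>x\<in>G. diff_weight n G z x * discrete_kernel n G s x)
      = (\<Sum>x\<in>G. diff_weight n G z x * poly p x)" by (intro sum.cong) auto
  also have "\<dots> = 0" using G z deg by (rule diff_weight_annihilates)
  finally show ?thesis .
qed

lemma diff_weight_self:
  assumes "finite G" "s \<in> atoms n G" "1 \<le> n"
  shows "diff_weight n G s s * discrete_kernel n G s s = 1"
proof -
  let ?P = "preds n G s"
  have P: "finite ?P" "card ?P = n" "?P \<subseteq> G \<inter> {..<s}"
    using assms by (simp_all only: finite_preds card_preds preds_subset)
  have "?P \<noteq> {}" using P assms by auto
  then have q: "Min ?P \<in> ?P" using P by auto
  have "insert s ?P - {s} = ?P" using P by auto
  moreover have "(\<Prod>r\<in>?P. s - r) = (s - Min ?P) * (\<Prod>r\<in>?P - {Min ?P}. s - r)"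
    using P q by (subst prod.remove[of _ "Min ?P"]) auto
  moreover have "(\<Prod>r\<in>?P. s - r) \<noteq> 0" using P by auto
  ultimately show ?thesis by (simp add: diff_weight_def discrete_kernel_def dd_weight_def)
qed

text \<open>A discrete Peano kernel theorem, with coefficients dictated by duality. The induction
  removes the largest grid point \<open>z\<close>: subtracting \<open>c\<close> times the difference
  functional at \<open>z\<close> makes the weight vanish at \<open>z\<close> and preserves the
  annihilation of polynomials.\<close>

lemma discrete_taylor:
  assumes "finite G" "1 \<le> n"
    and "\<And>p. degree p < n \<Longrightarrow> (\<Sum>x\<in>G. w x * poly p x) = 0" and "x \<in> G"
  shows "w x = (\<Sum>s\<in>atoms n G. (\<Sum>y\<in>G. w y * discrete_kernel n G s y) * diff_weight n G s x)"
  using assms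
proof (induction G arbitrary: w x rule: finite_linorder_max_induct)
  case empty
  then show ?case by simp
next
  case (insert z G)
  let ?G = "insert z G"
  note lt = insert.hyps(2)[rule_format]
  have z: "z \<notin> G" using lt by auto
  show ?case
  proof (cases "n \<le> card G")
    case False
    have "card (G \<inter> {..<s}) \<le> card G" for s using insert.hyps by (intro card_mono) auto
    then have "atoms n ?G = {}" using False atoms_insert_max[OF insert.hyps(1) lt, of n]
      by (auto simp: atoms_def intro: le_trans)
    moreover have "w x = 0"
    proof -
      \<comment> \<open>Too few points for a difference: \<open>p\<close> vanishes on the grid
        except at \<open>x\<close> and has degree \<open>card G < n\<close>, so it isolates
        \<open>w x\<close>.\<close>
      define p where "p = (\<Prod>r\<in>?G - {x}. [:- r, 1:])"
      have "card (?G - {x}) = card G" using insert z by simp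
      then have "degree p < n"
        using False insert by (simp add: p_def degree_prod_sum_eq)
      then have "0 = (\<Sum>y\<in>?G. w y * poly p y)" using insert.prems by simp
      also have "\<dots> = (\<Sum>y\<in>{x}. w y * poly p y)"
        using insert.prems(3) insert.hyps
        by (intro sum.mono_neutral_right) (auto simp: p_def poly_prod)
      finally have "w x * (\<Prod>r\<in>?G - {x}. x - r) = 0" by (simp add: p_def poly_prod)
      then show ?thesis using insert.hyps by auto
    qed
    ultimately show ?thesis by simp
  next
    case True
    have at: "atoms n ?G = insert z (atoms n G)" "z \<in> atoms n ?G"
      using True insert.hyps by (auto simp: atoms_insert_max)
    have fin: "finite ?G" using insert by simp
    define c where "c = (\<Sum>y\<in>?G. w y * discrete_kernel n ?G z y)"
    define v where "v y = w y - c * diff_weight n ?G z y" for y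
    have c: "c = w z * discrete_kernel n ?G z z"
    proof -
      have "discrete_kernel n ?G z y = 0" if "y \<in> G" for y
        using lt[OF that] by (simp add: discrete_kernel_def)
      then show ?thesis using insert.hyps z by (simp add: c_def)
    qed
    have vz: "v z = 0"
      using diff_weight_self[OF fin at(2) \<open>1 \<le> n\<close>] by (simp add: v_def c algebra_simps)
    have vG: "(\<Sum>y\<in>?G. v y * \<phi> y) = (\<Sum>y\<in>G. v y * \<phi> y)" for \<phi>
      using vz z insert.hyps by simp
    have split: "(\<Sum>y\<in>?G. v y * \<phi> y) = (\<Sum>y\<in>?G. w y * \<phi> y) - c * (\<Sum>y\<in>?G. diff_weight n ?G z y * \<phi> y)" for \<phi>
      by (simp add: v_def algebra_simps sum_subtractf sum_distrib_left del: sum.insert)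
    have vp: "(\<Sum>y\<in>G. v y * poly p y) = 0" if "degree p < n" for p
      using insert.prems(2)[OF that] diff_weight_annihilates[OF fin at(2) that]
        vG[of "poly p"] split[of "poly p"] by simp
    have IH: "v y = (\<Sum>s\<in>atoms n G. (\<Sum>y\<in>G. v y * discrete_kernel n G s y) * diff_weight n G s y)"
      if "y \<in> G" for y
      by (rule insert.IH) (use vp that \<open>1 \<le> n\<close> in auto)
    \<comment> \<open>The earlier coefficients survive the subtraction, because the difference
      functional at \<open>z\<close> annihilates every earlier kernel.\<close>
    have inner: "(\<Sum>y\<in>G. v y * discrete_kernel n G s y) = (\<Sum>y\<in>?G. w y * discrete_kernel n ?G s y)"
      if s: "s \<in> atoms n G" for s
    proof -
      have sG: "s \<in> G" using s atoms_subset by blast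
      have "(\<Sum>y\<in>G. v y * discrete_kernel n G s y) = (\<Sum>y\<in>?G. v y * discrete_kernel n ?G s y)"
        unfolding vG using discrete_kernel_insert_max[OF lt sG] by simp
      also have "\<dots> = (\<Sum>y\<in>?G. w y * discrete_kernel n ?G s y)"
        unfolding split using discrete_kernel_annihilated[OF fin _ at(2) lt[OF sG] \<open>1 \<le> n\<close>] s at by simp
      finally show ?thesis .
    qed
    have eq: "v x = (\<Sum>s\<in>atoms n G. (\<Sum>y\<in>?G. w y * discrete_kernel n ?G s y) * diff_weight n ?G s x)"
    proof (cases "x = z")
      case True
      have "diff_weight n ?G s z = 0" if "s \<in> atoms n G" for s
      proof -
        have sG: "s \<in> G" using that atoms_subset by blast
        have "diff_weight n ?G s z = diff_weight n G s z" by (rule diff_weight_insert_max[OF lt sG])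
        then show ?thesis using diff_weight_outside[OF sG z] by simp
      qed
      then show ?thesis using vz True by simp
    next
      case False
      then have x: "x \<in> G" using insert.prems by simp
      have "diff_weight n ?G s x = diff_weight n G s x" if "s \<in> atoms n G" for s
        using that atoms_subset[of n G] by (intro diff_weight_insert_max[OF lt]) auto
      then show ?thesis using IH[OF x] inner by simp
    qed
    have "z \<notin> atoms n G" using z atoms_subset by blast
    then have "(\<Sum>s\<in>atoms n ?G. (\<Sum>y\<in>?G. w y * discrete_kernel n ?G s y) * diff_weight n ?G s x)
       = c * diff_weight n ?G z x + v x"
      using insert.hyps unfolding at eq c_def by (subst sum.insert) (auto simp: finite_atoms)
    then show ?thesis by (simp add: v_def)
  qed
qed

text \<open>Each summand replaces the window of the last \<open>n\<close> points before
  \<open>s\<close> by the window ending at \<open>s\<close>. As \<open>s\<close> runs through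
  \<open>E\<close>, the window slides from \<open>Y\<close> to the top of the grid, and the sum
  telescopes.\<close>

lemma sum_diff_weight:
  assumes "finite E" "finite Y" "card Y = n" "1 \<le> n" "\<And>y e. y \<in> Y \<Longrightarrow> e \<in> E \<Longrightarrow> y < e"
  shows "(\<Sum>s\<in>E. diff_weight n (Y \<union> E) s x) = dd_weight (top_elems n (Y \<union> E)) x - dd_weight Y x"
  using assms
proof (induction E rule: finite_linorder_max_induct)
  case empty
  have "top_elems n Y = Y" using empty by (intro top_elems_eqI) auto
  then show ?case by simp
next
  case (insert z E)
  let ?G = "Y \<union> E"
  have G: "finite ?G" "\<And>x. x \<in> ?G \<Longrightarrow> x < z" "Y \<union> insert z E = insert z ?G" using insert by auto
  have z: "z \<notin> E" "z \<notin> ?G" using G by auto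
  have card: "n \<le> card ?G" using insert.prems card_mono[OF G(1), of Y] by auto
  let ?T = "top_elems n ?G"
  obtain m where m: "n = Suc m" using insert.prems by (cases n) auto
  have T: "finite ?T" "card ?T = n" "?T \<subseteq> ?G"
    using G card by (simp_all only: finite_top_elems card_top_elems top_elems_subset)
  then have "?T \<noteq> {}" using m by auto
  then have q: "Min ?T \<in> ?T" using T by simp
  have zT: "z \<notin> ?T" using T z by auto
  have "top_elems n (insert z ?G) = insert z (?T - {Min ?T})"
    using top_elems_insert_max[of ?G z m] top_elems_remove_Min[of ?G m] G card m by simp
  also have "\<dots> = insert z ?T - {Min ?T}" using q zT by auto
  finally have top: "top_elems n (insert z ?G) = insert z ?T - {Min ?T}" .
  have "preds n (insert z ?G) z = ?T" by (rule preds_max[OF G(2)])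
  then have "diff_weight n (insert z ?G) z x = dd_weight (top_elems n (insert z ?G)) x - dd_weight ?T x"
    using dd_weight_rec[of "insert z ?T" "Min ?T" z x] T q zT
    by (simp add: top diff_weight_def)
  moreover have "(\<Sum>s\<in>E. diff_weight n (insert z ?G) s x) = (\<Sum>s\<in>E. diff_weight n ?G s x)"
    by (intro sum.cong refl diff_weight_insert_max[OF G(2)]) auto
  ultimately show ?case using insert z unfolding G(3) by simp
qed

text \<open>An atom already has its \<open>n\<close> predecessors in \<open>H\<close>: points below
  \<open>H\<close> come too late to be among them, and points above \<open>s\<close> are never
  consulted.\<close>

lemma diff_weight_extend:
  assumes "finite H" "s \<in> atoms n H"
    and "\<And>y e. y \<in> Y \<Longrightarrow> e \<in> H \<Longrightarrow> y < e" "\<And>e z. e \<in> H \<Longrightarrow> z \<in> Z \<Longrightarrow> e < z" "finite Y"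
  shows "diff_weight n (Y \<union> (H \<union> Z)) s = diff_weight n H s"
proof -
  have sH: "s \<in> H" using assms atoms_subset by blast
  have eq: "(Y \<union> (H \<union> Z)) \<inter> {..<s} = Y \<union> (H \<inter> {..<s})"
    using assms(3)[OF _ sH] assms(4)[OF sH] by fastforce
  let ?T = "preds n H s"
  have "preds n (Y \<union> (H \<union> Z)) s = ?T"
    unfolding preds_def[of n "Y \<union> (H \<union> Z)"] eq
  proof (rule top_elems_eqI)
    fix x z assume x: "x \<in> Y \<union> H \<inter> {..<s} - ?T" and z: "z \<in> ?T"
    show "x < z"
    proof (cases "x \<in> Y")
      case True
      then show ?thesis using z assms(3) preds_subset[of n H s] by auto
    next
      case False
      then show ?thesis using x z top_elems_upper[of "H \<inter> {..<s}" z n x] assms(1)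
        by (force simp: preds_def)
    qed
  qed (use assms preds_subset[of n H s] in \<open>auto simp: card_preds\<close>)
  then show ?thesis by (simp add: diff_weight_def fun_eq_iff)
qed

section \<open>A compact set of reals mapping onto every box\<close>

definition cantor_space :: "(nat \<Rightarrow> real) set" where
  "cantor_space = PiE UNIV (\<lambda>_. {0, 1})"

text \<open>\<open>h\<close> selects a subsequence of the digits. Base 3 with all digits embeds the
  Cantor space in the line; base 2 with the digits \<open>k * d + i\<close> reads off the
  \<open>i\<close>-th of \<open>d\<close> interleaved binary expansions.\<close>

definition digit_series :: "real \<Rightarrow> (nat \<Rightarrow> nat) \<Rightarrow> (nat \<Rightarrow> real) \<Rightarrow> real" where
  "digit_series q h b = (\<Sum>k. b (h k) / q ^ Suc k)"

lemma compact_cantor_space: "compact cantor_space"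
proof -
  have "compactin (product_topology (\<lambda>i::nat. euclidean :: real topology) UNIV) (PiE UNIV (\<lambda>_. {0, 1}))"
    by (auto simp: compactin_PiE compactin_euclidean_iff finite_imp_compact)
  then show ?thesis by (simp add: euclidean_product_topology cantor_space_def)
qed

lemma cantor_space_bounds: "b \<in> cantor_space \<Longrightarrow> b k = 0 \<or> b k = 1"
  by (auto simp: cantor_space_def PiE_iff)

lemma digit_series_summable:
  assumes "b \<in> cantor_space" "1 < q"
  shows "summable (\<lambda>k. b (h k) / q ^ Suc k)"
proof (rule summable_comparison_test')
  show "summable (\<lambda>k. (1 / q) ^ Suc k)" using assms by (subst summable_Suc_iff) simp
  show "norm (b (h k) / q ^ Suc k) \<le> (1 / q) ^ Suc k" for k
    using cantor_space_bounds[OF assms(1), of "h k"] assms(2)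
    by (auto simp: power_one_over abs_mult)
qed

lemma geometric_tail:
  fixes q :: real
  assumes "1 < q"
  shows "(\<lambda>k. 1 / q ^ Suc k) sums (1 / (q - 1))"
proof -
  have "(\<lambda>k. (1 / q) * (1 / q) ^ k) sums ((1 / q) * (1 / (1 - 1 / q)))"
    using assms by (intro sums_mult geometric_sums) auto
  moreover have "(1 / q) * (1 / (1 - 1 / q)) = 1 / (q - 1)" using assms by (simp add: field_simps)
  ultimately show ?thesis by (simp add: power_one_over)
qed

lemma digit_series_bounds:
  assumes "b \<in> cantor_space" "1 < q"
  shows "0 \<le> digit_series q h b" "digit_series q h b \<le> 1 / (q - 1)"
proof -
  note s = digit_series_summable[OF assms, of h]
  note b = cantor_space_bounds[OF assms(1)]
  show "0 \<le> digit_series q h b"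
    unfolding digit_series_def
  proof (rule suminf_nonneg[OF s])
    show "0 \<le> b (h k) / q ^ Suc k" for k using b[of "h k"] assms(2) by (auto simp del: power_Suc)
  qed
  have "(\<Sum>k. b (h k) / q ^ Suc k) \<le> (\<Sum>k. 1 / q ^ Suc k)"
  proof (rule suminf_le[OF _ s])
    show "b (h k) / q ^ Suc k \<le> 1 / q ^ Suc k" for k using b[of "h k"] assms(2) by (auto simp del: power_Suc)
    show "summable (\<lambda>k. 1 / q ^ Suc k)" using geometric_tail[OF assms(2)] by (rule sums_summable)
  qed
  then show "digit_series q h b \<le> 1 / (q - 1)"
    using geometric_tail[OF assms(2)] by (simp add: digit_series_def sums_iff)
qed

lemma continuous_on_digit_series:
  assumes "1 < q"
  shows "continuous_on cantor_space (digit_series q h)"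
proof -
  have "uniform_limit cantor_space (\<lambda>n b. \<Sum>k<n. b (h k) / q ^ Suc k)
      (\<lambda>b. \<Sum>k. b (h k) / q ^ Suc k) sequentially"
  proof (rule Weierstrass_m_test)
    show "norm (b (h k) / q ^ Suc k) \<le> 1 / q ^ Suc k" if "b \<in> cantor_space" for k b
      using cantor_space_bounds[OF that, of "h k"] assms by (auto simp del: power_Suc)
    show "summable (\<lambda>k. 1 / q ^ Suc k)" using geometric_tail[OF assms] by (rule sums_summable)
  qed
  moreover have "continuous_on cantor_space (\<lambda>b. \<Sum>k<n. b (h k) / q ^ Suc k)" for n
    using assms by (intro continuous_intros continuous_on_product_then_coordinatewise continuous_on_id) auto
  ultimately have "continuous_on cantor_space (\<lambda>b. \<Sum>k. b (h k) / q ^ Suc k)"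
    by (intro uniform_limit_theorem[OF always_eventually]) auto
  then show ?thesis by (simp add: digit_series_def[abs_def])
qed

text \<open>A first difference at position \<open>k\<close> contributes
  \<open>1 / 3 ^ Suc k\<close>, and all later digits together can take back at most half of
  it.\<close>

lemma inj_on_ternary: "inj_on (digit_series 3 (\<lambda>k. k)) cantor_space"
proof -
  have less: "digit_series 3 (\<lambda>k. k) b' < digit_series 3 (\<lambda>k. k) b"
    if C: "b \<in> cantor_space" "b' \<in> cantor_space" and k: "b k = 1" "b' k = 0" "\<And>j. j < k \<Longrightarrow> b j = b' j"
    for b b' k
  proof -
    define D :: real where "D = 1 / 3 ^ Suc k"
    define u where "u j = b j / 3 ^ Suc j - b' j / 3 ^ Suc j" for j
    note s = digit_series_summable[OF C(1), of 3 "\<lambda>k. k", simplified]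
      digit_series_summable[OF C(2), of 3 "\<lambda>k. k", simplified]
    have su: "summable u" unfolding u_def using s by (intro summable_diff) auto
    have "(\<Sum>j. u j) = digit_series 3 (\<lambda>k. k) b - digit_series 3 (\<lambda>k. k) b'"
      unfolding u_def digit_series_def using s by (intro suminf_diff[symmetric]) auto
    moreover have "(\<Sum>j. u j) = (\<Sum>j. u (j + Suc k)) + (\<Sum>j<Suc k. u j)"
      by (rule suminf_split_initial_segment[OF su])
    moreover have "(\<Sum>j<Suc k. u j) = D" using k by (simp add: u_def D_def)
    moreover have "(\<Sum>j. - D * (1 / 3 ^ Suc j)) \<le> (\<Sum>j. u (j + Suc k))"
    proof (rule suminf_le)
      show "- D * (1 / 3 ^ Suc j) \<le> u (j + Suc k)" for j
        using cantor_space_bounds[OF C(1), of "j + Suc k"] cantor_space_bounds[OF C(2), of "j + Suc k"]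
        by (auto simp: u_def D_def power_add mult.commute[of "3 ^ j"])
      show "summable (\<lambda>j. u (j + Suc k))" using su by (subst summable_iff_shift)
      show "summable (\<lambda>j. - D * (1 / 3 ^ Suc j))"
        using sums_mult[OF geometric_tail[of 3], of "- D"] by (simp add: sums_iff)
    qed
    moreover have "(\<Sum>j. - D * (1 / 3 ^ Suc j)) = - D / 2"
      using sums_mult[OF geometric_tail[of 3], of "- D"] by (simp add: sums_iff)
    moreover have "0 < D" by (simp add: D_def)
    ultimately show ?thesis by linarith
  qed
  show ?thesis
  proof (rule inj_onI, rule ccontr)
    fix b b' assume C: "b \<in> cantor_space" "b' \<in> cantor_space"
      and eq: "digit_series 3 (\<lambda>k. k) b = digit_series 3 (\<lambda>k. k) b'" and "b \<noteq> b'"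
    then obtain k0 where "b k0 \<noteq> b' k0" by auto
    define k where "k = (LEAST k. b k \<noteq> b' k)"
    have k: "b k \<noteq> b' k" "\<And>j. j < k \<Longrightarrow> b j = b' j"
      using LeastI[of "\<lambda>k. b k \<noteq> b' k", OF \<open>b k0 \<noteq> b' k0\<close>]
      unfolding k_def by (blast dest: not_less_Least)+
    consider "b k = 1" "b' k = 0" | "b k = 0" "b' k = 1"
      using k(1) cantor_space_bounds[OF C(1), of k] cantor_space_bounds[OF C(2), of k] by metis
    then show False
    proof cases
      case 1
      then show ?thesis using less[OF C 1 k(2)] eq by simp
    next
      case 2
      then show ?thesis using less[OF C(2,1) 2(2,1) k(2)[symmetric]] eq by simp
    qed
  qed
qed

lemma binary_expansion:
  assumes "0 \<le> x" "x \<le> 1"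
  shows "\<exists>a :: nat \<Rightarrow> real. (\<forall>k. a k = 0 \<or> a k = 1) \<and> (\<lambda>k. a k / 2 ^ Suc k) sums x"
proof (cases "x = 1")
  \<comment> \<open>The floor construction telescopes from \<open>s 0 = 0\<close>, which fails at
    \<open>x = 1\<close>; there all digits are 1.\<close>
  case True
  then show ?thesis using geometric_tail[of 2] by (intro exI[of _ "\<lambda>_. 1"]) simp
next
  case False
  define s where "s k = real_of_int \<lfloor>2 ^ k * x\<rfloor> / 2 ^ k" for k
  define a where "a k = real_of_int (\<lfloor>2 ^ Suc k * x\<rfloor> - 2 * \<lfloor>2 ^ k * x\<rfloor>)" for k
  have "a k = 0 \<or> a k = 1" for k
  proof -
    have "\<lfloor>2 * (2 ^ k * x)\<rfloor> - 2 * \<lfloor>2 ^ k * x\<rfloor> \<in> {0, 1}" by (simp; linarith)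
    then show ?thesis by (auto simp: a_def mult.assoc)
  qed
  moreover have "s \<longlonglongrightarrow> x"
  proof (rule real_tendsto_sandwich[OF always_eventually always_eventually _ tendsto_const])
    show "\<forall>k. x - (1 / 2) ^ k \<le> s k"
    proof
      fix k
      have "2 ^ k * x - 1 \<le> real_of_int \<lfloor>2 ^ k * x\<rfloor>" by linarith
      then have "(2 ^ k * x - 1) / 2 ^ k \<le> s k" unfolding s_def by (intro divide_right_mono) auto
      then show "x - (1 / 2) ^ k \<le> s k" by (simp add: diff_divide_distrib power_one_over)
    qed
    show "\<forall>k. s k \<le> x" by (simp add: s_def field_simps)
    have "(\<lambda>k. x - (1 / 2) ^ k) \<longlonglongrightarrow> x - 0"
      by (intro tendsto_intros LIMSEQ_power_zero) simp
    then show "(\<lambda>k. x - (1 / 2) ^ k) \<longlonglongrightarrow> x" by simp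
  qed
  then have "(\<lambda>k. s (Suc k) - s k) sums (x - s 0)" by (rule telescope_sums)
  moreover have "\<lfloor>x\<rfloor> = 0" using assms False by (simp add: floor_eq_iff)
  then have "s 0 = 0" by (simp add: s_def)
  moreover have "s (Suc k) - s k = a k / 2 ^ Suc k" for k by (simp add: s_def a_def field_simps)
  ultimately show ?thesis by (intro exI[of _ a]) simp
qed

text \<open>The digits of one 0-1 sequence are dealt out to the \<open>d\<close> coordinates, which
  maps the Cantor space onto any box. The ternary map embeds the same space in the line, with
  continuous inverse by compactness. One \<open>K\<close> serves all boxes, since the sides enter
  only through affine maps.\<close>

lemma exists_compact_onto_boxes:
  fixes d :: nat
  assumes "1 \<le> d"
  obtains K :: "real set" where "compact K" "K \<subseteq> {0..1}"
    and "\<forall>a b :: nat \<Rightarrow> real. (\<forall>i<d. a i \<le> b i) \<longrightarrow>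
      (\<exists>\<gamma>. continuous_on K \<gamma> \<and> \<gamma> ` K = PiE {..<d} (\<lambda>i. {a i..b i}))"
proof
  define e where "e = digit_series 3 (\<lambda>k. k)"
  have e: "continuous_on cantor_space e" unfolding e_def by (rule continuous_on_digit_series) simp
  let ?K = "e ` cantor_space"
  show "compact ?K" using e compact_cantor_space by (rule compact_continuous_image)
  show "?K \<subseteq> {0..1}" using digit_series_bounds[of _ 3 "\<lambda>k. k"] by (force simp: e_def)
  show "\<forall>a b :: nat \<Rightarrow> real. (\<forall>i<d. a i \<le> b i) \<longrightarrow>
      (\<exists>\<gamma>. continuous_on ?K \<gamma> \<and> \<gamma> ` ?K = PiE {..<d} (\<lambda>i. {a i..b i}))"
  proof (intro allI impI)
    fix a b :: "nat \<Rightarrow> real" assume "\<forall>i<d. a i \<le> b i"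
    then have ab: "\<And>i. i < d \<Longrightarrow> a i \<le> b i" by simp
    define g where "g c = (\<lambda>i. if i < d then a i + (b i - a i) * digit_series 2 (\<lambda>k. k * d + i) c else undefined)"
      for c
    have g: "continuous_on cantor_space g"
    proof (rule continuous_on_coordinatewise_then_product)
      fix i
      show "continuous_on cantor_space (\<lambda>c. g c i)"
      proof (cases "i < d")
        case True
        then show ?thesis by (simp add: g_def) (intro continuous_intros continuous_on_digit_series; simp)
      qed (simp add: g_def)
    qed
    have im: "g ` cantor_space = PiE {..<d} (\<lambda>i. {a i..b i})"
    proof (intro equalityI subsetI)
      fix y assume "y \<in> g ` cantor_space"
      then obtain c where c: "c \<in> cantor_space" "y = g c" by auto
      have "a i \<le> g c i \<and> g c i \<le> b i" if "i < d" for i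
      proof -
        have s: "0 \<le> digit_series 2 (\<lambda>k. k * d + i) c" "digit_series 2 (\<lambda>k. k * d + i) c \<le> 1"
          using digit_series_bounds[OF c(1), of 2 "\<lambda>k. k * d + i"] by auto
        have "(b i - a i) * digit_series 2 (\<lambda>k. k * d + i) c \<le> b i - a i"
          using s ab[OF that] by (simp add: mult_left_le)
        moreover have "0 \<le> (b i - a i) * digit_series 2 (\<lambda>k. k * d + i) c" using s ab[OF that] by simp
        ultimately show ?thesis using that by (simp add: g_def)
      qed
      then show "y \<in> PiE {..<d} (\<lambda>i. {a i..b i})" using c by (auto simp: PiE_iff extensional_def g_def)
    next
      fix y assume y: "y \<in> PiE {..<d} (\<lambda>i. {a i..b i})"
      have "\<exists>z :: nat \<Rightarrow> real. (\<forall>k. z k = 0 \<or> z k = 1) \<and>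
         (i < d \<longrightarrow> a i + (b i - a i) * (\<Sum>k. z k / 2 ^ Suc k) = y i)" for i
      proof (cases "i < d")
        case True
        have yi: "a i \<le> y i" "y i \<le> b i" using y True by (auto simp: PiE_iff)
        define x where "x = (if a i = b i then 0 else (y i - a i) / (b i - a i))"
        have "0 \<le> x" "x \<le> 1" "a i + (b i - a i) * x = y i" using yi by (auto simp: x_def)
        moreover obtain z :: "nat \<Rightarrow> real" where "\<forall>k. z k = 0 \<or> z k = 1" "(\<lambda>k. z k / 2 ^ Suc k) sums x"
          using binary_expansion[OF \<open>0 \<le> x\<close> \<open>x \<le> 1\<close>] by blast
        ultimately show ?thesis by (intro exI[of _ z]) (auto simp: sums_iff)
      qed auto
      then obtain z :: "nat \<Rightarrow> nat \<Rightarrow> real" where z: "\<And>i k. z i k = 0 \<or> z i k = 1"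
        "\<And>i. i < d \<Longrightarrow> a i + (b i - a i) * (\<Sum>k. z i k / 2 ^ Suc k) = y i" by metis
      define c where "c j = z (j mod d) (j div d)" for j
      have "c \<in> cantor_space" using z(1)  using z(1) by (simp add: cantor_space_def c_def PiE_iff)
      moreover have "g c = y"
      proof
        fix i
        have "c (k * d + i) = z i k" if "i < d" for k using that by (simp add: c_def)
        then show "g c i = y i"
          using z(2)[of i] y by (auto simp: g_def digit_series_def PiE_iff extensional_def)
      qed
      ultimately show "y \<in> g ` cantor_space" by blast
    qed
    let ?e' = "inv_into cantor_space e"
    have inv: "?e' (e c) = c" if "c \<in> cantor_space" for c
      using that inj_on_ternary by (simp add: e_def)
    have "continuous_on ?K ?e'"
      by (rule continuous_on_inv[OF e compact_cantor_space]) (use inv in auto)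
    moreover have "?e' ` ?K = cantor_space" using inv by (force simp: image_image)
    ultimately have "continuous_on ?K (g \<circ> ?e')" "(g \<circ> ?e') ` ?K = PiE {..<d} (\<lambda>i. {a i..b i})"
      using g im by (auto intro!: continuous_on_compose simp only: image_comp[symmetric])
    then show "\<exists>\<gamma>. continuous_on ?K \<gamma> \<and> \<gamma> ` ?K = PiE {..<d} (\<lambda>i. {a i..b i})" by blast
  qed
qed

section \<open>Vague compactness\<close>

text \<open>Masses in the shell \<open>X m - X (m - 1)\<close> are lifted to the interval \<open>[2 m, 2 m + 1]\<close> and scaled
  so that the total mass beyond \<open>2 m\<close> is at most \<open>2 ^ - m\<close>; this makes the lifted measures tight,
  and Helly's theorem on the real line applies.\<close>

lemma vague_compactness:
  fixes X :: "nat \<Rightarrow> 'a::t2_space set" and K :: "real set"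
  assumes K: "compact K" "K \<subseteq> {0..1}"
    and \<gamma>: "\<And>m. continuous_on K (\<gamma> m)" "\<And>m. \<gamma> m ` K = X m"
    and X: "\<And>m. X m \<subseteq> X (Suc m)"
    and A: "\<And>N. finite (A N)" "\<And>N. A N \<subseteq> (\<Union>m. X m)"
    and c: "\<And>N \<sigma>. \<sigma> \<in> A N \<Longrightarrow> 0 \<le> c N \<sigma>"
    and M: "\<And>N m. (\<Sum>\<sigma>\<in>A N \<inter> X m. c N \<sigma>) \<le> M m"
  obtains r :: "nat \<Rightarrow> nat" and \<mu> :: "'a measure"
  where "strict_mono r" "sets \<mu> = sets borel" "emeasure \<mu> (- (\<Union>m. X m)) = 0"
    and "\<forall>\<phi> m. continuous_on UNIV \<phi> \<longrightarrow> (\<forall>x\<in>(\<Union>m. X m) - X m. \<phi> x = 0) \<longrightarrow>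
      integrable \<mu> \<phi> \<and> (\<lambda>N. \<Sum>\<sigma>\<in>A (r N). c (r N) \<sigma> * \<phi> \<sigma>) \<longlonglongrightarrow> (\<integral>x. \<phi> x \<partial>\<mu> :: real)"
proof -
  define lev where "lev \<sigma> = (LEAST m. \<sigma> \<in> X m)" for \<sigma>
  have lev: "\<sigma> \<in> X (lev \<sigma>)" if "\<sigma> \<in> (\<Union>m. X m)" for \<sigma>
    using that unfolding lev_def by (auto intro: LeastI)
  have lev_le: "lev \<sigma> \<le> m" if "\<sigma> \<in> X m" for \<sigma> m using that unfolding lev_def by (rule Least_le)
  have mono: "X m \<subseteq> X m'" if "m \<le> m'" for m m' using that X by (rule lift_Suc_mono_le[rotated])
  have "\<exists>t. t \<in> K \<and> \<gamma> (lev \<sigma>) t = \<sigma>" if "\<sigma> \<in> (\<Union>m. X m)" for \<sigma>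
    using lev[OF that] unfolding \<gamma>(2)[symmetric] by auto
  then obtain pre where pre: "\<And>\<sigma>. \<sigma> \<in> (\<Union>m. X m) \<Longrightarrow> pre \<sigma> \<in> K \<and> \<gamma> (lev \<sigma>) (pre \<sigma>) = \<sigma>" by metis
  define lift where "lift \<sigma> = 2 * real (lev \<sigma>) + pre \<sigma>" for \<sigma>
  have M0: "0 \<le> M m" for m
    using order_trans[OF sum_nonneg M[of 0 m]] c by auto
  \<comment> \<open>The scaled mass of shell \<open>m\<close> is at most
    \<open>1 / 2 ^ Suc m\<close>; the summand 1 keeps the quotient meaningful when
    \<open>M m = 0\<close>.\<close>
  define w where "w m = 1 / (2 ^ Suc m * (1 + M m))" for m
  have w: "0 < w m" "w m * M m \<le> 1 / 2 ^ Suc m" for m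
  proof -
    show "0 < w m" using M0[of m] by (simp add: w_def add_pos_nonneg)
    have "w m * M m = M m / (1 + M m) * (1 / 2 ^ Suc m)" by (simp add: w_def)
    also have "\<dots> \<le> 1 * (1 / 2 ^ Suc m)" using M0[of m] by (intro mult_right_mono) auto
    finally show "w m * M m \<le> 1 / 2 ^ Suc m" by simp
  qed
  define p where "p N \<sigma> = c N \<sigma> * w (lev \<sigma>)" for N \<sigma>
  have p0: "0 \<le> p N \<sigma>" if "\<sigma> \<in> A N" for N \<sigma> using c[OF that] w(1)[of "lev \<sigma>"] by (simp add: p_def)
  have tail: "(\<Sum>\<sigma>\<in>{\<sigma>\<in>A N. k \<le> lev \<sigma>}. p N \<sigma>) \<le> 1 / 2 ^ k" for N k
  proof -
    let ?B = "{\<sigma>\<in>A N. k \<le> lev \<sigma>}"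
    obtain q where q: "\<And>\<sigma>. \<sigma> \<in> A N \<Longrightarrow> lev \<sigma> < q"
      using A(1)[of N] by (metis finite_imageI finite_nat_set_iff_bounded imageI)
    have "(\<Sum>\<sigma>\<in>?B. p N \<sigma>) = (\<Sum>m\<in>{k..<max k q}. \<Sum>\<sigma>\<in>{\<sigma>\<in>?B. lev \<sigma> = m}. p N \<sigma>)"
      using A(1) q by (intro sum.group[symmetric]) (auto simp: less_max_iff_disj)
    also have "\<dots> \<le> (\<Sum>m\<in>{k..<max k q}. 1 / 2 ^ m - 1 / 2 ^ Suc m)"
    proof (rule sum_mono)
      fix m assume "m \<in> {k..<max k q}"
      have "(\<Sum>\<sigma>\<in>{\<sigma>\<in>?B. lev \<sigma> = m}. p N \<sigma>) = w m * (\<Sum>\<sigma>\<in>{\<sigma>\<in>?B. lev \<sigma> = m}. c N \<sigma>)"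
        unfolding sum_distrib_left by (intro sum.cong) (auto simp: p_def)
      also have "(\<Sum>\<sigma>\<in>{\<sigma>\<in>?B. lev \<sigma> = m}. c N \<sigma>) \<le> (\<Sum>\<sigma>\<in>A N \<inter> X m. c N \<sigma>)"
        using A c lev by (intro sum_mono2) (auto, blast)
      also have "\<dots> \<le> M m" by (rule M)
      finally show "(\<Sum>\<sigma>\<in>{\<sigma>\<in>?B. lev \<sigma> = m}. p N \<sigma>) \<le> 1 / 2 ^ m - 1 / 2 ^ Suc m"
        using w[of m] by simp
    qed
    also have "\<dots> = 1 / 2 ^ k - 1 / 2 ^ max k q"
      using sum_Suc_diff'[of k "max k q" "\<lambda>m. - (1 / 2 ^ m :: real)"] by (simp del: power_Suc)
    also have "\<dots> \<le> 1 / 2 ^ k" by simp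
    finally show ?thesis .
  qed
  define tot where "tot N = (\<Sum>\<sigma>\<in>A N. p N \<sigma>)" for N
  have tot: "0 \<le> tot N" "tot N \<le> 1" for N
    using tail[where N = N and k = 0] p0 by (auto simp: tot_def intro: sum_nonneg)

  \<comment> \<open>Helly's theorem concerns probability measures, so the missing mass
    \<open>1 - tot N\<close> is placed at -1, away from all lifted points, under the label
    \<open>None\<close>.\<close>
  define S where "S N = insert None (Some ` A N)" for N
  define pp where "pp N s = (case s of None \<Rightarrow> 1 - tot N | Some \<sigma> \<Rightarrow> p N \<sigma>)" for N s
  define L where "L s = (case s of None \<Rightarrow> -1 | Some \<sigma> \<Rightarrow> lift \<sigma>)" for s
  define Q where "Q N = distr (point_measure (S N) (pp N)) borel L" for N
  have S: "finite (S N)" "\<And>s. s \<in> S N \<Longrightarrow> 0 \<le> pp N s" for N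
    using A(1) tot p0 by (auto simp: S_def pp_def)
  have sumS: "(\<Sum>s\<in>S N. pp N s * h s) = (1 - tot N) * h None + (\<Sum>\<sigma>\<in>A N. p N \<sigma> * h (Some \<sigma>))" for N h
    using A(1) by (simp add: S_def pp_def sum.reindex)
  have "prob_space (point_measure (S N) (pp N))" for N
    using S sumS[of N "\<lambda>_. 1"] by (intro prob_space_point_measure) (auto simp: tot_def)
  then have Q: "real_distribution (Q N)" for N
    unfolding Q_def by (intro prob_space.real_distribution_distr) auto
  have Qint: "(\<integral>t. \<psi> t \<partial>Q N) = (1 - tot N) * \<psi> (-1) + (\<Sum>\<sigma>\<in>A N. p N \<sigma> * \<psi> (lift \<sigma>))"
    if [measurable]: "\<psi> \<in> borel_measurable borel" for N and \<psi> :: "real \<Rightarrow> real"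
  proof -
    have "(\<integral>t. \<psi> t \<partial>Q N) = (\<integral>s. \<psi> (L s) \<partial>point_measure (S N) (pp N))"
      unfolding Q_def by (subst integral_distr) auto
    also have "\<dots> = (\<Sum>s\<in>S N. pp N s * \<psi> (L s))"
      using S by (subst lebesgue_integral_point_measure_finite) auto
    finally show ?thesis using sumS[of N "\<lambda>s. \<psi> (L s)"] by (simp add: L_def)
  qed
  have lift: "2 * real (lev \<sigma>) \<le> lift \<sigma>" "lift \<sigma> \<le> 2 * real (lev \<sigma>) + 1"
    if "\<sigma> \<in> (\<Union>m. X m)" for \<sigma>
    using pre[OF that] K(2) by (auto simp: lift_def)
  have "tight Q"
    unfolding tight_def
  proof (intro conjI allI impI Q)
    fix \<epsilon> :: real assume "0 < \<epsilon>"
    then obtain k where k: "(1 / 2) ^ k < \<epsilon>" using real_arch_pow_inv[of \<epsilon> "1 / 2"] by auto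
    have "1 - \<epsilon> < measure (Q N) {-2<..2 * real k + 1}" for N
    proof -
      interpret Q: real_distribution "Q N" by (rule Q)
      have "measure (Q N) {-2<..2 * real k + 1} = (\<integral>t. indicator {-2<..2 * real k + 1} t \<partial>Q N)" by simp
      also have "\<dots> = (1 - tot N) + (\<Sum>\<sigma>\<in>A N. p N \<sigma> * indicator {-2<..2 * real k + 1} (lift \<sigma>))"
        by (subst Qint) auto
      also have "(\<Sum>\<sigma>\<in>A N. p N \<sigma> * indicator {-2<..2 * real k + 1} (lift \<sigma>)) \<ge>
          (\<Sum>\<sigma>\<in>A N. p N \<sigma> - (if k \<le> lev \<sigma> then p N \<sigma> else 0))"
      proof (rule sum_mono)
        fix \<sigma> assume \<sigma>: "\<sigma> \<in> A N"
        then have "\<sigma> \<in> (\<Union>m. X m)" using A by blast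
        note l = lift[OF this]
        have "\<not> k \<le> lev \<sigma> \<Longrightarrow> lift \<sigma> \<in> {-2<..2 * real k + 1}" using l by simp
        then show "p N \<sigma> - (if k \<le> lev \<sigma> then p N \<sigma> else 0) \<le> p N \<sigma> * indicator {-2<..2 * real k + 1} (lift \<sigma>)"
          using p0[OF \<sigma>] by auto
      qed
      moreover have "(\<Sum>\<sigma>\<in>A N. p N \<sigma> - (if k \<le> lev \<sigma> then p N \<sigma> else 0)) =
          tot N - (\<Sum>\<sigma>\<in>{\<sigma>\<in>A N. k \<le> lev \<sigma>}. p N \<sigma>)"
        using A(1) by (simp add: sum_subtractf tot_def sum.inter_filter)
      ultimately show ?thesis using tail[where N = N and k = k] k by (simp add: power_one_over)
    qed
    then show "\<exists>a b. a < b \<and> (\<forall>N. 1 - \<epsilon> < measure (Q N) {a<..b})"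
      by (intro exI[of _ "-2"] exI[of _ "2 * real k + 1"]) auto
  qed
  then obtain r P where r: "strict_mono (r :: nat \<Rightarrow> nat)" and P: "real_distribution P"
    and conv: "weak_conv_m (Q \<circ> id \<circ> r) P"
    using tight_imp_convergent_subsubsequence[of Q id] by (auto simp: strict_mono_def)
  interpret P: real_distribution P by (rule P)
  have lim: "(\<lambda>N. \<integral>t. \<psi> t \<partial>Q (r N)) \<longlonglongrightarrow> (\<integral>t. \<psi> t \<partial>P)"
    if "continuous_on UNIV \<psi>" "\<And>t. \<bar>\<psi> t\<bar> \<le> B" for \<psi> :: "real \<Rightarrow> real" and B
    using weak_conv_imp_integral_bdd_continuous_conv[of "\<lambda>N. Q (r N)" P \<psi> B] Q P conv that
    by (simp add: comp_def continuous_on_eq_continuous_at)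

  define T where "T = closure (insert (-1) (lift ` (\<Union>m. X m)))"
  have T: "closed T" "T \<noteq> {}" "-1 \<in> T" "\<And>\<sigma>. \<sigma> \<in> (\<Union>m. X m) \<Longrightarrow> lift \<sigma> \<in> T"
    by (auto simp: T_def intro: closure_subset[THEN subsetD])
  \<comment> \<open>The truncated distance to \<open>T\<close> is bounded and continuous and
    integrates to 0 against every \<open>Q N\<close>, hence also against the weak limit.\<close>
  have AE_T: "AE t in P. t \<in> T"
  proof -
    define \<psi> where "\<psi> t = min 1 (infdist t T)" for t
    have cont: "continuous_on UNIV \<psi>" unfolding \<psi>_def by (intro continuous_intros)
    then have [measurable]: "\<psi> \<in> borel_measurable borel" by (rule borel_measurable_continuous_onI)
    have b: "0 \<le> \<psi> t" "\<bar>\<psi> t\<bar> \<le> 1" for t by (auto simp: \<psi>_def infdist_nonneg)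
    have "\<psi> t = 0" if "t \<in> T" for t using that by (simp add: \<psi>_def)
    moreover have "lift \<sigma> \<in> T" if "\<sigma> \<in> A N" for \<sigma> N using A(2)[of N] that T(4) by blast
    ultimately have "(\<integral>t. \<psi> t \<partial>Q N) = 0" for N
      using T(3) by (subst Qint) (auto intro!: sum.neutral)
    then have "(\<integral>t. \<psi> t \<partial>P) = 0" using lim[OF cont b(2)] LIMSEQ_unique[OF _ tendsto_const] by auto
    moreover have "integrable P \<psi>" using b by (intro P.integrable_const_bound[of _ 1]) auto
    ultimately have "AE t in P. \<psi> t = 0" using integral_nonneg_eq_0_iff_AE[of P \<psi>] b by auto
    then show ?thesis
    proof (rule AE_mp, intro AE_I2 impI)
      fix t assume "\<psi> t = 0"
      then have "infdist t T = 0" by (auto simp: \<psi>_def min_def split: if_splits)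
      then show "t \<in> T" using in_closed_iff_infdist_zero[OF T(1,2)] by blast
    qed
  qed
  \<comment> \<open>Points of different levels, and the point -1, are at distance at least 1 from
    each other. A ball of radius 1/2 thus meets only one of these pieces, so taking the closure does
    not mix them.\<close>
  have T_cases: "t = -1 \<or> (\<exists>m. t \<in> closure (lift ` {\<sigma>\<in>\<Union>m. X m. lev \<sigma> = m}))" if "t \<in> T" for t
  proof -
    let ?L = "insert (-1) (lift ` (\<Union>m. X m))"
    have t: "t \<in> closure (ball t (1/2) \<inter> ?L)"
      using open_Int_closure_subset[of "ball t (1/2)" ?L] that by (auto simp: T_def)
    show ?thesis
    proof (cases "-1 \<in> ball t (1/2)")
      case True
      have "ball t (1/2) \<inter> ?L \<subseteq> {-1}"
      proof
        fix y assume y: "y \<in> ball t (1/2) \<inter> ?L"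
        then have "\<bar>t - y\<bar> < 1 / 2" "\<bar>t + 1\<bar> < 1 / 2" using True by (simp_all add: dist_real_def)
        then have "y < 0" by linarith
        then show "y \<in> {-1}" using y lift(1) by fastforce
      qed
      then have "t \<in> closure {-1}" using t closure_mono by blast
      then show ?thesis by simp
    next
      case False
      have "ball t (1/2) \<inter> ?L \<noteq> {}" using t by auto
      then obtain \<sigma> where \<sigma>: "\<sigma> \<in> (\<Union>m. X m)" "lift \<sigma> \<in> ball t (1/2)" using False by blast
      have "ball t (1/2) \<inter> ?L \<subseteq> lift ` {\<sigma>'\<in>\<Union>m. X m. lev \<sigma>' = lev \<sigma>}"
      proof
        fix y assume y: "y \<in> ball t (1/2) \<inter> ?L"
        then obtain \<sigma>' where \<sigma>': "\<sigma>' \<in> (\<Union>m. X m)" "y = lift \<sigma>'" using False by blast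
        have "\<bar>t - lift \<sigma>'\<bar> < 1 / 2" "\<bar>t - lift \<sigma>\<bar> < 1 / 2"
          using y \<sigma>(2) \<sigma>' by (simp_all add: dist_real_def)
        then have "\<bar>lift \<sigma>' - lift \<sigma>\<bar> < 1" by linarith
        then have "lev \<sigma>' = lev \<sigma>" using lift[OF \<sigma>(1)] lift[OF \<sigma>'(1)] by linarith
        then show "y \<in> lift ` {\<sigma>'\<in>\<Union>m. X m. lev \<sigma>' = lev \<sigma>}" using \<sigma>' by auto
      qed
      then show ?thesis using t closure_mono by blast
    qed
  qed

  \<comment> \<open>\<open>lv\<close> reads off the level, \<Gamma> undoes the lift and
    \<open>h\<close> undoes the scaling. At -1 the level is truncated to 0 and
    \<open>-1 \<notin> K\<close>, so \<open>h\<close> vanishes and the auxiliary mass is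
    discarded.\<close>
  define lv where "lv t = nat \<lfloor>t / 2\<rfloor>" for t :: real
  define \<Gamma>' where "\<Gamma>' m s = (if s \<in> K then \<gamma> m s else undefined)" for m s
  define \<Gamma> where "\<Gamma> t = \<Gamma>' (lv t) (t - 2 * real (lv t))" for t
  define h where "h t = (if t - 2 * real (lv t) \<in> K then 1 / w (lv t) else 0)" for t
  have K_borel[measurable]: "K \<in> sets borel" using K by (intro borel_closed compact_imp_closed)
  have lv[measurable]: "lv \<in> measurable borel (count_space UNIV)" unfolding lv_def by measurable
  have "\<Gamma>' m \<in> borel_measurable borel" for m
    unfolding \<Gamma>'_def by (rule borel_measurable_continuous_on_if) (use \<gamma>(1) in \<open>auto simp: K_borel\<close>)
  then have "(\<lambda>t. \<Gamma>' m (t - 2 * real m)) \<in> borel_measurable borel" for m by measurable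
  then have \<Gamma>[measurable]: "\<Gamma> \<in> borel_measurable borel"
    unfolding \<Gamma>_def by (rule measurable_compose_countable[OF _ lv])
  have h[measurable]: "h \<in> borel_measurable borel"
    unfolding h_def
    by (rule measurable_compose_countable[where f = "\<lambda>m t. if t - 2 * real m \<in> K then 1 / w m else 0", OF _ lv])
      measurable
  have h0: "0 \<le> h t" for t using w(1)[of "lv t"] by (simp add: h_def)
  define \<mu> where "\<mu> = distr (density P h) borel \<Gamma>"
  have sets: "sets \<mu> = sets borel" by (simp add: \<mu>_def)

  have piece: "t - 2 * real m \<in> K \<and> lv t = m" if "t \<in> closure (lift ` {\<sigma>\<in>\<Union>m. X m. lev \<sigma> = m})" for t m
  proof -
    let ?C = "(\<lambda>s. 2 * real m + s) ` K"
    have "lift ` {\<sigma>\<in>\<Union>m. X m. lev \<sigma> = m} \<subseteq> ?C" using pre by (auto simp: lift_def)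
    moreover have "closed ?C" using K by (intro compact_imp_closed compact_continuous_image continuous_intros)
    ultimately have "t \<in> ?C" using that closure_minimal by blast
    then have *: "t - 2 * real m \<in> K" by auto
    then have "0 \<le> t - 2 * real m" "t - 2 * real m \<le> 1" using K by auto
    then have "\<lfloor>t / 2\<rfloor> = int m" by (simp add: floor_eq_iff)
    then show ?thesis using * by (simp add: lv_def)
  qed
  have nullset: "emeasure \<mu> (- (\<Union>m. X m)) = 0"
  proof -
    have cl: "X m \<in> sets borel" for m
      unfolding \<gamma>(2)[symmetric] using K \<gamma>(1)
      by (intro borel_closed compact_imp_closed compact_continuous_image)
    then have "(\<Union>m. X m) \<in> sets borel" by (intro sets.countable_UN) auto
    then have [measurable]: "- (\<Union>m. X m) \<in> sets borel" by (rule borel_comp)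
    have z: "h t = 0 \<or> (\<exists>m. \<Gamma> t \<in> X m)" for t
      using \<gamma>(2)[of "lv t"] by (auto simp: h_def \<Gamma>_def \<Gamma>'_def)
    have "emeasure \<mu> (- (\<Union>m. X m)) = (\<integral>\<^sup>+t. ennreal (h t) * indicator (\<Gamma> -` (- (\<Union>m. X m))) t \<partial>P)"
      unfolding \<mu>_def using measurable_sets_borel[OF \<Gamma>, of "- (\<Union>m. X m)"]
      by (simp add: emeasure_distr emeasure_density del: vimage_Compl Compl_UN)
    also have "\<dots> = (\<integral>\<^sup>+t. 0 \<partial>P)"
      by (intro nn_integral_cong) (use z in \<open>force split: split_indicator\<close>)
    finally show ?thesis by simp
  qed
  have "integrable \<mu> \<phi> \<and> (\<lambda>N. \<Sum>\<sigma>\<in>A (r N). c (r N) \<sigma> * \<phi> \<sigma>) \<longlonglongrightarrow> (\<integral>x. \<phi> x \<partial>\<mu>)"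
    if cont: "continuous_on UNIV \<phi>" and supp: "\<And>x. x \<in> (\<Union>m. X m) \<Longrightarrow> x \<notin> X m0 \<Longrightarrow> \<phi> x = 0"
    for \<phi> :: "'a \<Rightarrow> real" and m0
  proof -
    have contK: "continuous_on K (\<lambda>s. \<phi> (\<gamma> m s) / w m)" for m
      using continuous_on_compose2[OF cont \<gamma>(1)] w(1)[of m] by (intro continuous_intros) auto
    have "\<exists>g B. continuous_on UNIV g \<and> (\<forall>s\<in>K. g s = \<phi> (\<gamma> m s) / w m) \<and> (\<forall>s. \<bar>g s\<bar> \<le> B)" for m
    proof -
      have "bounded ((\<lambda>s. \<phi> (\<gamma> m s) / w m) ` K)"
        using compact_continuous_image[OF contK K(1)] by (rule compact_imp_bounded)
      then obtain B where B: "0 < B" "\<And>s. s \<in> K \<Longrightarrow> norm (\<phi> (\<gamma> m s) / w m) \<le> B"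
        by (auto simp: bounded_pos)
      have "closedin (top_of_set UNIV) K" using K by (simp add: compact_imp_closed)
      from Tietze[OF contK this, of B] B obtain g where "continuous_on UNIV g"
        "\<And>s. s \<in> K \<Longrightarrow> g s = \<phi> (\<gamma> m s) / w m" "\<And>s. norm (g s) \<le> B" by auto
      then show ?thesis by (intro exI[of _ g] exI[of _ B]) auto
    qed
    then obtain g B where g: "\<And>m. continuous_on UNIV (g m)" "\<And>m s. s \<in> K \<Longrightarrow> g m s = \<phi> (\<gamma> m s) / w m"
      "\<And>m s. \<bar>g m s\<bar> \<le> B m" by metis
    \<comment> \<open>\<open>h t * \<phi> (\<Gamma> t)\<close> need not be continuous on the line.
      On \<open>T\<close> it agrees with \<psi>, which is glued from the Tietze extensions
      \<open>g m\<close>: the bump is 1 on \<open>{0..1}\<close> and 0 at distance 1/2 or more from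
      it, so at a point of \<open>T\<close> at most one summand survives.\<close>
    define bump :: "real \<Rightarrow> real" where "bump s = max 0 (1 - 2 * max 0 (max (- s) (s - 1)))" for s
    have bump: "0 \<le> bump s" "bump s \<le> 1" for s by (auto simp: bump_def)
    define \<psi> where "\<psi> t = (\<Sum>m\<le>m0. bump (t - 2 * real m) * g m (t - 2 * real m))" for t
    have cont\<psi>: "continuous_on UNIV \<psi>"
      unfolding \<psi>_def bump_def
      by (intro continuous_intros continuous_on_compose2[OF g(1)]) auto
    then have [measurable]: "\<psi> \<in> borel_measurable borel" by (rule borel_measurable_continuous_onI)
    have bound: "\<bar>\<psi> t\<bar> \<le> (\<Sum>m\<le>m0. B m)" for t
    proof -
      have "\<bar>bump s * g m s\<bar> \<le> B m" for m s
        using mult_mono[OF bump(2)[of s] g(3)[of m s]] bump(1)[of s] by (simp add: abs_mult)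
      then show ?thesis unfolding \<psi>_def by (intro order_trans[OF sum_abs] sum_mono)
    qed
    have eq: "\<psi> t = h t * \<phi> (\<Gamma> t)" if tT: "t \<in> T" for t
      using T_cases[OF tT]
    proof
      assume t: "t = -1"
      have "\<psi> t = 0" unfolding \<psi>_def by (intro sum.neutral) (auto simp: t bump_def)
      moreover have "h t = 0" using K by (auto simp: h_def t lv_def)
      ultimately show ?thesis by simp
    next
      assume "\<exists>m. t \<in> closure (lift ` {\<sigma>\<in>\<Union>m. X m. lev \<sigma> = m})"
      then obtain m where m: "t \<in> closure (lift ` {\<sigma>\<in>\<Union>m. X m. lev \<sigma> = m})" by blast
      note tm = piece[OF m]
      then have s: "0 \<le> t - 2 * real m" "t - 2 * real m \<le> 1" using K by auto
      have hphi: "h t * \<phi> (\<Gamma> t) = \<phi> (\<gamma> m (t - 2 * real m)) / w m"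
        using tm by (simp add: h_def \<Gamma>_def \<Gamma>'_def)
      have z: "bump (t - 2 * real m') = 0" if "m' \<noteq> m" for m'
      proof -
        from that have "Suc m' \<le> m \<or> Suc m \<le> m'" by linarith
        then consider "real (Suc m') \<le> real m" | "real (Suc m) \<le> real m'"
          unfolding of_nat_le_iff by blast
        then show ?thesis using s by cases (auto simp: bump_def)
      qed
      have "bump (t - 2 * real m) = 1" using s by (simp add: bump_def)
      then have "bump (t - 2 * real m') * g m' (t - 2 * real m') =
          (if m' = m then \<phi> (\<gamma> m (t - 2 * real m)) / w m else 0)" for m'
        using z[of m'] g(2) tm by simp
      then have \<psi>: "\<psi> t = (if m \<le> m0 then \<phi> (\<gamma> m (t - 2 * real m)) / w m else 0)"
        by (simp add: \<psi>_def)
      show ?thesis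
      proof (cases "m \<le> m0")
        case False
        \<comment> \<open>A limit of lifted points of level \<open>m\<close> may correspond to a
          point of \<open>X m0\<close>, where \<open>supp\<close> says nothing. It still comes from
          points outside \<open>X m0\<close>, so \<phi> vanishes there by continuity.\<close>
        let ?C = "(\<lambda>s. 2 * real m + s) ` {s\<in>K. \<phi> (\<gamma> m s) = 0}"
        have "continuous_on K (\<lambda>s. \<phi> (\<gamma> m s))" using continuous_on_compose2[OF cont \<gamma>(1)] by auto
        then have "closed (K \<inter> (\<lambda>s. \<phi> (\<gamma> m s)) -` {0})"
          using K by (intro continuous_closed_preimage compact_imp_closed) auto
        moreover have eqK: "K \<inter> (K \<inter> (\<lambda>s. \<phi> (\<gamma> m s)) -` {0}) = {s\<in>K. \<phi> (\<gamma> m s) = 0}" by auto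
        ultimately have "compact {s\<in>K. \<phi> (\<gamma> m s) = 0}"
          using compact_Int_closed[OF K(1)] unfolding eqK[symmetric] by blast
        then have "closed ?C" by (intro compact_imp_closed compact_continuous_image continuous_intros)
        moreover have "lift ` {\<sigma>\<in>\<Union>m. X m. lev \<sigma> = m} \<subseteq> ?C"
        proof
          fix y assume "y \<in> lift ` {\<sigma>\<in>\<Union>m. X m. lev \<sigma> = m}"
          then obtain \<sigma> where \<sigma>: "\<sigma> \<in> (\<Union>m. X m)" "lev \<sigma> = m" "y = lift \<sigma>" by blast
          then have "\<sigma> \<notin> X m0" using lev_le[of \<sigma> m0] False by auto
          then have "\<phi> (\<gamma> m (pre \<sigma>)) = 0" using supp \<sigma> pre[OF \<sigma>(1)] by simp
          then show "y \<in> ?C" using pre[OF \<sigma>(1)] \<sigma> by (auto simp: lift_def)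
        qed
        ultimately have "t \<in> ?C" using m closure_minimal by blast
        then have "\<phi> (\<gamma> m (t - 2 * real m)) = 0" by auto
        then show ?thesis using \<psi> hphi by simp
      qed (use \<psi> hphi in simp)
    qed
    have [measurable]: "\<phi> \<in> borel_measurable borel" using cont by (rule borel_measurable_continuous_onI)
    have AE: "AE t in P. \<psi> t = h t * \<phi> (\<Gamma> t)" using AE_T by eventually_elim (rule eq)
    have "integrable P \<psi>" using bound by (intro P.integrable_const_bound[of _ "\<Sum>m\<le>m0. B m"]) auto
    then have "integrable P (\<lambda>t. h t * \<phi> (\<Gamma> t))"
      by (subst integrable_cong_AE[of _ _ \<psi>]) (use AE in auto)
    then have int: "integrable \<mu> \<phi>"
      unfolding \<mu>_def by (subst integrable_distr_eq) (auto simp: integrable_density h0)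
    have "(\<integral>x. \<phi> x \<partial>\<mu>) = (\<integral>t. h t * \<phi> (\<Gamma> t) \<partial>P)"
      unfolding \<mu>_def by (subst integral_distr) (auto simp: integral_density h0)
    also have "\<dots> = (\<integral>t. \<psi> t \<partial>P)" by (rule integral_cong_AE) (use AE in auto)
    finally have I: "(\<integral>x. \<phi> x \<partial>\<mu>) = (\<integral>t. \<psi> t \<partial>P)" .
    have "(\<integral>t. \<psi> t \<partial>Q N) = (\<Sum>\<sigma>\<in>A N. c N \<sigma> * \<phi> \<sigma>)" for N
    proof -
      have "\<psi> (-1) = 0" using eq[OF T(3)] K by (auto simp: h_def lv_def)
      moreover have "p N \<sigma> * \<psi> (lift \<sigma>) = c N \<sigma> * \<phi> \<sigma>" if \<sigma>: "\<sigma> \<in> A N" for \<sigma>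
      proof -
        have \<sigma>X: "\<sigma> \<in> (\<Union>m. X m)" using \<sigma> A by blast
        then have "lift \<sigma> \<in> closure (lift ` {\<sigma>'\<in>\<Union>m. X m. lev \<sigma>' = lev \<sigma>})"
          by (intro closure_subset[THEN subsetD]) blast
        note tm = piece[OF this]
        have "\<psi> (lift \<sigma>) = \<phi> \<sigma> / w (lev \<sigma>)"
          using eq[OF T(4)[OF \<sigma>X]] tm pre[OF \<sigma>X] by (simp add: h_def \<Gamma>_def \<Gamma>'_def lift_def)
        then show ?thesis using w(1)[of "lev \<sigma>"] by (simp add: p_def)
      qed
      ultimately show ?thesis by (subst Qint) (auto intro!: sum.cong)
    qed
    then show ?thesis using lim[OF cont\<psi> bound] int I by simp
  qed
  then show ?thesis by (intro that[OF r sets nullset]) blast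
qed

section \<open>Tensor products of finitely supported functionals\<close>

text \<open>Summing over the supports makes the functional independent of any grid;
  \<open>tensor_eq\<close> recovers the sum over an arbitrary finite grid containing them.\<close>

definition tensor :: "nat \<Rightarrow> (nat \<Rightarrow> real \<Rightarrow> real) \<Rightarrow> ((nat \<Rightarrow> real) \<Rightarrow> real) \<Rightarrow> real" where
  "tensor d w f = (\<Sum>y\<in>PiE {..<d} (\<lambda>i. {x. w i x \<noteq> 0}). (\<Prod>i<d. w i (y i)) * f y)"

lemma tensor_eq:
  assumes "\<And>i. i < d \<Longrightarrow> finite (G i)" "\<And>i x. i < d \<Longrightarrow> x \<notin> G i \<Longrightarrow> w i x = 0"
  shows "tensor d w f = (\<Sum>y\<in>PiE {..<d} G. (\<Prod>i<d. w i (y i)) * f y)"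
  unfolding tensor_def
proof (rule sum.mono_neutral_left)
  show "finite (PiE {..<d} G)" using assms by (intro finite_PiE) auto
  show "PiE {..<d} (\<lambda>i. {x. w i x \<noteq> 0}) \<subseteq> PiE {..<d} G" using assms by (intro PiE_mono) auto
  show "\<forall>y\<in>PiE {..<d} G - PiE {..<d} (\<lambda>i. {x. w i x \<noteq> 0}). (\<Prod>i<d. w i (y i)) * f y = 0"
  proof
    fix y assume y: "y \<in> PiE {..<d} G - PiE {..<d} (\<lambda>i. {x. w i x \<noteq> 0})"
    then have "\<exists>i\<in>{..<d}. w i (y i) = 0" by (auto simp: PiE_iff)
    then show "(\<Prod>i<d. w i (y i)) * f y = 0" by (simp add: prod_zero)
  qed
qed

lemma tensor_cong:
  assumes "\<And>i. i < d \<Longrightarrow> w i = v i"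
  shows "tensor d w f = tensor d v f"
proof -
  have "PiE {..<d} (\<lambda>i. {x. w i x \<noteq> 0}) = PiE {..<d} (\<lambda>i. {x. v i x \<noteq> 0})"
    using assms by (intro PiE_cong) auto
  then show ?thesis using assms by (simp add: tensor_def)
qed

text \<open>This carries one-dimensional identities between weights over to \<open>d\<close>
  dimensions, for an \<open>f\<close> that need not be a product.\<close>

lemma tensor_multilinear:
  assumes "\<And>i. i < d \<Longrightarrow> finite (G i)" "\<And>i. i < d \<Longrightarrow> finite (A i)"
    and "\<And>i s x. i < d \<Longrightarrow> s \<in> A i \<Longrightarrow> x \<notin> G i \<Longrightarrow> v i s x = 0"
    and "\<And>i x. i < d \<Longrightarrow> w i x = (\<Sum>s\<in>A i. a i s * v i s x)"
  shows "tensor d w f =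
    (\<Sum>\<sigma>\<in>PiE {..<d} A. (\<Prod>i<d. a i (\<sigma> i)) * tensor d (\<lambda>i. v i (\<sigma> i)) f)"
proof -
  have "tensor d w f = (\<Sum>y\<in>PiE {..<d} G. (\<Prod>i<d. w i (y i)) * f y)"
    using assms by (intro tensor_eq) auto
  also have "\<dots> = (\<Sum>y\<in>PiE {..<d} G. (\<Prod>i<d. \<Sum>s\<in>A i. a i s * v i s (y i)) * f y)"
    using assms by simp
  also have "\<dots> = (\<Sum>y\<in>PiE {..<d} G. (\<Sum>\<sigma>\<in>PiE {..<d} A. \<Prod>i<d. a i (\<sigma> i) * v i (\<sigma> i) (y i)) * f y)"
    using assms by (subst prod_sum_PiE) auto
  also have "\<dots> = (\<Sum>\<sigma>\<in>PiE {..<d} A. (\<Prod>i<d. a i (\<sigma> i)) *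
      (\<Sum>y\<in>PiE {..<d} G. (\<Prod>i<d. v i (\<sigma> i) (y i)) * f y))"
    unfolding sum_distrib_left sum_distrib_right
    by (subst sum.swap) (simp add: prod.distrib mult.assoc)
  also have "\<dots> = (\<Sum>\<sigma>\<in>PiE {..<d} A. (\<Prod>i<d. a i (\<sigma> i)) * tensor d (\<lambda>i. v i (\<sigma> i)) f)"
  proof (intro sum.cong refl arg_cong2[where f = "(*)"])
    fix \<sigma> assume "\<sigma> \<in> PiE {..<d} A"
    then show "(\<Sum>y\<in>PiE {..<d} G. (\<Prod>i<d. v i (\<sigma> i) (y i)) * f y) = tensor d (\<lambda>i. v i (\<sigma> i)) f"
      using assms by (intro tensor_eq[symmetric]) (auto simp: PiE_iff)
  qed
  finally show ?thesis .
qed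

lemma tensor_prod:
  assumes "\<And>i. i < d \<Longrightarrow> finite (G i)" "\<And>i x. i < d \<Longrightarrow> x \<notin> G i \<Longrightarrow> w i x = 0"
  shows "tensor d w (\<lambda>x. \<Prod>i<d. \<phi> i (x i)) = (\<Prod>i<d. \<Sum>x\<in>G i. w i x * \<phi> i x)"
proof -
  have "(\<Prod>i<d. \<Sum>x\<in>G i. w i x * \<phi> i x) = (\<Sum>y\<in>PiE {..<d} G. \<Prod>i<d. w i (y i) * \<phi> i (y i))"
    using assms by (subst prod_sum_PiE) auto
  then show ?thesis using tensor_eq[OF assms] by (simp add: prod.distrib)
qed

lemma tensor_point:
  "tensor d (\<lambda>i x. if x = p i then 1 else 0) f = f (restrict p {..<d})"
proof -
  have "tensor d (\<lambda>i x. if x = p i then 1 else 0) f =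
    (\<Sum>y\<in>PiE {..<d} (\<lambda>i. {p i}). (\<Prod>i<d. if y i = p i then 1 else 0) * f y)"
    by (rule tensor_eq) auto
  also have "PiE {..<d} (\<lambda>i. {p i}) = PiE {..<d} (\<lambda>i. {restrict p {..<d} i})"
    by (rule PiE_cong) simp
  also have "\<dots> = {restrict p {..<d}}" by (rule PiE_singleton[OF restrict_extensional])
  finally show ?thesis by (simp add: restrict_def)
qed

lemma tensor_scale:
  assumes "\<And>i. i < d \<Longrightarrow> finite (G i)" "\<And>i x. i < d \<Longrightarrow> x \<notin> G i \<Longrightarrow> w i x = 0"
  shows "tensor d (\<lambda>i x. c i * w i x) f = (\<Prod>i<d. c i) * tensor d w f"
  using assms by (subst (1 2) tensor_eq[where G = G])
    (auto simp: prod.distrib sum_distrib_left mult.assoc)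

lemma sum_PiE_insert:
  assumes "i \<notin> D"
  shows "(\<Sum>y\<in>PiE (insert i D) S. h y) = (\<Sum>t\<in>S i. \<Sum>g\<in>PiE D S. h (g(i := t)))"
proof -
  have "(\<Sum>y\<in>PiE (insert i D) S. h y) = (\<Sum>(t, g)\<in>S i \<times> PiE D S. h (g(i := t)))"
    unfolding PiE_insert_eq
    by (subst sum.reindex[OF inj_combinator[OF assms]]) (auto simp: case_prod_unfold)
  then show ?thesis by (simp add: sum.cartesian_product)
qed

lemma multi_divdiff_eq_tensor:
  assumes "\<And>i. i < d \<Longrightarrow> inj_on (X i) {..n i}"
  shows "multi_divdiff d n X f = tensor d (\<lambda>i. dd_weight (X i ` {..n i})) f"
  using assms
proof (induction d arbitrary: f)
  case 0
  then show ?case by (simp add: tensor_def)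
next
  case (Suc d)
  let ?S = "\<lambda>i. X i ` {..n i}"
  have sup: "tensor e (\<lambda>i. dd_weight (?S i)) g =
      (\<Sum>y\<in>PiE {..<e} ?S. (\<Prod>i<e. dd_weight (?S i) (y i)) * g y)" for e g
    by (rule tensor_eq) (auto simp: dd_weight_outside)
  have "multi_divdiff (Suc d) n X f = (\<Sum>t\<in>?S d. dd_weight (?S d) t *
      tensor d (\<lambda>i. dd_weight (?S i)) (\<lambda>y. f (y(d := t))))"
    using Suc by (simp add: divdiff_eq_sum)
  also have "\<dots> = (\<Sum>y\<in>PiE {..<Suc d} ?S. (\<Prod>i<Suc d. dd_weight (?S i) (y i)) * f y)"
    unfolding lessThan_Suc sum_PiE_insert[of d "{..<d}", simplified] sup sum_distrib_left
    by (intro sum.cong refl) (auto simp: algebra_simps intro!: prod.cong)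
  finally show ?case using sup by simp
qed

lemma box_convex_tensor:
  assumes "box_convex d n I f"
    and "\<And>i. i < d \<Longrightarrow> S i \<subseteq> I i \<and> finite (S i) \<and> card (S i) = Suc (n i)"
  shows "0 \<le> tensor d (\<lambda>i. dd_weight (S i)) f"
proof -
  have "\<exists>X. bij_betw X {..n i} (S i)" if "i < d" for i
    using ex_bij_betw_nat_finite[of "S i"] assms(2)[OF that]
    by (simp add: atLeast0LessThan lessThan_Suc_atMost)
  then obtain X where X: "\<And>i. i < d \<Longrightarrow> bij_betw (X i) {..n i} (S i)" by metis
  then have inj: "\<And>i. i < d \<Longrightarrow> inj_on (X i) {..n i}" and im: "\<And>i. i < d \<Longrightarrow> X i ` {..n i} = S i"
    by (auto simp: bij_betw_def)
  then have "0 \<le> multi_divdiff d n X f" using assms by (simp add: box_convex_def)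
  also have "\<dots> = tensor d (\<lambda>i. dd_weight (X i ` {..n i})) f"
    using inj by (rule multi_divdiff_eq_tensor)
  also have "\<dots> = tensor d (\<lambda>i. dd_weight (S i)) f" using im by (intro tensor_cong) simp
  finally show ?thesis .
qed

section \<open>Pseudo-polynomials\<close>

text \<open>Each term of \<open>W\<close> is a power of one coordinate times a function of the
  others, so the sum over that coordinate splits off and is already zero.\<close>

lemma tensor_pseudo_polynomial:
  assumes W: "pseudo_polynomial d m J W"
    and S: "\<And>i. i < d \<Longrightarrow> finite (S i) \<and> S i \<subseteq> J i"
    and w: "\<And>i x. i < d \<Longrightarrow> x \<notin> S i \<Longrightarrow> w i x = 0"
    and z: "\<And>i k. i < d \<Longrightarrow> k \<le> m i \<Longrightarrow> (\<Sum>x\<in>S i. w i x * x ^ k) = 0"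
  shows "tensor d w W = 0"
proof -
  obtain A :: "nat \<Rightarrow> nat \<Rightarrow> (nat \<Rightarrow> real) \<Rightarrow> real" where A: "\<And>x. x \<in> PiE {..<d} J \<Longrightarrow>
     W x = (\<Sum>i<d. \<Sum>k\<le>m i. A i k (restrict x ({..<d} - {i})) * x i ^ k)"
    using W unfolding pseudo_polynomial_def by blast
  have "PiE {..<d} S \<subseteq> PiE {..<d} J" using S by (intro PiE_mono) auto
  then have "tensor d w W = (\<Sum>y\<in>PiE {..<d} S. (\<Prod>j<d. w j (y j)) *
      (\<Sum>i<d. \<Sum>k\<le>m i. A i k (restrict y ({..<d} - {i})) * y i ^ k))"
    using S w A by (subst tensor_eq[of d S w]) (auto intro!: sum.cong)
  also have "\<dots> = (\<Sum>i<d. \<Sum>k\<le>m i. \<Sum>y\<in>PiE {..<d} S. (\<Prod>j<d. w j (y j)) *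
      (A i k (restrict y ({..<d} - {i})) * y i ^ k))"
    unfolding sum_distrib_left by (subst sum.swap, intro sum.cong refl, subst sum.swap) simp
  also have "\<dots> = 0"
  proof (rule sum.neutral, rule ballI, rule sum.neutral, rule ballI)
    fix i k assume ik: "i \<in> {..<d}" "k \<in> {..m i}"
    define D where "D = {..<d} - {i}"
    have D: "{..<d} = insert i D" "i \<notin> D" "finite D" using ik by (auto simp: D_def)
    have "(\<Sum>y\<in>PiE {..<d} S. (\<Prod>j<d. w j (y j)) * (A i k (restrict y D) * y i ^ k))
      = (\<Sum>t\<in>S i. \<Sum>g\<in>PiE D S. (w i t * t ^ k) * ((\<Prod>j\<in>D. w j (g j)) * A i k g))"
      unfolding D(1) sum_PiE_insert[OF D(2)]
    proof (intro sum.cong refl)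
      fix t g assume "g \<in> PiE D S"
      then have "restrict (g(i := t)) D = g" using D by (auto simp: PiE_iff extensional_def fun_eq_iff)
      moreover have "(\<Prod>j\<in>D. w j ((g(i := t)) j)) = (\<Prod>j\<in>D. w j (g j))"
        using D by (intro prod.cong) auto
      ultimately show "(\<Prod>j\<in>insert i D. w j ((g(i := t)) j)) *
          (A i k (restrict (g(i := t)) D) * (g(i := t)) i ^ k) =
          (w i t * t ^ k) * ((\<Prod>j\<in>D. w j (g j)) * A i k g)"
        unfolding prod.insert[OF D(3,2)] by simp
    qed
    also have "\<dots> = (\<Sum>t\<in>S i. w i t * t ^ k) * (\<Sum>g\<in>PiE D S. (\<Prod>j\<in>D. w j (g j)) * A i k g)"
      by (simp add: sum_product)
    also have "\<dots> = 0" using z ik by simp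
    finally show "(\<Sum>y\<in>PiE {..<d} S. (\<Prod>j<d. w j (y j)) *
       (A i k (restrict y ({..<d} - {i})) * y i ^ k)) = 0" by (simp only: D_def)
  qed
  finally show ?thesis .
qed

lemma pseudo_polynomial_sum:
  assumes "\<And>\<tau>. \<tau> \<in> T \<Longrightarrow> pseudo_polynomial d m J (W \<tau>)"
  shows "pseudo_polynomial d m J (\<lambda>x. \<Sum>\<tau>\<in>T. W \<tau> x)"
proof -
  have "\<exists>A. \<forall>\<tau>\<in>T. \<forall>x\<in>PiE {..<d} J.
     W \<tau> x = (\<Sum>i<d. \<Sum>k\<le>m i. A \<tau> i k (restrict x ({..<d} - {i})) * x i ^ k)"
    by (rule bchoice) (use assms in \<open>unfold pseudo_polynomial_def, blast\<close>)
  then obtain A where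
    A: "\<And>\<tau> x. \<tau> \<in> T \<Longrightarrow> x \<in> PiE {..<d} J \<Longrightarrow>
      W \<tau> x = (\<Sum>i<d. \<Sum>k\<le>m i. A \<tau> i k (restrict x ({..<d} - {i})) * x i ^ k)"
    by blast
  show ?thesis
    unfolding pseudo_polynomial_def
  proof (intro exI ballI)
    fix x assume x: "x \<in> PiE {..<d} J"
    have "(\<Sum>\<tau>\<in>T. W \<tau> x) = (\<Sum>\<tau>\<in>T. \<Sum>i<d. \<Sum>k\<le>m i. A \<tau> i k (restrict x ({..<d} - {i})) * x i ^ k)"
      using A x by simp
    also have "\<dots> = (\<Sum>i<d. \<Sum>k\<le>m i. (\<Sum>\<tau>\<in>T. A \<tau> i k (restrict x ({..<d} - {i}))) * x i ^ k)"
      unfolding sum_distrib_right by (subst sum.swap, intro sum.cong refl, subst sum.swap) simp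
    finally show "(\<Sum>\<tau>\<in>T. W \<tau> x) =
        (\<Sum>i<d. \<Sum>k\<le>m i. (\<lambda>i k y. \<Sum>\<tau>\<in>T. A \<tau> i k y) i k (restrict x ({..<d} - {i})) * x i ^ k)" .
  qed
qed

lemma pseudo_polynomial_single:
  assumes "i < d" "degree p \<le> m i"
    and "\<And>x. x \<in> PiE {..<d} J \<Longrightarrow> W x = B (restrict x ({..<d} - {i})) * poly p (x i)"
  shows "pseudo_polynomial d m J W"
  unfolding pseudo_polynomial_def
proof (intro exI ballI)
  fix x assume x: "x \<in> PiE {..<d} J"
  define A where "A j k y = (if j = i then B y * coeff p k else 0)" for j k and y :: "nat \<Rightarrow> real"
  have "poly p (x i) = (\<Sum>k\<le>m i. coeff p k * x i ^ k)"
    unfolding poly_altdef using assms by (intro sum.mono_neutral_left) (auto simp: coeff_eq_0)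
  then have "W x = (\<Sum>k\<le>m i. B (restrict x ({..<d} - {i})) * coeff p k * x i ^ k)"
    using assms x by (simp add: sum_distrib_left mult.assoc)
  also have "\<dots> = (\<Sum>j<d. if j = i then \<Sum>k\<le>m i. B (restrict x ({..<d} - {i})) * coeff p k * x i ^ k else 0)"
    using assms by simp
  also have "\<dots> = (\<Sum>j<d. \<Sum>k\<le>m j. (\<lambda>j k y. if j = i then B y * coeff p k else 0) j k
      (restrict x ({..<d} - {j})) * x j ^ k)"
    by (intro sum.cong refl) auto
  finally show "W x = (\<Sum>j<d. \<Sum>k\<le>m j. (\<lambda>j k y. if j = i then B y * coeff p k else 0) j k
      (restrict x ({..<d} - {j})) * x j ^ k)" .
qed

section \<open>The remainder of Lagrange interpolation\<close>

definition lagrange_poly :: "nat \<Rightarrow> (nat \<Rightarrow> real) \<Rightarrow> nat \<Rightarrow> real poly" where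
  "lagrange_poly n t j =
     smult (1 / (\<Prod>l\<in>{..<n} - {j}. t j - t l)) (\<Prod>l\<in>{..<n} - {j}. [:- t l, 1:])"

text \<open>Index \<open>n\<close> stands for the evaluation point \<open>x\<close> itself, smaller indices for the
  interpolation nodes \<open>t 0, \<dots>, t (n - 1)\<close>.\<close>

definition rem_coeff :: "nat \<Rightarrow> (nat \<Rightarrow> real) \<Rightarrow> real \<Rightarrow> nat \<Rightarrow> real" where
  "rem_coeff n t x j = (if j < n then - poly (lagrange_poly n t j) x else 1)"

definition rem_point :: "nat \<Rightarrow> (nat \<Rightarrow> real) \<Rightarrow> real \<Rightarrow> nat \<Rightarrow> real" where
  "rem_point n t x j = (if j < n then t j else x)"

text \<open>The evaluation point \<open>x\<close> may coincide with a node; summing indicators over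
  the indices adds the two coefficients in that case.\<close>

definition rem_weight :: "nat \<Rightarrow> (nat \<Rightarrow> real) \<Rightarrow> real \<Rightarrow> real \<Rightarrow> real" where
  "rem_weight n t x s = (\<Sum>j\<le>n. rem_coeff n t x j * (if s = rem_point n t x j then 1 else 0))"

text \<open>The expanded product of the operators \<open>1 - P_i\<close>, where \<open>P_i\<close>
  interpolates in coordinate \<open>i\<close>: \<open>\<tau> i = n i\<close> selects the identity,
  and \<open>\<tau> i = j < n i\<close> selects minus the term of the \<open>j\<close>-th
  node.\<close>

definition remainder ::
  "nat \<Rightarrow> (nat \<Rightarrow> nat) \<Rightarrow> (nat \<Rightarrow> nat \<Rightarrow> real) \<Rightarrow> ((nat \<Rightarrow> real) \<Rightarrow> real) \<Rightarrow> (nat \<Rightarrow> real) \<Rightarrow> real" where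
  "remainder d n t f x = (\<Sum>\<tau>\<in>PiE {..<d} (\<lambda>i. {..n i}).
     (\<Prod>i<d. rem_coeff (n i) (t i) (x i) (\<tau> i)) * f (\<lambda>i\<in>{..<d}. rem_point (n i) (t i) (x i) (\<tau> i)))"

lemma degree_lagrange_poly:
  assumes "j < n"
  shows "degree (lagrange_poly n t j) \<le> n - 1"
proof -
  have "degree (\<Prod>l\<in>{..<n} - {j}. [:- t l, 1:]) = n - 1"
    using assms by (subst degree_prod_sum_eq) auto
  then show ?thesis unfolding lagrange_poly_def by (metis degree_smult_le)
qed

lemma poly_lagrange_poly:
  assumes "j < n" "l < n" "inj_on t {..<n}"
  shows "poly (lagrange_poly n t j) (t l) = (if l = j then 1 else 0)"
proof (cases "l = j")
  case True
  have "(\<Prod>l\<in>{..<n} - {j}. t j - t l) \<noteq> 0" using assms by (auto simp: inj_on_def)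
  then show ?thesis using True by (simp add: lagrange_poly_def poly_prod)
next
  case False
  then have "(\<Prod>k\<in>{..<n} - {j}. t l - t k) = 0" using assms by (intro prod_zero) auto
  then show ?thesis using False by (simp add: lagrange_poly_def poly_prod)
qed

lemma lagrange_interpolation:
  assumes "degree p < n" "inj_on t {..<n}"
  shows "poly p x = (\<Sum>j<n. poly (lagrange_poly n t j) x * poly p (t j))"
proof -
  define q where "q = (\<Sum>j<n. smult (poly p (t j)) (lagrange_poly n t j))"
  have "degree q \<le> n - 1"
    unfolding q_def by (intro degree_sum_le) (use degree_lagrange_poly[of _ n t] in \<open>auto intro: order_trans[OF degree_smult_le]\<close>)
  then have q: "degree q < n" using assms by simp
  have "p = q"
  proof (rule poly_eqI_degree[of "t ` {..<n}"])
    show "poly p y = poly q y" if "y \<in> t ` {..<n}" for y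
    proof -
      obtain l where l: "l < n" "y = t l" using \<open>y \<in> t ` {..<n}\<close> by auto
      have "poly q y = (\<Sum>j<n. if l = j then poly p (t j) else 0)"
        unfolding q_def poly_sum using l assms by (intro sum.cong refl) (simp add: poly_lagrange_poly)
      also have "\<dots> = poly p (t l)" using l by simp
      finally show ?thesis using l by simp
    qed
  qed (use assms q in \<open>auto simp: card_image\<close>)
  then have "poly p x = poly q x" by simp
  then show ?thesis by (simp add: q_def poly_sum mult.commute)
qed

lemma sum_rem_weight:
  assumes "finite G" "\<And>j. j \<le> n \<Longrightarrow> rem_point n t x j \<in> G"
  shows "(\<Sum>s\<in>G. rem_weight n t x s * \<phi> s) = (\<Sum>j\<le>n. rem_coeff n t x j * \<phi> (rem_point n t x j))"
proof -
  have "(\<Sum>s\<in>G. rem_weight n t x s * \<phi> s) =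
      (\<Sum>j\<le>n. \<Sum>s\<in>G. rem_coeff n t x j * (if s = rem_point n t x j then 1 else 0) * \<phi> s)"
    unfolding rem_weight_def sum_distrib_right by (rule sum.swap)
  also have "\<dots> = (\<Sum>j\<le>n. rem_coeff n t x j * \<phi> (rem_point n t x j))"
  proof (intro sum.cong refl)
    fix j assume "j \<in> {..n}"
    then have "rem_point n t x j \<in> G" using assms by simp
    moreover have "(\<Sum>s\<in>G. rem_coeff n t x j * (if s = rem_point n t x j then 1 else 0) * \<phi> s)
      = (\<Sum>s\<in>G. if s = rem_point n t x j then rem_coeff n t x j * \<phi> s else 0)"
      by (intro sum.cong) auto
    ultimately show "(\<Sum>s\<in>G. rem_coeff n t x j * (if s = rem_point n t x j then 1 else 0) * \<phi> s)
      = rem_coeff n t x j * \<phi> (rem_point n t x j)"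
      using assms by simp
  qed
  finally show ?thesis .
qed

lemma sum_rem_coeff:
  "(\<Sum>j\<le>n. rem_coeff n t x j * \<phi> (rem_point n t x j)) =
     \<phi> x - (\<Sum>j<n. poly (lagrange_poly n t j) x * \<phi> (t j))"
proof -
  have "(\<Sum>j\<le>n. rem_coeff n t x j * \<phi> (rem_point n t x j)) =
      (\<Sum>j<n. rem_coeff n t x j * \<phi> (rem_point n t x j)) + \<phi> x"
    by (simp add: lessThan_Suc_atMost[symmetric] rem_coeff_def[of n t x n] rem_point_def[of n t x n])
  also have "(\<Sum>j<n. rem_coeff n t x j * \<phi> (rem_point n t x j)) =
     - (\<Sum>j<n. poly (lagrange_poly n t j) x * \<phi> (t j))"
    unfolding sum_negf[symmetric] by (intro sum.cong refl) (simp add: rem_coeff_def rem_point_def)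
  finally show ?thesis by simp
qed

lemma rem_coeff_annihilates:
  assumes "degree p < n" "inj_on t {..<n}"
  shows "(\<Sum>j\<le>n. rem_coeff n t x j * poly p (rem_point n t x j)) = 0"
  using lagrange_interpolation[OF assms, of x] by (simp add: sum_rem_coeff)

lemma rem_weight_outside:
  "(\<And>j. j \<le> n \<Longrightarrow> rem_point n t x j \<in> G) \<Longrightarrow> s \<notin> G \<Longrightarrow> rem_weight n t x s = 0"
  by (auto simp: rem_weight_def intro!: sum.neutral)

lemma remainder_eq_tensor:
  "remainder d n t f x = tensor d (\<lambda>i. rem_weight (n i) (t i) (x i)) f"
proof -
  have "tensor d (\<lambda>i. rem_weight (n i) (t i) (x i)) f =
    (\<Sum>\<tau>\<in>PiE {..<d} (\<lambda>i. {..n i}). (\<Prod>i<d. rem_coeff (n i) (t i) (x i) (\<tau> i)) *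
      tensor d (\<lambda>i s. if s = rem_point (n i) (t i) (x i) (\<tau> i) then 1 else 0) f)"
    by (rule tensor_multilinear[where G = "\<lambda>i. rem_point (n i) (t i) (x i) ` {..n i}"])
      (auto simp: rem_weight_def)
  then show ?thesis by (simp add: tensor_point remainder_def)
qed

lemma remainder_prod:
  "remainder d n t (\<lambda>y. \<Prod>i<d. \<phi> i (y i)) x =
     (\<Prod>i<d. \<Sum>j\<le>n i. rem_coeff (n i) (t i) (x i) j * \<phi> i (rem_point (n i) (t i) (x i) j))"
  unfolding remainder_def by (subst prod_sum_PiE) (auto simp: prod.distrib)

text \<open>The term with all \<open>\<tau> i = n i\<close> is \<open>W x\<close> itself. Every
  other term has a coordinate evaluated at a node, hence depends on that coordinate only through a
  Lagrange polynomial of degree at most \<open>n i - 1\<close>.\<close>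

lemma pseudo_polynomial_if_remainder_zero:
  assumes "\<And>x. x \<in> PiE {..<d} J \<Longrightarrow> remainder d n t W x = 0"
  shows "pseudo_polynomial d (\<lambda>i. n i - 1) J W"
proof -
  let ?T = "PiE {..<d} (\<lambda>i. {..n i})"
  define top where "top = restrict n {..<d}"
  define V where "V \<tau> x = - ((\<Prod>i<d. rem_coeff (n i) (t i) (x i) (\<tau> i)) *
     W (\<lambda>i\<in>{..<d}. rem_point (n i) (t i) (x i) (\<tau> i)))" for \<tau> x
  have T: "finite ?T" "top \<in> ?T" by (auto intro!: finite_PiE simp: top_def)
  have "pseudo_polynomial d (\<lambda>i. n i - 1) J (V \<tau>)" if \<tau>: "\<tau> \<in> ?T - {top}" for \<tau>
  proof -
    have "\<exists>i<d. \<tau> i \<noteq> n i"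
    proof (rule ccontr)
      assume "\<not> ?thesis"
      then have "\<tau> = top" using \<tau> by (auto simp: top_def fun_eq_iff PiE_iff extensional_def)
      then show False using \<tau> by simp
    qed
    then obtain i where i: "i < d" "\<tau> i < n i" using \<tau> by (force simp: PiE_iff order_less_le)
    define D where "D = {..<d} - {i}"
    have D: "{..<d} = insert i D" "i \<notin> D" "finite D" using i by (auto simp: D_def)
    define B where "B y = (\<Prod>j\<in>D. rem_coeff (n j) (t j) (y j) (\<tau> j)) *
      W (\<lambda>j\<in>{..<d}. if j = i then t i (\<tau> i) else rem_point (n j) (t j) (y j) (\<tau> j))" for y :: "nat \<Rightarrow> real"
    show ?thesis
    proof (rule pseudo_polynomial_single[of i d "lagrange_poly (n i) (t i) (\<tau> i)" _ _ _ B])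
      fix x :: "nat \<Rightarrow> real" assume "x \<in> PiE {..<d} J"
      have "(\<lambda>j\<in>{..<d}. rem_point (n j) (t j) (x j) (\<tau> j)) = (\<lambda>j\<in>{..<d}. if j = i then t i (\<tau> i)
          else rem_point (n j) (t j) (restrict x D j) (\<tau> j))"
        using i by (auto simp: fun_eq_iff D_def rem_point_def)
      moreover have "(\<Prod>j<d. rem_coeff (n j) (t j) (x j) (\<tau> j)) =
         - poly (lagrange_poly (n i) (t i) (\<tau> i)) (x i) *
         (\<Prod>j\<in>D. rem_coeff (n j) (t j) (restrict x D j) (\<tau> j))"
        using i D by (simp add: rem_coeff_def[of "n i"])
      ultimately show "V \<tau> x = B (restrict x ({..<d} - {i})) * poly (lagrange_poly (n i) (t i) (\<tau> i)) (x i)"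
        unfolding V_def B_def D_def[symmetric] by simp
    qed (use i degree_lagrange_poly in auto)
  qed
  then have P: "pseudo_polynomial d (\<lambda>i. n i - 1) J (\<lambda>x. \<Sum>\<tau>\<in>?T - {top}. V \<tau> x)"
    by (rule pseudo_polynomial_sum)
  have "W x = (\<Sum>\<tau>\<in>?T - {top}. V \<tau> x)" if x: "x \<in> PiE {..<d} J" for x
  proof -
    have "(\<lambda>i\<in>{..<d}. rem_point (n i) (t i) (x i) (top i)) = x"
      using x by (auto simp: fun_eq_iff top_def rem_point_def PiE_iff extensional_def)
    moreover have "(\<Prod>i<d. rem_coeff (n i) (t i) (x i) (top i)) = 1"
      by (intro prod.neutral) (auto simp: top_def rem_coeff_def)
    ultimately have "V top x = - W x" by (simp add: V_def)
    moreover have "(\<Sum>\<tau>\<in>?T. V \<tau> x) = 0"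
      using assms[OF x] by (simp add: V_def remainder_def sum_negf)
    ultimately show ?thesis using sum.remove[OF T, of "\<lambda>\<tau>. V \<tau> x"] by simp
  qed
  then show ?thesis using P by (simp add: pseudo_polynomial_def)
qed

section \<open>Nonnegativity and boundedness of the grid masses\<close>

lemma open_interval_above:
  fixes S :: "real set"
  assumes "open S" "x \<in> S"
  shows "infinite (S \<inter> {x<..})"
proof -
  obtain e where e: "0 < e" "ball x e \<subseteq> S" using assms open_contains_ball by blast
  then have "{x<..<x + e} \<subseteq> S \<inter> {x<..}" by (auto simp: dist_real_def subset_iff)
  then show ?thesis using infinite_super[of "{x<..<x + e}"] infinite_Ioo[of x "x + e"] e(1) by simp
qed

lemma open_interval_below:
  fixes S :: "real set"
  assumes "open S" "x \<in> S"
  shows "infinite (S \<inter> {..<x})"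
proof -
  obtain e where e: "0 < e" "ball x e \<subseteq> S" using assms open_contains_ball by blast
  then have "{x - e<..<x} \<subseteq> S \<inter> {..<x}" by (auto simp: dist_real_def subset_iff)
  then show ?thesis using infinite_super[of "{x - e<..<x}"] infinite_Ioo[of "x - e" x] e(1) by simp
qed

definition grid_mass ::
  "nat \<Rightarrow> (nat \<Rightarrow> nat) \<Rightarrow> ((nat \<Rightarrow> real) \<Rightarrow> real) \<Rightarrow> (nat \<Rightarrow> real set) \<Rightarrow> (nat \<Rightarrow> real) \<Rightarrow> real" where
  "grid_mass d n f G \<sigma> = tensor d (\<lambda>i. diff_weight (n i) (G i) (\<sigma> i)) f"

text \<open>The mass is a multiple divided difference of \<open>f\<close> with
  \<open>n i + 1\<close> nodes in each coordinate, times the positive lengths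
  \<open>\<sigma> i - Min (preds (n i) (G i) (\<sigma> i))\<close>.\<close>

lemma grid_mass_nonneg:
  assumes f: "box_convex d n I f" and G: "\<And>i. i < d \<Longrightarrow> finite (G i) \<and> G i \<subseteq> I i"
    and \<sigma>: "\<And>i. i < d \<Longrightarrow> \<sigma> i \<in> atoms (n i) (G i)" and n: "\<And>i. i < d \<Longrightarrow> 1 \<le> n i"
  shows "0 \<le> grid_mass d n f G \<sigma>"
proof -
  let ?P = "\<lambda>i. preds (n i) (G i) (\<sigma> i)"
  have P: "finite (?P i)" "card (?P i) = n i" "?P i \<subseteq> G i \<inter> {..<\<sigma> i}" "\<sigma> i \<in> G i" if "i < d" for i
    using that G \<sigma> atoms_subset[of "n i" "G i"] by (auto intro!: finite_preds card_preds dest: preds_subset[THEN subsetD])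
  have min: "Min (?P i) < \<sigma> i" if "i < d" for i
  proof -
    have "?P i \<noteq> {}" using P(2)[OF that] n[OF that] by auto
    then have "Min (?P i) \<in> ?P i" using P(1)[OF that] by simp
    then show ?thesis using P(3)[OF that] by auto
  qed
  have "grid_mass d n f G \<sigma> =
      tensor d (\<lambda>i x. (\<sigma> i - Min (?P i)) * dd_weight (insert (\<sigma> i) (?P i)) x) f"
    unfolding grid_mass_def by (intro tensor_cong ext) (simp add: diff_weight_def)
  also have "\<dots> = (\<Prod>i<d. \<sigma> i - Min (?P i)) * tensor d (\<lambda>i. dd_weight (insert (\<sigma> i) (?P i))) f"
    by (rule tensor_scale[where G = "\<lambda>i. insert (\<sigma> i) (?P i)"]) (use P in \<open>auto simp: dd_weight_outside\<close>)
  also have "\<dots> \<ge> 0"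
  proof (rule mult_nonneg_nonneg)
    show "0 \<le> (\<Prod>i<d. \<sigma> i - Min (?P i))" using min by (intro prod_nonneg) (auto intro: less_imp_le)
    have "insert (\<sigma> i) (?P i) \<subseteq> I i \<and> finite (insert (\<sigma> i) (?P i)) \<and>
        card (insert (\<sigma> i) (?P i)) = Suc (n i)" if "i < d" for i
    proof -
      have "\<sigma> i \<notin> ?P i" using P(3)[OF that] by auto
      then show ?thesis using P[OF that] G[OF that] by auto
    qed
    then show "0 \<le> tensor d (\<lambda>i. dd_weight (insert (\<sigma> i) (?P i))) f"
      by (intro box_convex_tensor[OF f])
  qed
  finally show ?thesis .
qed

text \<open>The grid is enlarged by \<open>n i\<close> points \<open>Y i\<close> of
  \<open>I i\<close> below \<open>a i\<close> and as many, \<open>Z i\<close>, above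
  \<open>b i\<close>. The old masses do not change, the new ones are nonnegative, and the sum over
  all points above \<open>Y\<close> telescopes in each coordinate to an expression in
  \<open>Y\<close> and \<open>Z\<close> only. That expression is the bound.\<close>

lemma grid_mass_bounded:
  assumes f: "box_convex d n I f" and I: "\<And>i. i < d \<Longrightarrow> open (I i)"
    and ab: "\<And>i. i < d \<Longrightarrow> a i \<in> I i \<and> b i \<in> I i" and le: "\<And>i. i < d \<Longrightarrow> a i \<le> b i"
    and n: "\<And>i. i < d \<Longrightarrow> 1 \<le> n i"
  obtains M where "\<And>G. (\<And>i. i < d \<Longrightarrow> finite (G i) \<and> G i \<subseteq> I i \<inter> {a i..b i}) \<Longrightarrow>
    (\<Sum>\<sigma>\<in>PiE {..<d} (\<lambda>i. atoms (n i) (G i)). grid_mass d n f G \<sigma>) \<le> M"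
proof -
  have "\<exists>Y Z. Y \<subseteq> I i \<inter> {..<a i} \<and> finite Y \<and> card Y = n i \<and>
      Z \<subseteq> I i \<inter> {b i<..} \<and> finite Z \<and> card Z = n i" if "i < d" for i
    using infinite_arbitrarily_large[OF open_interval_below, of "I i" "a i" "n i"]
      infinite_arbitrarily_large[OF open_interval_above, of "I i" "b i" "n i"] I ab that by blast
  then obtain Y Z where
    Y: "\<And>i. i < d \<Longrightarrow> Y i \<subseteq> I i \<inter> {..<a i} \<and> finite (Y i) \<and> card (Y i) = n i" and
    Z: "\<And>i. i < d \<Longrightarrow> Z i \<subseteq> I i \<inter> {b i<..} \<and> finite (Z i) \<and> card (Z i) = n i" by metis
  show ?thesis
  proof (rule that)
    fix G :: "nat \<Rightarrow> real set" assume G: "\<And>i. i < d \<Longrightarrow> finite (G i) \<and> G i \<subseteq> I i \<inter> {a i..b i}"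
    define E where "E i = G i \<union> Z i" for i
    have E: "finite (E i)" "E i \<subseteq> I i" "\<And>y e. y \<in> Y i \<Longrightarrow> e \<in> E i \<Longrightarrow> y < e"
      "\<And>e z. e \<in> G i \<Longrightarrow> z \<in> Z i \<Longrightarrow> e < z" if "i < d" for i
    proof -
      note sub = G[OF that] Y[OF that] Z[OF that] le[OF that]
      show "finite (E i)" "E i \<subseteq> I i" using sub by (auto simp: E_def)
      show "e < z" if "e \<in> G i" "z \<in> Z i" for e z
      proof -
        have "e \<le> b i" "b i < z" using sub that by auto
        then show ?thesis by simp
      qed
      show "y < e" if "y \<in> Y i" "e \<in> E i" for y e
      proof -
        have "y < a i" using sub that by auto
        moreover have "a i \<le> e" using sub that by (auto simp: E_def)
        ultimately show ?thesis by simp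
      qed
    qed
    have ext: "\<sigma> i \<in> E i \<and> diff_weight (n i) (Y i \<union> E i) (\<sigma> i) = diff_weight (n i) (G i) (\<sigma> i)"
      if "\<sigma> \<in> PiE {..<d} (\<lambda>i. atoms (n i) (G i))" "i < d" for \<sigma> i
    proof -
      have s: "\<sigma> i \<in> atoms (n i) (G i)" using that by auto
      have "diff_weight (n i) (Y i \<union> (G i \<union> Z i)) (\<sigma> i) = diff_weight (n i) (G i) (\<sigma> i)"
      proof (rule diff_weight_extend[OF _ s])
        show "y < e" if "y \<in> Y i" "e \<in> G i" for y e using E(3)[OF \<open>i < d\<close> that(1)] that by (simp add: E_def)
        show "e < z" if "e \<in> G i" "z \<in> Z i" for e z using E(4)[OF \<open>i < d\<close> that] .
      qed (use G Y \<open>i < d\<close> in auto)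
      then show ?thesis using s atoms_subset by (auto simp: E_def)
    qed
    have atE: "E i \<subseteq> atoms (n i) (Y i \<union> E i)" if "i < d" for i
    proof
      fix s assume s: "s \<in> E i"
      then have "Y i \<subseteq> (Y i \<union> E i) \<inter> {..<s}" using E(3)[OF that] by auto
      then have "card (Y i) \<le> card ((Y i \<union> E i) \<inter> {..<s})"
        using E(1)[OF that] Y[OF that] by (intro card_mono) auto
      then show "s \<in> atoms (n i) (Y i \<union> E i)" using s Y[OF that] by (simp add: atoms_def)
    qed
    have "(\<Sum>\<sigma>\<in>PiE {..<d} (\<lambda>i. atoms (n i) (G i)). grid_mass d n f G \<sigma>) =
       (\<Sum>\<sigma>\<in>PiE {..<d} (\<lambda>i. atoms (n i) (G i)). grid_mass d n f (\<lambda>i. Y i \<union> E i) \<sigma>)"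
      unfolding grid_mass_def using ext by (intro sum.cong refl tensor_cong) auto
    also have "\<dots> \<le> (\<Sum>\<sigma>\<in>PiE {..<d} E. grid_mass d n f (\<lambda>i. Y i \<union> E i) \<sigma>)"
    proof (rule sum_mono2)
      show "finite (PiE {..<d} E)" using E(1) by (intro finite_PiE) auto
      show "PiE {..<d} (\<lambda>i. atoms (n i) (G i)) \<subseteq> PiE {..<d} E"
        by (intro PiE_mono) (auto simp: E_def dest: atoms_subset[THEN subsetD])
      fix \<sigma> assume "\<sigma> \<in> PiE {..<d} E - PiE {..<d} (\<lambda>i. atoms (n i) (G i))"
      then have "\<sigma> i \<in> atoms (n i) (Y i \<union> E i)" if "i < d" for i using atE[OF that] that by auto
      then show "0 \<le> grid_mass d n f (\<lambda>i. Y i \<union> E i) \<sigma>"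
        using E Y n by (intro grid_mass_nonneg[OF f]) auto
    qed
    also have "\<dots> = (\<Sum>\<sigma>\<in>PiE {..<d} E. (\<Prod>i<d. 1) *
        tensor d (\<lambda>i. diff_weight (n i) (Y i \<union> E i) (\<sigma> i)) f)"
      by (simp add: grid_mass_def)
    also have "\<dots> = tensor d (\<lambda>i x. dd_weight (Z i) x - dd_weight (Y i) x) f"
    proof (rule tensor_multilinear[symmetric, where G = "\<lambda>i. Y i \<union> E i"])
      fix i x assume i: "i < d"
      have "top_elems (n i) (Y i \<union> E i) = Z i"
      proof (rule top_elems_eqI)
        fix y z assume "y \<in> Y i \<union> E i - Z i" "z \<in> Z i"
        then show "y < z" using E(3)[OF i, of y z] E(4)[OF i, of y z] by (auto simp: E_def)
      qed (use i E Y Z in \<open>auto simp: E_def\<close>)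
      then show "dd_weight (Z i) x - dd_weight (Y i) x =
          (\<Sum>s\<in>E i. 1 * diff_weight (n i) (Y i \<union> E i) s x)"
        using sum_diff_weight[OF E(1)[OF i], of "Y i" "n i" x] E(3)[OF i] Y[OF i] n[OF i] by simp
    next
      fix i s x assume "i < d" "s \<in> E i" "x \<notin> Y i \<union> E i"
      then show "diff_weight (n i) (Y i \<union> E i) s x = 0" by (intro diff_weight_outside) auto
    qed (use E Y in auto)
    finally show "(\<Sum>\<sigma>\<in>PiE {..<d} (\<lambda>i. atoms (n i) (G i)). grid_mass d n f G \<sigma>)
      \<le> tensor d (\<lambda>i x. dd_weight (Z i) x - dd_weight (Y i) x) f" .
  qed
qed

text \<open>Predecessors look only to the left, so a grid may be cut from above without changing the
  remaining masses. This is why all boxes share the lower corner \<open>a\<close>.\<close>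

lemma preds_truncate: "s \<le> b \<Longrightarrow> preds n (G \<inter> {..b}) s = preds n G s"
proof -
  assume "s \<le> b"
  then have "G \<inter> {..b} \<inter> {..<s} = G \<inter> {..<s}" by auto
  then show ?thesis by (simp add: preds_def)
qed

lemma atoms_truncate: "atoms n (G \<inter> {..b}) = atoms n G \<inter> {..b}"
proof -
  have "G \<inter> {..b} \<inter> {..<s} = G \<inter> {..<s}" if "s \<le> b" for s using that by auto
  then show ?thesis by (auto simp: atoms_def)
qed

lemma grid_mass_truncate:
  assumes "\<And>i. i < d \<Longrightarrow> \<sigma> i \<le> b i"
  shows "grid_mass d n f (\<lambda>i. G i \<inter> {..b i}) \<sigma> = grid_mass d n f G \<sigma>"
  unfolding grid_mass_def using assms
  by (intro tensor_cong ext) (simp add: diff_weight_def preds_truncate)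

section \<open>The spline kernels\<close>

text \<open>The factors are exchanged one at a time. The base \<open>B + 1\<close> is at least 1,
  which lets the exponent be \<open>card S\<close> rather than \<open>card S - 1\<close>.\<close>

lemma abs_prod_diff_le:
  fixes a b :: "'i \<Rightarrow> real"
  assumes "finite S" "\<And>r. r \<in> S \<Longrightarrow> \<bar>a r\<bar> \<le> B \<and> \<bar>b r\<bar> \<le> B \<and> \<bar>a r - b r\<bar> \<le> e" "0 \<le> B" "0 \<le> e"
  shows "\<bar>(\<Prod>r\<in>S. a r) - (\<Prod>r\<in>S. b r)\<bar> \<le> real (card S) * (B + 1) ^ card S * e"
  using assms(1,2)
proof (induction S rule: finite_induct)
  case empty
  then show ?case by simp
next
  case (insert x S)
  let ?m = "card S"
  have IH: "\<bar>(\<Prod>r\<in>S. a r) - (\<Prod>r\<in>S. b r)\<bar> \<le> real ?m * (B + 1) ^ ?m * e" using insert by simp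
  have x: "\<bar>a x\<bar> \<le> B" "\<bar>a x - b x\<bar> \<le> e" using insert.prems by auto
  have "\<bar>\<Prod>r\<in>S. b r\<bar> \<le> (\<Prod>r\<in>S. B + 1)"
    unfolding abs_prod using insert.prems by (intro prod_mono) force
  then have b: "\<bar>\<Prod>r\<in>S. b r\<bar> \<le> (B + 1) ^ ?m" by simp
  have "(\<Prod>r\<in>insert x S. a r) - (\<Prod>r\<in>insert x S. b r) =
      a x * ((\<Prod>r\<in>S. a r) - (\<Prod>r\<in>S. b r)) + (a x - b x) * (\<Prod>r\<in>S. b r)"
    using insert.hyps by (simp add: algebra_simps)
  then have "\<bar>(\<Prod>r\<in>insert x S. a r) - (\<Prod>r\<in>insert x S. b r)\<bar> \<le>
      \<bar>a x\<bar> * \<bar>(\<Prod>r\<in>S. a r) - (\<Prod>r\<in>S. b r)\<bar> + \<bar>a x - b x\<bar> * \<bar>\<Prod>r\<in>S. b r\<bar>"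
    by (metis abs_mult abs_triangle_ineq)
  also have "\<dots> \<le> (B + 1) * (real ?m * (B + 1) ^ ?m * e) + e * (B + 1) ^ ?m"
    using IH x b assms by (intro add_mono mult_mono) auto
  also have "\<dots> \<le> (B + 1) * (real ?m * (B + 1) ^ ?m * e) + (B + 1) * (e * (B + 1) ^ ?m)"
    using assms mult_right_mono[of 1 "B + 1" "e * (B + 1) ^ ?m"] by simp
  also have "\<dots> = real (card (insert x S)) * (B + 1) ^ card (insert x S) * e"
    using insert.hyps by (simp add: algebra_simps)
  finally show ?case .
qed

definition kern :: "nat \<Rightarrow> real \<Rightarrow> real \<Rightarrow> real" where
  "kern n x u = max 0 (x - u) ^ (n - 1) / fact (n - 1)"

text \<open>The Peano kernel of Lagrange interpolation at the nodes \<open>t\<close>.\<close>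

definition rem_kern :: "nat \<Rightarrow> (nat \<Rightarrow> real) \<Rightarrow> real \<Rightarrow> real \<Rightarrow> real" where
  "rem_kern n t x u = (\<Sum>j\<le>n. rem_coeff n t x j * kern n (rem_point n t x j) u)"

lemma spline_kernel_eq: "spline_kernel d n x u = (\<Prod>j<d. kern (n j) (x j) (u j))"
  by (simp add: spline_kernel_def kern_def)

lemma kern_nonneg: "0 \<le> kern n x u"
  by (simp add: kern_def)

text \<open>For \<open>n = 1\<close> the convention \<open>0 ^ 0 = 1\<close> would make the kernel
  equal to 1 here.\<close>

lemma kern_zero: "x \<le> u \<Longrightarrow> 2 \<le> n \<Longrightarrow> kern n x u = 0"
  by (simp add: kern_def)

lemma continuous_on_kern [continuous_intros]:
  "continuous_on S g \<Longrightarrow> continuous_on S h \<Longrightarrow> continuous_on S (\<lambda>y. kern n (g y) (h y))"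
  unfolding kern_def by (intro continuous_intros) auto

lemma kern_le:
  assumes "a \<le> u" "x \<le> b" "a \<le> b"
  shows "kern n x u \<le> (b - a) ^ (n - 1)"
proof -
  have "max 0 (x - u) ^ (n - 1) \<le> (b - a) ^ (n - 1)" using assms by (intro power_mono) auto
  moreover have "(1::real) \<le> fact (n - 1)" by (rule fact_ge_1)
  moreover have "0 \<le> max 0 (x - u) ^ (n - 1)" by simp
  ultimately show ?thesis unfolding kern_def
    by (smt (verit) divide_left_mono div_by_1 fact_gt_zero zero_less_mult_iff zero_less_one)
qed

lemma rem_kern_zero_right:
  assumes "2 \<le> n" "x \<le> u" "\<And>j. j < n \<Longrightarrow> t j \<le> u"
  shows "rem_kern n t x u = 0"
  using assms by (auto simp: rem_kern_def rem_point_def kern_zero intro!: sum.neutral)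

text \<open>To the left of all evaluation points the truncation is inactive, and the remainder
  annihilates a polynomial of degree \<open>n - 1\<close>.\<close>

lemma rem_kern_zero_left:
  assumes "1 \<le> n" "u \<le> x" "\<And>j. j < n \<Longrightarrow> u \<le> t j" "inj_on t {..<n}"
  shows "rem_kern n t x u = 0"
proof -
  let ?p = "smult (1 / fact (n - 1)) ([:- u, 1:] ^ (n - 1))"
  have "rem_kern n t x u = (\<Sum>j\<le>n. rem_coeff n t x j * poly ?p (rem_point n t x j))"
    unfolding rem_kern_def using assms by (intro sum.cong) (auto simp: kern_def rem_point_def max_def)
  also have "\<dots> = 0"
    using assms by (intro rem_coeff_annihilates)
      (auto simp: degree_linear_power intro: le_less_trans[OF degree_smult_le])
  finally show ?thesis .
qed

text \<open>Both kernels vanish for \<open>x < s\<close>. Otherwise they are products of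
  \<open>n - 1\<close> factors \<open>x - r\<close> and \<open>x - s\<close>, bounded by
  \<open>b - a\<close> and differing by at most \<open>e\<close>; dividing by the factorial only
  reduces the error.\<close>

lemma discrete_kernel_approx:
  assumes G: "finite G" "G \<subseteq> {a..}" and s: "s \<in> atoms n G" "s \<le> b" and x: "a \<le> x" "x \<le> b"
    and n: "2 \<le> n" and e: "\<And>r. r \<in> preds n G s \<Longrightarrow> s - r \<le> e" "0 \<le> e"
  shows "\<bar>discrete_kernel n G s x / fact (n - 1) - kern n x s\<bar> \<le> real n * (b - a + 1) ^ (n - 1) * e"
proof -
  have f1: "(1::real) \<le> fact (n - 1)" by (rule fact_ge_1)
  show ?thesis
  proof (cases "x < s")
    case True
    then show ?thesis using kern_zero[of x s n] n x e by (simp add: discrete_kernel_def)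
  next
    case False
    let ?P = "preds n G s"
    let ?S = "?P - {Min ?P}"
    have P: "finite ?P" "card ?P = n" "?P \<subseteq> G \<inter> {..<s}"
      using G s by (auto intro!: finite_preds card_preds dest: preds_subset[THEN subsetD])
    then have "?P \<noteq> {}" using n by auto
    then have card: "card ?S = n - 1" using P by simp
    have "\<bar>(\<Prod>r\<in>?S. x - r) - (\<Prod>r\<in>?S. x - s)\<bar> \<le> real (card ?S) * (b - a + 1) ^ card ?S * e"
    proof (rule abs_prod_diff_le)
      fix r assume r: "r \<in> ?S"
      then have "a \<le> r" "r < s" "s - r \<le> e" using P G e by auto
      then show "\<bar>x - r\<bar> \<le> b - a \<and> \<bar>x - s\<bar> \<le> b - a \<and> \<bar>x - r - (x - s)\<bar> \<le> e"
        using False x by auto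
    qed (use P x e in auto)
    also have "\<dots> \<le> real n * (b - a + 1) ^ (n - 1) * e"
      unfolding card using x e by (intro mult_right_mono) auto
    finally have *: "\<bar>(\<Prod>r\<in>?S. x - r) - (x - s) ^ (n - 1)\<bar> \<le> real n * (b - a + 1) ^ (n - 1) * e"
      by (simp add: card)
    have "discrete_kernel n G s x / fact (n - 1) - kern n x s =
       ((\<Prod>r\<in>?S. x - r) - (x - s) ^ (n - 1)) / fact (n - 1)"
      using False by (simp add: discrete_kernel_def kern_def diff_divide_distrib max_def)
    then have "\<bar>discrete_kernel n G s x / fact (n - 1) - kern n x s\<bar> =
        \<bar>(\<Prod>r\<in>?S. x - r) - (x - s) ^ (n - 1)\<bar> / fact (n - 1)" by simp
    also have "\<dots> \<le> \<bar>(\<Prod>r\<in>?S. x - r) - (x - s) ^ (n - 1)\<bar> / 1"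
      using f1 by (intro divide_left_mono) auto
    finally show ?thesis using * by simp
  qed
qed

section \<open>Refining grids\<close>

text \<open>The first points of the enumeration \<open>q\<close>, together with those points of
  spacing \<open>1 / Suc N\<close> from \<open>a\<close> up to \<open>a + N\<close> that lie in
  \<open>S\<close>. The window grows while the spacing shrinks, and each point of \<open>q\<close>
  is eventually included; the equidistant parts are not nested.\<close>

definition grid :: "real set \<Rightarrow> real \<Rightarrow> (nat \<Rightarrow> real) \<Rightarrow> nat \<Rightarrow> real set" where
  "grid S a q N = q ` {..N} \<union> (\<lambda>j. a + real j / real (Suc N)) ` {..N * Suc N} \<inter> S"

lemma finite_grid: "finite (grid S a q N)"
  by (simp add: grid_def)

lemma grid_subset: "range q \<subseteq> S \<inter> {a..} \<Longrightarrow> grid S a q N \<subseteq> S \<inter> {a..}"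
  by (auto simp: grid_def)

text \<open>A gap larger than \<open>n\<close> spacings would contain \<open>n\<close> equidistant
  points strictly between \<open>r\<close> and \<open>s\<close>, and then \<open>r\<close> would not
  be among the \<open>n\<close> predecessors of \<open>s\<close>.\<close>

lemma grid_mesh:
  assumes S: "is_interval S" "range q \<subseteq> S \<inter> {a..}" and s: "s \<in> grid S a q N" "s \<le> a + real N"
    and r: "r \<in> preds n (grid S a q N) s"
  shows "s - r \<le> real n / real (Suc N)"
proof (rule ccontr)
  assume "\<not> ?thesis"
  then have gap: "real n / real (Suc N) < s - r" by simp
  let ?G = "grid S a q N"
  have rG: "r \<in> ?G" "r < s" "r \<in> S" "s \<in> S" "a \<le> r"
    using r s preds_subset[of n ?G s] grid_subset[OF S(2), of N] by auto
  have card: "card {y \<in> ?G \<inter> {..<s}. r < y} < n" using r by (simp add: preds_def top_elems_def)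
  define j0 where "j0 = nat \<lfloor>(r - a) * real (Suc N)\<rfloor>"
  define g where "g j = a + real j / real (Suc N)" for j
  have j0: "real j0 \<le> (r - a) * real (Suc N)" "(r - a) * real (Suc N) < real j0 + 1"
    using rG by (auto simp: j0_def)
  have "inj_on g {Suc j0..j0 + n}" by (auto simp: inj_on_def g_def)
  then have "card (g ` {Suc j0..j0 + n}) = n" by (simp add: card_image)
  moreover have "g ` {Suc j0..j0 + n} \<subseteq> {y \<in> ?G \<inter> {..<s}. r < y}"
  proof
    fix y assume "y \<in> g ` {Suc j0..j0 + n}"
    then obtain j where j: "Suc j0 \<le> j" "j \<le> j0 + n" "y = g j" by auto
    have "(r - a) * real (Suc N) < real j" using j0 j by linarith
    then have ry: "r < y" by (simp add: j g_def field_simps)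
    have "real j \<le> (r - a) * real (Suc N) + real n" using j0 j by linarith
    then have "real j / real (Suc N) \<le> ((r - a) * real (Suc N) + real n) / real (Suc N)"
      by (intro divide_right_mono) auto
    also have "\<dots> = r - a + real n / real (Suc N)" by (simp add: add_divide_distrib del: of_nat_Suc)
    finally have "y \<le> r + real n / real (Suc N)" by (simp add: j g_def)
    then have ys: "y < s" using gap by simp
    have "y \<in> S" using mem_is_interval_1_I[OF S(1) rG(3,4)] ry ys by simp
    moreover have "real j / real (Suc N) < real N" using ys s by (simp add: j g_def)
    then have "real j < real (N * Suc N)" by (simp add: field_simps)
    then have "j \<le> N * Suc N" unfolding of_nat_less_iff by simp
    ultimately show "y \<in> {y \<in> ?G \<inter> {..<s}. r < y}" using ry ys by (auto simp: grid_def j g_def)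
  qed
  then have "card (g ` {Suc j0..j0 + n}) \<le> card {y \<in> ?G \<inter> {..<s}. r < y}"
    by (intro card_mono) (auto simp: finite_grid)
  ultimately show False using card by simp
qed

section \<open>The representing measure\<close>

lemma open_exhaustion:
  fixes S :: "real set"
  assumes "open S" "is_interval S" "a \<in> S"
  obtains b :: "nat \<Rightarrow> real" where "\<And>m. b m \<in> S" "\<And>m. a < b m" "strict_mono b" "\<And>x. x \<in> S \<Longrightarrow> \<exists>m. x \<le> b m"
proof -
  have above: "\<exists>y\<in>S. x < y" if "x \<in> S" for x
    using open_interval_above[OF assms(1) that] by (metis IntE greaterThan_iff infinite_imp_nonempty equals0I)
  define q where "q = from_nat_into (\<rat> :: real set)"
  have q: "range q = \<rat>" unfolding q_def using Rats_0 by (intro range_from_nat_into countable_rat) blast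
  \<comment> \<open>It suffices that the sequence passes every rational point of \<open>S\<close>,
    since each point of \<open>S\<close> has such a rational above it.\<close>
  have "\<exists>b. \<forall>m. (b m \<in> S \<and> a < b m) \<and> (b m < b (Suc m) \<and> (q m \<in> S \<longrightarrow> q m \<le> b (Suc m)))"
  proof (rule dependent_nat_choice)
    show "\<exists>x. x \<in> S \<and> a < x" using above assms by blast
    fix x m assume x: "x \<in> S \<and> a < x"
    have "(if q m \<in> S then max x (q m) else x) \<in> S" using x by (auto simp: max_def)
    from above[OF this] show "\<exists>y. (y \<in> S \<and> a < y) \<and> x < y \<and> (q m \<in> S \<longrightarrow> q m \<le> y)"
      using x by (force split: if_splits)
  qed
  then obtain b where b: "\<And>m. b m \<in> S \<and> a < b m" "\<And>m. b m < b (Suc m)"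
    "\<And>m. q m \<in> S \<Longrightarrow> q m \<le> b (Suc m)" by blast
  show ?thesis
  proof
    show "strict_mono b" using b(2) by (simp add: strict_mono_Suc_iff)
    fix x assume x: "x \<in> S"
    then obtain y where y: "y \<in> S" "x < y" using above by blast
    obtain z where z: "z \<in> \<rat>" "x < z" "z < y" using Rats_dense_in_real[OF y(2)] by blast
    have zS: "z \<in> S" using mem_is_interval_1_I[OF assms(2) x y(1)] z by simp
    obtain m where m: "q m = z" using q z(1) by (metis rangeE)
    then have "x \<le> b (Suc m)" using b(3)[of m] zS z by simp
    then show "\<exists>m. x \<le> b m" by blast
  qed (use b in auto)
qed

section \<open>Necessity at a fixed lower corner \<open>a\<close>\<close>

locale taylor_setup =
  fixes d :: nat and n :: "nat \<Rightarrow> nat" and I :: "nat \<Rightarrow> real set" and f :: "(nat \<Rightarrow> real) \<Rightarrow> real"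
    and a :: "nat \<Rightarrow> real" and b t :: "nat \<Rightarrow> nat \<Rightarrow> real"
  assumes d: "1 \<le> d" and n: "\<And>i. i < d \<Longrightarrow> 2 \<le> n i"
    and opn: "\<And>i. i < d \<Longrightarrow> open (I i)" and intv: "\<And>i. i < d \<Longrightarrow> is_interval (I i)"
    and convex: "box_convex d n I f"
    and a: "\<And>i. i < d \<Longrightarrow> a i \<in> I i"
    and b: "\<And>i m. i < d \<Longrightarrow> b i m \<in> I i" "\<And>i m. i < d \<Longrightarrow> a i < b i m"
      "\<And>i. i < d \<Longrightarrow> strict_mono (b i)" "\<And>i x. i < d \<Longrightarrow> x \<in> I i \<Longrightarrow> \<exists>m. x \<le> b i m"
    and t: "\<And>i j. i < d \<Longrightarrow> j < n i \<Longrightarrow> t i j \<in> I i \<inter> {a i<..}"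
      "\<And>i. i < d \<Longrightarrow> inj_on (t i) {..<n i}"
begin

definition J :: "nat \<Rightarrow> real set" where "J i = I i \<inter> {a i<..}"

text \<open>Unlike \<open>J\<close>, the boxes contain their lower faces: grid points can approach
  \<open>a i\<close>, so the limit measure may charge the faces. \<open>\<Phi>_boundary\<close>
  makes this harmless.\<close>

definition X :: "nat \<Rightarrow> (nat \<Rightarrow> real) set" where "X m = PiE {..<d} (\<lambda>i. {a i..b i m})"

definition \<Phi> :: "(nat \<Rightarrow> real) \<Rightarrow> (nat \<Rightarrow> real) \<Rightarrow> real" where
  "\<Phi> x u = (\<Prod>i<d. rem_kern (n i) (t i) (x i) (u i))"

definition good_measure :: "(nat \<Rightarrow> real) measure \<Rightarrow> bool" where
  "good_measure \<mu> \<longleftrightarrow> sets \<mu> = sets borel \<and> emeasure \<mu> (- (\<Union>m. X m)) = 0 \<and> (\<forall>m. emeasure \<mu> (X m) < \<infinity>)"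

lemma b_mono: "i < d \<Longrightarrow> m \<le> m' \<Longrightarrow> b i m \<le> b i m'"
  using b(3) strict_mono_less_eq by blast

lemma level:
  assumes "\<And>i. i < d \<Longrightarrow> x i \<in> I i"
  shows "\<exists>m. \<forall>i<d. x i \<le> b i m"
proof -
  have "\<exists>m. i < d \<longrightarrow> x i \<le> b i m" for i using b(4)[of i "x i"] assms[of i] by blast
  then obtain l where l: "\<And>i. i < d \<Longrightarrow> x i \<le> b i (l i)" by metis
  have "x i \<le> b i (Max (l ` {..<d}))" if "i < d" for i
    using l[OF that] b_mono[OF that, of "l i" "Max (l ` {..<d})"] that by (force intro: order_trans Max_ge)
  then show ?thesis by blast
qed

lemma level_t:
  assumes "\<And>i. i < d \<Longrightarrow> x i \<in> I i"
  shows "\<exists>m. \<forall>i<d. x i \<le> b i m \<and> (\<forall>j<n i. t i j \<le> b i m)"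
proof -
  define y where "y i = Max (insert (x i) (t i ` {..<n i}))" for i
  have y: "y i \<in> insert (x i) (t i ` {..<n i})" for i unfolding y_def by (rule Max_in) auto
  have "y i \<in> I i" if "i < d" for i using y[of i] assms[OF that] t(1)[OF that] by auto
  then obtain m where m: "\<And>i. i < d \<Longrightarrow> y i \<le> b i m" using level[of y] by blast
  have "x i \<le> y i" "\<And>j. j < n i \<Longrightarrow> t i j \<le> y i" for i by (auto simp: y_def)
  then show ?thesis using m by (meson order_trans)
qed

lemma X_mono: "X m \<subseteq> X (Suc m)"
  unfolding X_def using b_mono[of _ m "Suc m"] by (intro PiE_mono) force

lemma Un_X: "(\<Union>m. X m) = PiE {..<d} (\<lambda>i. I i \<inter> {a i..})"
proof (intro equalityI subsetI)
  fix u assume "u \<in> (\<Union>m. X m)"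
  then obtain m where u: "u \<in> X m" by blast
  have "u i \<in> I i" if "i < d" for i
    using mem_is_interval_1_I[OF intv[OF that] a[OF that] b(1)[OF that, of m], of "u i"] u that
    by (auto simp: X_def PiE_iff)
  then show "u \<in> PiE {..<d} (\<lambda>i. I i \<inter> {a i..})" using u by (auto simp: X_def PiE_iff)
next
  fix u assume u: "u \<in> PiE {..<d} (\<lambda>i. I i \<inter> {a i..})"
  then obtain m where "\<And>i. i < d \<Longrightarrow> u i \<le> b i m" using level[of u] by (auto simp: PiE_iff)
  then show "u \<in> (\<Union>m. X m)" using u by (auto simp: X_def PiE_iff)
qed

lemma continuous_\<Phi>: "continuous_on UNIV (\<Phi> x)"
  unfolding \<Phi>_def rem_kern_def by (intro continuous_intros continuous_on_product_coordinates)

lemma \<Phi>_outside: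
  assumes "\<And>i. i < d \<Longrightarrow> x i \<le> b i m \<and> (\<forall>j<n i. t i j \<le> b i m)" "u \<in> (\<Union>m. X m)" "u \<notin> X m"
  shows "\<Phi> x u = 0"
proof -
  obtain i where i: "i < d" "b i m < u i"
    using assms(2,3) unfolding Un_X by (force simp: X_def PiE_iff not_le)
  have "rem_kern (n i) (t i) (x i) (u i) = 0"
    using assms(1)[OF i(1)] i n[OF i(1)] by (intro rem_kern_zero_right) force+
  then show ?thesis unfolding \<Phi>_def using i by (intro prod_zero) auto
qed

lemma \<Phi>_boundary:
  assumes "x \<in> PiE {..<d} J" "u \<in> (\<Union>m. X m)" "u \<notin> PiE {..<d} J"
  shows "\<Phi> x u = 0"
proof -
  obtain i where i: "i < d" "u i = a i"
    using assms(2,3) unfolding Un_X by (force simp: J_def PiE_iff)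
  have "1 \<le> n i" using n[OF i(1)] by simp
  moreover have "a i \<le> x i" using assms(1) i by (force simp: J_def PiE_iff)
  moreover have "a i \<le> t i j" if "j < n i" for j using t(1)[OF i(1) that] by simp
  ultimately have "rem_kern (n i) (t i) (x i) (u i) = 0"
    unfolding i(2) using t(2)[OF i(1)] by (intro rem_kern_zero_left)
  then show ?thesis unfolding \<Phi>_def using i(1) by (intro prod_zero) auto
qed

text \<open>Such a function is an admissible test function for the vague limit and dominates the
  indicator of \<open>X m\<close>, which gives finite mass on \<open>X m\<close>.\<close>

lemma cutoff:
  obtains \<eta> :: "(nat \<Rightarrow> real) \<Rightarrow> real" where "continuous_on UNIV \<eta>" "\<forall>u. 0 \<le> \<eta> u"
    "\<forall>u\<in>X m. \<eta> u = 1" "\<forall>u\<in>(\<Union>m. X m) - X (Suc m). \<eta> u = 0"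
proof
  define \<eta> :: "(nat \<Rightarrow> real) \<Rightarrow> real" where
    "\<eta> u = (\<Prod>i<d. min 1 (max 0 ((b i (Suc m) - u i) / (b i (Suc m) - b i m))))" for u
  have lt: "b i m < b i (Suc m)" if "i < d" for i using b(3)[OF that] by (simp add: strict_mono_Suc_iff)
  show "continuous_on UNIV \<eta>"
    unfolding \<eta>_def using lt by (intro continuous_intros continuous_on_product_coordinates) force
  show "\<forall>u. 0 \<le> \<eta> u" unfolding \<eta>_def by (intro allI prod_nonneg) auto
  show "\<forall>u\<in>X m. \<eta> u = 1"
    unfolding \<eta>_def
  proof (intro prod.neutral ballI)
    fix u i assume "u \<in> X m" and i: "i \<in> {..<d}"
    then have "u i \<le> b i m" by (auto simp: X_def PiE_iff)
    then have "1 \<le> (b i (Suc m) - u i) / (b i (Suc m) - b i m)" using lt[of i] i by simp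
    then show "min 1 (max 0 ((b i (Suc m) - u i) / (b i (Suc m) - b i m))) = 1" by simp
  qed
  show "\<forall>u\<in>(\<Union>m. X m) - X (Suc m). \<eta> u = 0"
  proof
    fix u assume u: "u \<in> (\<Union>m. X m) - X (Suc m)"
    obtain i where i: "i < d" "b i (Suc m) < u i"
      using u unfolding Un_X by (force simp: X_def PiE_iff not_le)
    then have "(b i (Suc m) - u i) / (b i (Suc m) - b i m) \<le> 0"
      using lt[of i] by (intro divide_nonpos_pos) auto
    then show "\<eta> u = 0" unfolding \<eta>_def using i by (intro prod_zero) (auto intro!: bexI[of _ i])
  qed
qed

lemma compact_X: "compact (X m)"
proof -
  have "X m = PiE UNIV (\<lambda>i. if i < d then {a i..b i m} else {undefined})"
    unfolding X_def PiE_iff set_eq_iff by (simp add: extensional_def split: if_split) blast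
  moreover have "compactin (product_topology (\<lambda>i::nat. euclidean :: real topology) UNIV)
      (PiE UNIV (\<lambda>i. if i < d then {a i..b i m} else {undefined}))"
    by (auto simp: compactin_PiE compactin_euclidean_iff)
  ultimately show ?thesis by (simp add: euclidean_product_topology)
qed

lemma X_borel: "X m \<in> sets borel"
  by (intro borel_closed compact_imp_closed compact_X)

text \<open>In each coordinate the remainder weight annihilates polynomials of degree below
  \<open>n i\<close>, so \<open>discrete_taylor\<close> applies to it; the expansions are then
  multiplied out.\<close>

lemma remainder_grid:
  assumes G: "\<And>i. i < d \<Longrightarrow> finite (G i)"
    and pts: "\<And>i j. i < d \<Longrightarrow> j \<le> n i \<Longrightarrow> rem_point (n i) (t i) (x i) j \<in> G i"
  shows "remainder d n t f x = (\<Sum>\<sigma>\<in>PiE {..<d} (\<lambda>i. atoms (n i) (G i)).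
    (\<Prod>i<d. \<Sum>j\<le>n i. rem_coeff (n i) (t i) (x i) j *
       discrete_kernel (n i) (G i) (\<sigma> i) (rem_point (n i) (t i) (x i) j)) * grid_mass d n f G \<sigma>)"
  unfolding remainder_eq_tensor grid_mass_def
proof (rule tensor_multilinear[where G = G])
  fix i y assume i: "i < d"
  let ?w = "rem_weight (n i) (t i) (x i)"
  have s: "(\<Sum>y\<in>G i. ?w y * \<phi> y) = (\<Sum>j\<le>n i. rem_coeff (n i) (t i) (x i) j * \<phi> (rem_point (n i) (t i) (x i) j))"
    for \<phi> using G i pts by (intro sum_rem_weight) auto
  show "?w y = (\<Sum>s\<in>atoms (n i) (G i). (\<Sum>j\<le>n i. rem_coeff (n i) (t i) (x i) j *
       discrete_kernel (n i) (G i) s (rem_point (n i) (t i) (x i) j)) * diff_weight (n i) (G i) s y)"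
  proof (cases "y \<in> G i")
    case True
    show ?thesis
      unfolding s[symmetric]
    proof (rule discrete_taylor[OF _ _ _ True])
      show "(\<Sum>x\<in>G i. ?w x * poly p x) = 0" if "degree p < n i" for p
        unfolding s using that t(2)[OF i] by (rule rem_coeff_annihilates)
    qed (use G i n[OF i] in auto)
  next
    case False
    have "diff_weight (n i) (G i) s y = 0" if "s \<in> atoms (n i) (G i)" for s
      using that False atoms_subset by (intro diff_weight_outside) auto
    moreover have "?w y = 0" using False pts i by (intro rem_weight_outside) auto
    ultimately show ?thesis by simp
  qed
next
  fix i s y assume "i < d" "s \<in> atoms (n i) (G i)" "y \<notin> G i"
  then show "diff_weight (n i) (G i) s y = 0" using atoms_subset by (intro diff_weight_outside) auto
qed (use G finite_atoms in auto)

lemma exists_measure_countable: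
  assumes D: "\<And>i. i < d \<Longrightarrow> countable (D i) \<and> D i \<subseteq> J i" "\<And>i j. i < d \<Longrightarrow> j < n i \<Longrightarrow> t i j \<in> D i"
  obtains \<mu> where "good_measure \<mu>"
    "\<And>x. x \<in> PiE {..<d} D \<Longrightarrow> remainder d n t f x = (\<integral>u. \<Phi> x u \<partial>\<mu>)"
proof -
  define q where "q i = from_nat_into (D i)" for i
  have ne: "D i \<noteq> {}" if "i < d" for i using D(2)[OF that, of 0] n[OF that] by auto
  have q: "range (q i) = D i" if "i < d" for i
    using range_from_nat_into[OF ne[OF that]] D(1)[OF that] by (simp add: q_def)
  have qJ: "range (q i) \<subseteq> I i \<inter> {a i..}" if "i < d" for i
    unfolding q[OF that] using D(1)[OF that] by (auto simp: J_def)
  define G where "G N i = grid (I i) (a i) (q i) N" for N i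
  have G: "finite (G N i)" "G N i \<subseteq> I i \<inter> {a i..}" if "i < d" for N i
    using finite_grid grid_subset[OF qJ[OF that]] by (auto simp: G_def)
  define A where "A N = PiE {..<d} (\<lambda>i. atoms (n i) (G N i))" for N
  have finA: "finite (A N)" for N
    unfolding A_def using G finite_atoms by (intro finite_PiE) auto
  have atG: "atoms (n i) (G N i) \<subseteq> I i \<inter> {a i..}" if "i < d" for N i
    using G[OF that, of N] atoms_subset[of "n i" "G N i"] by blast
  then have AX: "A N \<subseteq> (\<Union>m. X m)" for N
    unfolding A_def Un_X by (intro PiE_mono) auto
  \<comment> \<open>The discrete kernels lack the factor \<open>1 / fact (n i - 1)\<close> of the
    spline kernel; the factorials are moved into the masses.\<close>
  define F :: real where "F = (\<Prod>i<d. fact (n i - 1))"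
  have F: "0 < F" unfolding F_def by (intro prod_pos) auto
  define c where "c N \<sigma> = F * grid_mass d n f (G N) \<sigma>" for N \<sigma>
  have c0: "0 \<le> c N \<sigma>" if "\<sigma> \<in> A N" for N \<sigma>
  proof -
    have "0 \<le> grid_mass d n f (G N) \<sigma>"
    proof (rule grid_mass_nonneg[OF convex])
      show "finite (G N i) \<and> G N i \<subseteq> I i" if "i < d" for i using G[OF that, of N] by auto
      show "\<sigma> i \<in> atoms (n i) (G N i)" if "i < d" for i using \<open>\<sigma> \<in> A N\<close> that by (auto simp: A_def)
      show "1 \<le> n i" if "i < d" for i using n[OF that] by simp
    qed
    then show ?thesis using F by (simp add: c_def)
  qed
  have "\<exists>M. \<forall>G. (\<forall>i<d. finite (G i) \<and> G i \<subseteq> I i \<inter> {a i..b i m}) \<longrightarrow>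
      (\<Sum>\<sigma>\<in>PiE {..<d} (\<lambda>i. atoms (n i) (G i)). grid_mass d n f G \<sigma>) \<le> M" for m
  proof -
    have 1: "a i \<in> I i \<and> b i m \<in> I i" "a i \<le> b i m" "1 \<le> n i" if "i < d" for i
      using a[OF that] b(1,2)[OF that, of m] n[OF that] by auto
    from grid_mass_bounded[OF convex opn 1] show ?thesis by metis
  qed
  then obtain M where M: "\<And>m G. (\<And>i. i < d \<Longrightarrow> finite (G i) \<and> G i \<subseteq> I i \<inter> {a i..b i m}) \<Longrightarrow>
      (\<Sum>\<sigma>\<in>PiE {..<d} (\<lambda>i. atoms (n i) (G i)). grid_mass d n f G \<sigma>) \<le> M m" by metis
  \<comment> \<open>Inside \<open>X m\<close> the atoms are those of the grid cut off above
    \<open>b i m\<close>, with the same masses. The bound for grids in a fixed box thus applies with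
    a constant independent of \<open>N\<close>.\<close>
  have mass: "(\<Sum>\<sigma>\<in>A N \<inter> X m. c N \<sigma>) \<le> F * M m" for N m
  proof -
    let ?H = "\<lambda>i. G N i \<inter> {..b i m}"
    have "A N \<inter> X m = PiE {..<d} (\<lambda>i. atoms (n i) (G N i) \<inter> {a i..b i m})"
      unfolding A_def X_def by (auto simp: PiE_iff)
    also have "\<dots> = PiE {..<d} (\<lambda>i. atoms (n i) (?H i))"
      unfolding atoms_truncate using atG by (intro PiE_cong) force
    finally have eq: "A N \<inter> X m = PiE {..<d} (\<lambda>i. atoms (n i) (?H i))" .
    have "(\<Sum>\<sigma>\<in>A N \<inter> X m. c N \<sigma>) = F * (\<Sum>\<sigma>\<in>A N \<inter> X m. grid_mass d n f (G N) \<sigma>)"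
      by (simp add: c_def sum_distrib_left)
    also have "(\<Sum>\<sigma>\<in>A N \<inter> X m. grid_mass d n f (G N) \<sigma>) = (\<Sum>\<sigma>\<in>A N \<inter> X m. grid_mass d n f ?H \<sigma>)"
      by (intro sum.cong refl grid_mass_truncate[symmetric]) (auto simp: X_def PiE_iff)
    also have "\<dots> \<le> M m" unfolding eq using G by (intro M) force
    finally show ?thesis using F by simp
  qed
  obtain K :: "real set" where K: "compact K" "K \<subseteq> {0..1}"
    and onto: "\<forall>p p' :: nat \<Rightarrow> real. (\<forall>i<d. p i \<le> p' i) \<longrightarrow>
      (\<exists>\<gamma>. continuous_on K \<gamma> \<and> \<gamma> ` K = PiE {..<d} (\<lambda>i. {p i..p' i}))"
    by (rule exists_compact_onto_boxes[OF d])
  have "\<exists>\<gamma>. continuous_on K \<gamma> \<and> \<gamma> ` K = X m" for m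
    unfolding X_def by (rule onto[rule_format]) (auto intro: less_imp_le b(2))
  then obtain \<gamma> where \<gamma>: "\<And>m. continuous_on K (\<gamma> m)" "\<And>m. \<gamma> m ` K = X m" by metis
  obtain r \<mu> where r: "strict_mono (r :: nat \<Rightarrow> nat)" and \<mu>: "sets \<mu> = sets borel"
    "emeasure \<mu> (- (\<Union>m. X m)) = 0" and
    conv: "\<forall>\<phi> m. continuous_on UNIV \<phi> \<longrightarrow> (\<forall>x\<in>(\<Union>m. X m) - X m. \<phi> x = 0) \<longrightarrow>
      integrable \<mu> \<phi> \<and> (\<lambda>N. \<Sum>\<sigma>\<in>A (r N). c (r N) \<sigma> * \<phi> \<sigma>) \<longlonglongrightarrow> (\<integral>x. \<phi> x \<partial>\<mu> :: real)"
    by (rule vague_compactness[where A = A and c = c and M = "\<lambda>m. F * M m", OF K \<gamma> X_mono finA AX c0 mass])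
      (assumption, blast)
  have "emeasure \<mu> (X m) < \<infinity>" for m
  proof -
    obtain \<eta> :: "(nat \<Rightarrow> real) \<Rightarrow> real" where \<eta>: "continuous_on UNIV \<eta>" "\<forall>u. 0 \<le> \<eta> u" "\<forall>u\<in>X m. \<eta> u = 1"
      "\<forall>u\<in>(\<Union>m. X m) - X (Suc m). \<eta> u = 0" using cutoff[of m] by blast
    have "integrable \<mu> \<eta>" using conv \<eta>(1,4) by blast
    have "emeasure \<mu> (X m) = (\<integral>\<^sup>+u. indicator (X m) u \<partial>\<mu>)" using X_borel \<mu> by simp
    also have "\<dots> \<le> (\<integral>\<^sup>+u. ennreal (\<eta> u) \<partial>\<mu>)"
      using \<eta>(2,3) by (intro nn_integral_mono) (auto split: split_indicator)
    also have "\<dots> < \<infinity>"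
      using \<open>integrable \<mu> \<eta>\<close> \<eta>(2) by (simp add: nn_integral_eq_integral)
    finally show ?thesis .
  qed
  then have good: "good_measure \<mu>" using \<mu> by (simp add: good_measure_def)
  have "remainder d n t f x = (\<integral>u. \<Phi> x u \<partial>\<mu>)" if x: "x \<in> PiE {..<d} D" for x
  proof -
    have xI: "x i \<in> I i" "a i < x i" if "i < d" for i using x D(1)[OF that] that by (auto simp: J_def PiE_iff)
    obtain m where m: "\<And>i. i < d \<Longrightarrow> x i \<le> b i m \<and> (\<forall>j<n i. t i j \<le> b i m)"
      using level_t[of x] xI by blast
    have pt: "a i \<le> rem_point (n i) (t i) (x i) j" "rem_point (n i) (t i) (x i) j \<le> b i m"
      "rem_point (n i) (t i) (x i) j \<in> D i" if "i < d" for i j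
      using xI[OF that] m[OF that] t(1)[OF that] D(2)[OF that] x that
      by (auto simp: rem_point_def intro: less_imp_le)
    have "\<forall>u\<in>(\<Union>m. X m) - X m. \<Phi> x u = 0" using \<Phi>_outside[of x m] m by blast
    then have lim: "(\<lambda>N. \<Sum>\<sigma>\<in>A (r N). c (r N) \<sigma> * \<Phi> x \<sigma>) \<longlonglongrightarrow> (\<integral>u. \<Phi> x u \<partial>\<mu>)"
      using conv continuous_\<Phi>[of x] by blast
    \<comment> \<open>\<open>dk\<close> and \<Psi> are the grid counterparts of
      \<open>rem_kern\<close> and \<Phi>. With \<Psi> the remainder formula is exact for large
      \<open>N\<close>; replacing \<Psi> by \<Phi> is the only source of error.\<close>
    define dk where "dk N i s = (\<Sum>j\<le>n i. rem_coeff (n i) (t i) (x i) j *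
      (discrete_kernel (n i) (G N i) s (rem_point (n i) (t i) (x i) j) / fact (n i - 1)))" for N i s
    define \<Psi> where "\<Psi> N \<sigma> = (\<Prod>i<d. dk N i (\<sigma> i))" for N \<sigma>
    have "\<exists>k. \<forall>N\<ge>k. \<forall>i<d. \<forall>j\<le>n i. rem_point (n i) (t i) (x i) j \<in> G N i"
    proof -
      have "\<exists>k. rem_point (n i) (t i) (x i) j = q i k" if "i < d" for i j
        using pt(3)[OF that] q[OF that] by (metis rangeE)
      then obtain k where k: "\<And>i j. i < d \<Longrightarrow> rem_point (n i) (t i) (x i) j = q i (k i j)" by metis
      define k0 where "k0 = (\<Sum>i<d. \<Sum>j\<le>n i. k i j)"
      have "k i j \<le> k0" if "i < d" "j \<le> n i" for i j
      proof -
        have "k i j \<le> (\<Sum>j\<le>n i. k i j)" using that by (intro member_le_sum) auto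
        also have "\<dots> \<le> k0" unfolding k0_def using that by (intro member_le_sum[of i "{..<d}" "\<lambda>i. \<Sum>j\<le>n i. k i j"]) auto
        finally show ?thesis .
      qed
      then have "rem_point (n i) (t i) (x i) j \<in> G N i" if "k0 \<le> N" "i < d" "j \<le> n i" for N i j
        unfolding G_def grid_def k[OF that(2)] using that by (intro UnI1 imageI) (force intro: order_trans)
      then show ?thesis by blast
    qed
    then obtain k0 where k0: "\<And>N i j. k0 \<le> N \<Longrightarrow> i < d \<Longrightarrow> j \<le> n i \<Longrightarrow> rem_point (n i) (t i) (x i) j \<in> G N i"
      by blast
    have rem: "remainder d n t f x = (\<Sum>\<sigma>\<in>A N. c N \<sigma> * \<Psi> N \<sigma>)" if N: "k0 \<le> N" for N
    proof -
      have "(\<Prod>i<d. \<Sum>j\<le>n i. rem_coeff (n i) (t i) (x i) j *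
         discrete_kernel (n i) (G N i) (\<sigma> i) (rem_point (n i) (t i) (x i) j)) = F * \<Psi> N \<sigma>" for \<sigma>
        unfolding F_def \<Psi>_def dk_def prod.distrib[symmetric]
        by (intro prod.cong refl) (simp add: sum_divide_distrib[symmetric])
      then show ?thesis
        using remainder_grid[of "G N" x] G k0[OF N] by (simp add: A_def c_def algebra_simps)
    qed
    define R where "R i = (\<Sum>j\<le>n i. \<bar>rem_coeff (n i) (t i) (x i) j\<bar>)" for i
    have R0: "0 \<le> R i" for i unfolding R_def by (intro sum_nonneg) auto
    \<comment> \<open>\<open>C\<close> collects the constants of
      \<open>discrete_kernel_approx\<close> for \<open>e = n i / Suc N\<close>. Sums over the
      coordinates serve as common bounds: \<open>C / Suc N\<close> for the error and
      \<open>B\<close> for both kernels.\<close>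
    define C where "C = (\<Sum>i<d. R i * (real (n i) * (b i m - a i + 1) ^ (n i - 1) * real (n i)))"
    define B where "B = C + (\<Sum>i<d. R i * (b i m - a i) ^ (n i - 1))"
    have ab: "0 \<le> b i m - a i" if "i < d" for i using b(2)[OF that, of m] by simp
    have C0: "0 \<le> C" unfolding C_def using R0 ab by (intro sum_nonneg mult_nonneg_nonneg) auto
    \<comment> \<open>From \<open>k1\<close> on, the window of the grid reaches
      \<open>b i m\<close>, as \<open>grid_mesh\<close> requires.\<close>
    obtain k1 where k1: "\<And>i. i < d \<Longrightarrow> b i m - a i \<le> real k1"
    proof -
      obtain k where k: "(\<Sum>i<d. b i m - a i) \<le> real k" using real_arch_simple by blast
      have "b i m - a i \<le> real k" if "i < d" for i
        using member_le_sum[of i "{..<d}" "\<lambda>i. b i m - a i"] ab that k by simp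
      then show ?thesis using that by blast
    qed
    have dk: "\<bar>dk N i s - rem_kern (n i) (t i) (x i) s\<bar> \<le> C / real (Suc N)"
      "\<bar>rem_kern (n i) (t i) (x i) s\<bar> \<le> B" "\<bar>dk N i s\<bar> \<le> B"
      if N: "k1 \<le> N" and i: "i < d" and s: "s \<in> atoms (n i) (G N i)" "s \<le> b i m" for N i s
    proof -
      let ?e = "real (n i) / real (Suc N)"
      let ?E = "real (n i) * (b i m - a i + 1) ^ (n i - 1) * ?e"
      have sG: "s \<in> G N i" "a i \<le> s" using s atG[OF i, of N] atoms_subset[of "n i" "G N i"] by auto
      have mesh: "s - p \<le> ?e" if p: "p \<in> preds (n i) (G N i) s" for p
      proof -
        have "s \<le> a i + real N" using s k1[OF i] N by linarith
        then show ?thesis using grid_mesh[OF intv[OF i] qJ[OF i]] sG p by (simp add: G_def)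
      qed
      have "\<bar>dk N i s - rem_kern (n i) (t i) (x i) s\<bar> = \<bar>\<Sum>j\<le>n i. rem_coeff (n i) (t i) (x i) j *
         (discrete_kernel (n i) (G N i) s (rem_point (n i) (t i) (x i) j) / fact (n i - 1) -
           kern (n i) (rem_point (n i) (t i) (x i) j) s)\<bar>"
        by (simp add: dk_def rem_kern_def sum_subtractf right_diff_distrib)
      also have "\<dots> \<le> (\<Sum>j\<le>n i. \<bar>rem_coeff (n i) (t i) (x i) j\<bar> * ?E)"
      proof (intro order_trans[OF sum_abs] sum_mono)
        fix j assume "j \<in> {..n i}"
        have "\<bar>discrete_kernel (n i) (G N i) s (rem_point (n i) (t i) (x i) j) / fact (n i - 1) -
           kern (n i) (rem_point (n i) (t i) (x i) j) s\<bar> \<le> ?E"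
          using G[OF i, of N] s pt[OF i, of j] n[OF i] mesh by (intro discrete_kernel_approx) auto
        then show "\<bar>rem_coeff (n i) (t i) (x i) j * (discrete_kernel (n i) (G N i) s (rem_point (n i) (t i) (x i) j) / fact (n i - 1) -
           kern (n i) (rem_point (n i) (t i) (x i) j) s)\<bar> \<le> \<bar>rem_coeff (n i) (t i) (x i) j\<bar> * ?E"
          unfolding abs_mult by (intro mult_left_mono) auto
      qed
      also have "\<dots> = R i * ?E" by (simp only: R_def sum_distrib_right)
      also have "\<dots> = R i * (real (n i) * (b i m - a i + 1) ^ (n i - 1) * real (n i)) / real (Suc N)"
        by simp
      also have "\<dots> \<le> C / real (Suc N)"
        unfolding C_def using i R0 ab by (intro divide_right_mono member_le_sum) auto
      finally show 1: "\<bar>dk N i s - rem_kern (n i) (t i) (x i) s\<bar> \<le> C / real (Suc N)" .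
      have "\<bar>rem_kern (n i) (t i) (x i) s\<bar> \<le> (\<Sum>j\<le>n i. \<bar>rem_coeff (n i) (t i) (x i) j\<bar> * (b i m - a i) ^ (n i - 1))"
        unfolding rem_kern_def
      proof (intro order_trans[OF sum_abs] sum_mono)
        fix j assume "j \<in> {..n i}"
        show "\<bar>rem_coeff (n i) (t i) (x i) j * kern (n i) (rem_point (n i) (t i) (x i) j) s\<bar> \<le>
          \<bar>rem_coeff (n i) (t i) (x i) j\<bar> * (b i m - a i) ^ (n i - 1)"
          unfolding abs_mult using kern_le[OF sG(2) pt(2)[OF i]] ab[OF i]
          by (intro mult_left_mono) (auto simp: abs_of_nonneg[OF kern_nonneg])
      qed
      also have "\<dots> = R i * (b i m - a i) ^ (n i - 1)" by (simp add: R_def sum_distrib_right)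
      also have "\<dots> \<le> (\<Sum>i<d. R i * (b i m - a i) ^ (n i - 1))"
        using i R0 ab by (intro member_le_sum) auto
      finally have 2: "\<bar>rem_kern (n i) (t i) (x i) s\<bar> \<le> (\<Sum>i<d. R i * (b i m - a i) ^ (n i - 1))" .
      then show "\<bar>rem_kern (n i) (t i) (x i) s\<bar> \<le> B" using C0 by (simp add: B_def)
      have "C / real (Suc N) \<le> C / 1" using C0 by (intro divide_left_mono) auto
      then show "\<bar>dk N i s\<bar> \<le> B" using 1 2 by (simp add: B_def)
    qed
    have B0: "0 \<le> B" unfolding B_def using C0 R0 ab by (intro add_nonneg_nonneg sum_nonneg mult_nonneg_nonneg) auto
    define \<epsilon> where "\<epsilon> N = real d * (B + 1) ^ d * (C / real (Suc N))" for N
    have close: "\<bar>\<Psi> N \<sigma> - \<Phi> x \<sigma>\<bar> \<le> \<epsilon> N" if N: "k1 \<le> N" and \<sigma>: "\<sigma> \<in> A N \<inter> X m" for N \<sigma>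
    proof -
      have "\<bar>(\<Prod>i<d. dk N i (\<sigma> i)) - (\<Prod>i<d. rem_kern (n i) (t i) (x i) (\<sigma> i))\<bar> \<le>
          real (card {..<d}) * (B + 1) ^ card {..<d} * (C / real (Suc N))"
      proof (rule abs_prod_diff_le)
        fix i assume i: "i \<in> {..<d}"
        then have s: "\<sigma> i \<in> atoms (n i) (G N i)" "\<sigma> i \<le> b i m" using \<sigma> by (auto simp: A_def X_def PiE_iff)
        then show "\<bar>dk N i (\<sigma> i)\<bar> \<le> B \<and> \<bar>rem_kern (n i) (t i) (x i) (\<sigma> i)\<bar> \<le> B \<and>
          \<bar>dk N i (\<sigma> i) - rem_kern (n i) (t i) (x i) (\<sigma> i)\<bar> \<le> C / real (Suc N)"
          using dk[OF N _ s] i by auto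
      qed (use B0 C0 in auto)
      then show ?thesis by (simp add: \<Psi>_def \<Phi>_def \<epsilon>_def)
    qed
    \<comment> \<open>Outside the box some \<open>\<sigma> i\<close> exceeds every evaluation point,
      so \<Psi> vanishes there exactly, as \<Phi> does. The error is therefore weighted only by the
      bounded mass of \<open>X m\<close>.\<close>
    have far: "\<Psi> N \<sigma> = 0" if \<sigma>: "\<sigma> \<in> A N" "\<sigma> \<notin> X m" for N \<sigma>
    proof -
      have "\<sigma> \<in> (\<Union>m. X m)" using \<sigma> AX by blast
      then obtain i where i: "i < d" "b i m < \<sigma> i"
        using \<sigma>(2) unfolding Un_X by (force simp: X_def PiE_iff not_le)
      then have "dk N i (\<sigma> i) = 0"
        using pt(2)[OF i(1)] unfolding dk_def
        by (intro sum.neutral) (auto simp: discrete_kernel_def intro: le_less_trans)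
      then show ?thesis unfolding \<Psi>_def using i by (intro prod_zero) auto
    qed
    have err: "\<bar>(\<Sum>\<sigma>\<in>A N. c N \<sigma> * \<Phi> x \<sigma>) - remainder d n t f x\<bar> \<le> \<epsilon> N * (F * M m)"
      if N: "k0 \<le> N" "k1 \<le> N" for N
    proof -
      have far\<Phi>: "\<Phi> x \<sigma> = 0" if "\<sigma> \<in> A N" "\<sigma> \<notin> X m" for \<sigma>
        using \<Phi>_outside[of x m \<sigma>] m that AX by blast
      have \<epsilon>0: "0 \<le> \<epsilon> N" unfolding \<epsilon>_def using B0 C0 by (intro mult_nonneg_nonneg) auto
      have "\<bar>(\<Sum>\<sigma>\<in>A N. c N \<sigma> * \<Phi> x \<sigma>) - remainder d n t f x\<bar> =
          \<bar>\<Sum>\<sigma>\<in>A N. c N \<sigma> * (\<Phi> x \<sigma> - \<Psi> N \<sigma>)\<bar>"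
        using rem[OF N(1)] by (simp add: right_diff_distrib sum_subtractf)
      also have "\<dots> = \<bar>\<Sum>\<sigma>\<in>A N \<inter> X m. c N \<sigma> * (\<Phi> x \<sigma> - \<Psi> N \<sigma>)\<bar>"
        using finA far far\<Phi> by (intro arg_cong[where f = abs] sum.mono_neutral_right) auto
      also have "\<dots> \<le> (\<Sum>\<sigma>\<in>A N \<inter> X m. c N \<sigma> * \<epsilon> N)"
      proof (intro order_trans[OF sum_abs] sum_mono)
        fix \<sigma> assume \<sigma>: "\<sigma> \<in> A N \<inter> X m"
        then show "\<bar>c N \<sigma> * (\<Phi> x \<sigma> - \<Psi> N \<sigma>)\<bar> \<le> c N \<sigma> * \<epsilon> N"
          using close[OF N(2) \<sigma>] c0[of \<sigma> N] by (simp add: abs_mult abs_minus_commute mult_left_mono)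
      qed
      also have "\<dots> = \<epsilon> N * (\<Sum>\<sigma>\<in>A N \<inter> X m. c N \<sigma>)" by (simp add: sum_distrib_left mult.commute)
      also have "\<dots> \<le> \<epsilon> N * (F * M m)" using mass \<epsilon>0 by (intro mult_left_mono)
      finally show ?thesis .
    qed
    have "(\<lambda>N. C / real (Suc N)) \<longlonglongrightarrow> 0" by (rule LIMSEQ_Suc[OF lim_const_over_n])
    then have "(\<lambda>N. \<epsilon> N * (F * M m)) \<longlonglongrightarrow> 0"
      unfolding \<epsilon>_def by (intro tendsto_mult_left_zero tendsto_mult_right_zero)
    moreover have "\<forall>\<^sub>F N in sequentially. norm ((\<Sum>\<sigma>\<in>A N. c N \<sigma> * \<Phi> x \<sigma>) - remainder d n t f x) \<le> \<epsilon> N * (F * M m)"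
      unfolding eventually_sequentially real_norm_def using err by (intro exI[of _ "max k0 k1"]) auto
    ultimately have "(\<lambda>N. (\<Sum>\<sigma>\<in>A N. c N \<sigma> * \<Phi> x \<sigma>) - remainder d n t f x) \<longlonglongrightarrow> 0"
      by (rule Lim_null_comparison[rotated])
    then have "(\<lambda>N. \<Sum>\<sigma>\<in>A N. c N \<sigma> * \<Phi> x \<sigma>) \<longlonglongrightarrow> remainder d n t f x" by (simp add: LIM_zero_iff)
    from LIMSEQ_subseq_LIMSEQ[OF this r]
    have "(\<lambda>N. \<Sum>\<sigma>\<in>A (r N). c (r N) \<sigma> * \<Phi> x \<sigma>) \<longlonglongrightarrow> remainder d n t f x"
      by (simp add: comp_def)
    from LIMSEQ_unique[OF lim this] show ?thesis by simp
  qed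
  then show ?thesis by (rule that[OF good])
qed

end

lemma continuous_on_rem_kern:
  fixes g h :: "'a::topological_space \<Rightarrow> real"
  assumes "continuous_on S g" "continuous_on S h"
  shows "continuous_on S (\<lambda>z. rem_kern n t (g z) (h z))"
proof -
  have "continuous_on S (\<lambda>z. rem_coeff n t (g z) j)" for j
    by (cases "j < n") (simp_all add: rem_coeff_def continuous_on_poly continuous_on_minus assms)
  moreover have "continuous_on S (\<lambda>z. rem_point n t (g z) j)" for j
    by (cases "j < n") (simp_all add: rem_point_def assms)
  ultimately show ?thesis unfolding rem_kern_def using assms by (intro continuous_intros)
qed

context taylor_setup
begin

text \<open>Approaching \<open>x\<close> from below keeps all evaluation points under the same
  \<open>b i m\<close>. On the union of the boxes, all these kernels then vanish outside one
  \<open>X m\<close>, where a constant dominates them.\<close>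

lemma integral_\<Phi>_tendsto:
  assumes \<mu>: "good_measure \<mu>" and x: "x \<in> PiE {..<d} J" and y: "\<And>k. y k \<in> PiE {..<d} J"
    and le: "\<And>k i. i < d \<Longrightarrow> y k i \<le> x i" and lim: "\<And>i. i < d \<Longrightarrow> (\<lambda>k. y k i) \<longlonglongrightarrow> x i"
  shows "(\<lambda>k. \<integral>u. \<Phi> (y k) u \<partial>\<mu>) \<longlonglongrightarrow> (\<integral>u. \<Phi> x u \<partial>\<mu>)"
proof -
  have sets[measurable_cong]: "sets \<mu> = sets borel" and null: "emeasure \<mu> (- (\<Union>m. X m)) = 0"
    and fin: "emeasure \<mu> (X m) < \<infinity>" for m
    using \<mu> by (auto simp: good_measure_def)
  have [measurable]: "\<Phi> z \<in> borel_measurable borel" for z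
    using continuous_\<Phi> by (rule borel_measurable_continuous_onI)
  have "x i \<in> I i" if "i < d" for i using x that by (auto simp: J_def PiE_iff)
  then obtain m where m: "\<And>i. i < d \<Longrightarrow> x i \<le> b i m \<and> (\<forall>j<n i. t i j \<le> b i m)" using level_t[of x] by blast
  have "\<exists>B. \<forall>z\<in>{a i..b i m}. \<forall>v\<in>{a i..b i m}. \<bar>rem_kern (n i) (t i) z v\<bar> \<le> B" for i
  proof -
    have "continuous_on ({a i..b i m} \<times> {a i..b i m}) (\<lambda>p. rem_kern (n i) (t i) (fst p) (snd p))"
      by (intro continuous_on_rem_kern continuous_intros)
    then have "bounded ((\<lambda>p. rem_kern (n i) (t i) (fst p) (snd p)) ` ({a i..b i m} \<times> {a i..b i m}))"
      by (intro compact_imp_bounded compact_continuous_image compact_Times compact_Icc)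
    then show ?thesis unfolding bounded_iff by fastforce
  qed
  then obtain B where B: "\<And>i z v. z \<in> {a i..b i m} \<Longrightarrow> v \<in> {a i..b i m} \<Longrightarrow> \<bar>rem_kern (n i) (t i) z v\<bar> \<le> B i"
    by metis
  have AE_X: "AE u in \<mu>. u \<in> (\<Union>m. X m)"
  proof (rule AE_I[OF _ null])
    have "(\<Union>m. X m) \<in> sets borel" using X_borel by (intro sets.countable_UN) auto
    then show "- (\<Union>m. X m) \<in> sets \<mu>" unfolding sets by (rule borel_comp)
  qed auto
  show ?thesis
  proof (rule integral_dominated_convergence[where w = "\<lambda>u. (\<Prod>i<d. B i) * indicator (X m) u"])
    show "integrable \<mu> (\<lambda>u. (\<Prod>i<d. B i) * indicator (X m) u)"
      using fin[of m] X_borel sets by (intro integrable_mult_right integrable_real_indicator) auto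
    show "AE u in \<mu>. (\<lambda>k. \<Phi> (y k) u) \<longlonglongrightarrow> \<Phi> x u"
    proof (intro AE_I2)
      fix u
      have "(\<lambda>k. rem_kern (n i) (t i) (y k i) (u i)) \<longlonglongrightarrow> rem_kern (n i) (t i) (x i) (u i)" if "i < d" for i
      proof -
        have "continuous_on UNIV (\<lambda>z. rem_kern (n i) (t i) z (u i))"
          by (intro continuous_on_rem_kern continuous_intros)
        then have "isCont (\<lambda>z. rem_kern (n i) (t i) z (u i)) (x i)" by (simp add: continuous_on_eq_continuous_at)
        then show ?thesis using lim[OF that] by (rule isCont_tendsto_compose)
      qed
      then show "(\<lambda>k. \<Phi> (y k) u) \<longlonglongrightarrow> \<Phi> x u" unfolding \<Phi>_def by (intro tendsto_prod) auto
    qed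
    show "AE u in \<mu>. norm (\<Phi> (y k) u) \<le> (\<Prod>i<d. B i) * indicator (X m) u" for k
      using AE_X
    proof eventually_elim
      fix u assume u: "u \<in> (\<Union>m. X m)"
      show "norm (\<Phi> (y k) u) \<le> (\<Prod>i<d. B i) * indicator (X m) u"
      proof (cases "u \<in> X m")
        case True
        have "\<bar>rem_kern (n i) (t i) (y k i) (u i)\<bar> \<le> B i" if "i < d" for i
        proof (rule B)
          show "u i \<in> {a i..b i m}" using True that by (auto simp: X_def PiE_iff)
          have "a i < y k i" using y[of k] that by (auto simp: J_def PiE_iff)
          then show "y k i \<in> {a i..b i m}" using le[OF that, of k] m[OF that] by auto
        qed
        then have "(\<Prod>i<d. \<bar>rem_kern (n i) (t i) (y k i) (u i)\<bar>) \<le> (\<Prod>i<d. B i)"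
          by (intro prod_mono) auto
        then show ?thesis using True unfolding \<Phi>_def by (simp add: abs_prod)
      next
        case False
        have "\<Phi> (y k) u = 0"
          using m le order_trans by (intro \<Phi>_outside[OF _ u False]) blast
        then show ?thesis using False by simp
      qed
    qed
  qed measurable
qed

lemma exists_measure:
  obtains \<mu> where "good_measure \<mu>"
    "\<And>x. x \<in> PiE {..<d} J \<Longrightarrow> remainder d n t f x = (\<integral>u. \<Phi> x u \<partial>\<mu>)"
proof -
  define D where "D i = J i \<inter> \<rat> \<union> t i ` {..<n i}" for i
  have tJ: "t i j \<in> J i" if "i < d" "j < n i" for i j using t(1)[OF that] by (simp add: J_def)
  have D: "countable (D i) \<and> D i \<subseteq> J i" if "i < d" for i
    using tJ[OF that] countable_subset[OF Int_lower2 countable_rat, of "J i"] by (auto simp: D_def)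
  have tD: "t i j \<in> D i" if "i < d" "j < n i" for i j using that by (simp add: D_def)
  obtain \<mu> where \<mu>: "good_measure \<mu>" and
    rep: "\<And>x. x \<in> PiE {..<d} D \<Longrightarrow> remainder d n t f x = (\<integral>u. \<Phi> x u \<partial>\<mu>)"
    using exists_measure_countable[OF D tD] by metis
  have "remainder d n t f x = (\<integral>u. \<Phi> x u \<partial>\<mu>)" if x: "x \<in> PiE {..<d} J" for x
  proof -
    have xJ: "x i \<in> J i" if "i < d" for i using x that by auto
    have D': "countable (insert (x i) (D i)) \<and> insert (x i) (D i) \<subseteq> J i" if "i < d" for i
      using D[OF that] xJ[OF that] by auto
    have tD': "t i j \<in> insert (x i) (D i)" if "i < d" "j < n i" for i j using tD[OF that] by simp
    obtain \<nu> where \<nu>: "good_measure \<nu>" and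
      rep': "\<And>z. z \<in> PiE {..<d} (\<lambda>i. insert (x i) (D i)) \<Longrightarrow>
        remainder d n t f z = (\<integral>u. \<Phi> z u \<partial>\<nu>)"
      using exists_measure_countable[OF D' tD'] by metis
    \<comment> \<open>Rational coordinates keep the approximating points in both countable products,
      so each of the two measures represents the remainder at them.\<close>
    have "\<exists>z. i < d \<longrightarrow> z \<in> J i \<inter> \<rat> \<and> x i - 1 / real (Suc k) < z \<and> z < x i" for i k
    proof (cases "i < d")
      case True
      have "max (a i) (x i - 1 / real (Suc k)) < x i" using xJ[OF True] by (simp add: J_def)
      then obtain z where z: "z \<in> \<rat>" "max (a i) (x i - 1 / real (Suc k)) < z" "z < x i"
        using Rats_dense_in_real by blast
      moreover have "z \<in> I i"
        using mem_is_interval_1_I[OF intv[OF True] a[OF True], of "x i" z] xJ[OF True] z by (simp add: J_def)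
      ultimately show ?thesis by (auto simp: J_def)
    qed auto
    then have "\<exists>z. \<forall>k i. i < d \<longrightarrow> z k i \<in> J i \<inter> \<rat> \<and> x i - 1 / real (Suc k) < z k i \<and> z k i < x i"
      by (intro choice allI)
    then obtain z where z: "\<And>k i. i < d \<Longrightarrow> z k i \<in> J i \<inter> \<rat>" "\<And>k i. i < d \<Longrightarrow> x i - 1 / real (Suc k) < z k i"
      "\<And>k i. i < d \<Longrightarrow> z k i < x i" by blast
    define y where "y k = restrict (z k) {..<d}" for k
    have yD: "y k \<in> PiE {..<d} D" "y k \<in> PiE {..<d} (\<lambda>i. insert (x i) (D i))" "y k \<in> PiE {..<d} J" for k
      using z(1) by (auto simp: y_def D_def)
    have le: "y k i \<le> x i" if "i < d" for k i using z(3)[OF that, of k] that by (simp add: y_def)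
    have lim: "(\<lambda>k. y k i) \<longlonglongrightarrow> x i" if "i < d" for i
    proof (rule real_tendsto_sandwich[OF always_eventually always_eventually _ tendsto_const])
      show "\<forall>k. x i - 1 / real (Suc k) \<le> y k i" using z(2)[OF that] that by (auto simp: y_def intro: less_imp_le)
      show "\<forall>k. y k i \<le> x i" using le[OF that] by blast
      have "(\<lambda>k. x i - 1 / real (Suc k)) \<longlonglongrightarrow> x i - 0"
        by (intro tendsto_intros LIMSEQ_Suc[OF lim_const_over_n])
      then show "(\<lambda>k. x i - 1 / real (Suc k)) \<longlonglongrightarrow> x i" by simp
    qed
    have "(\<lambda>k. \<integral>u. \<Phi> (y k) u \<partial>\<mu>) \<longlonglongrightarrow> (\<integral>u. \<Phi> x u \<partial>\<mu>)"
      using \<mu> x yD(3) le lim by (rule integral_\<Phi>_tendsto)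
    moreover have "(\<lambda>k. \<integral>u. \<Phi> (y k) u \<partial>\<nu>) \<longlonglongrightarrow> (\<integral>u. \<Phi> x u \<partial>\<nu>)"
      using \<nu> x yD(3) le lim by (rule integral_\<Phi>_tendsto)
    moreover have "(\<integral>u. \<Phi> (y k) u \<partial>\<mu>) = (\<integral>u. \<Phi> (y k) u \<partial>\<nu>)" for k
      using rep[OF yD(1)] rep'[OF yD(2)] by metis
    ultimately have eq: "(\<integral>u. \<Phi> x u \<partial>\<mu>) = (\<integral>u. \<Phi> x u \<partial>\<nu>)" using LIMSEQ_unique by simp
    have "x \<in> PiE {..<d} (\<lambda>i. insert (x i) (D i))" using x by (auto simp: PiE_iff)
    then show ?thesis using rep' eq by simp
  qed
  then show ?thesis by (rule that[OF \<mu>])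
qed

lemma representation:
  "\<exists>W \<nu>. pseudo_polynomial d (\<lambda>i. n i - 1) J W \<and>
     borel_measure_on (PiE {..<d} I) \<nu> \<and> finite_on_compacts (PiE {..<d} I) \<nu> \<and>
     (\<forall>x \<in> PiE {..<d} J. set_integrable \<nu> (PiE {..<d} J) (spline_kernel d n x) \<and>
        f x = W x + (LINT u:PiE {..<d} J|\<nu>. spline_kernel d n x u))"
proof -
  obtain \<mu> where \<mu>: "good_measure \<mu>" and
    rep: "\<And>x. x \<in> PiE {..<d} J \<Longrightarrow> remainder d n t f x = (\<integral>u. \<Phi> x u \<partial>\<mu>)"
    by (rule exists_measure) blast
  have sets[measurable_cong]: "sets \<mu> = sets borel" and null: "emeasure \<mu> (- (\<Union>m. X m)) = 0"
    and fin: "emeasure \<mu> (X m) < \<infinity>" for m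
    using \<mu> by (auto simp: good_measure_def)
  have space: "space \<mu> = UNIV" using sets_eq_imp_space_eq[OF sets] by simp
  have UnX: "(\<Union>m. X m) \<in> sets borel" using X_borel by (intro sets.countable_UN) auto
  have AE_X: "AE u in \<mu>. u \<in> (\<Union>m. X m)"
    by (rule AE_I[OF _ null]) (use borel_comp[OF UnX] sets in auto)
  have PiE_borel: "PiE {..<d} S \<in> sets borel" if "\<And>i. i < d \<Longrightarrow> open (S i)" for S :: "nat \<Rightarrow> real set"
  proof -
    have "PiE {..<d} S = (\<Inter>i. (\<lambda>u. u i) -` (if i < d then S i else {undefined}))"
      unfolding PiE_iff set_eq_iff by (simp add: extensional_def split: if_split) blast
    moreover have "(\<lambda>u :: nat \<Rightarrow> real. u i) -` (if i < d then S i else {undefined}) \<in> sets borel" for i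
    proof -
      have "(\<lambda>u :: nat \<Rightarrow> real. u i) \<in> borel_measurable borel"
        by (intro borel_measurable_continuous_onI continuous_on_product_coordinates)
      moreover have "(if i < d then S i else {undefined}) \<in> sets borel" using that by auto
      ultimately show ?thesis by (rule measurable_sets_borel)
    qed
    ultimately show ?thesis by (simp add: sets.countable_INT)
  qed
  let ?I = "PiE {..<d} I" and ?J = "PiE {..<d} J"
  have I[measurable]: "?I \<in> sets borel" by (intro PiE_borel opn)
  have J[measurable]: "?J \<in> sets borel" by (intro PiE_borel) (auto simp: J_def intro: opn)
  have JI: "?J \<subseteq> ?I" by (intro PiE_mono) (auto simp: J_def)
  have ker[measurable]: "spline_kernel d n x \<in> borel_measurable borel" for x
    unfolding spline_kernel_eq[abs_def]
    by (intro borel_measurable_continuous_onI continuous_intros continuous_on_product_coordinates)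
  define g where "g x u = indicator ?J u * spline_kernel d n x u" for x u
  have int: "integrable \<mu> (g x)" if x: "\<And>i. i < d \<Longrightarrow> x i \<in> J i" for x
  proof -
    obtain m where m: "\<And>i. i < d \<Longrightarrow> x i \<le> b i m" using level[of x] x by (auto simp: J_def)
    let ?C = "\<Prod>i<d. (b i m - a i) ^ (n i - 1)"
    show ?thesis
    proof (rule Bochner_Integration.integrable_bound)
      show "integrable \<mu> (\<lambda>u. ?C * indicator (X m) u)"
        using fin[of m] X_borel sets by (intro integrable_mult_right integrable_real_indicator) auto
      show "g x \<in> borel_measurable \<mu>" unfolding g_def by measurable
      show "AE u in \<mu>. norm (g x u) \<le> norm (?C * indicator (X m) u)"
      proof (rule AE_I2)
        fix u
        have nn: "0 \<le> (\<Prod>j<d. kern (n j) (x j) (u j))" by (intro prod_nonneg) (simp add: kern_nonneg)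
        show "norm (g x u) \<le> norm (?C * indicator (X m) u)"
        proof (cases "u \<in> ?J")
          case uJ: True
          show ?thesis
          proof (cases "u \<in> X m")
            case True
            have "(\<Prod>j<d. kern (n j) (x j) (u j)) \<le> ?C"
            proof (intro prod_mono conjI kern_nonneg kern_le)
              fix j assume j: "j \<in> {..<d}"
              show "a j \<le> u j" using True j by (auto simp: X_def PiE_iff)
            qed (use m b(2)[of _ m] in \<open>auto intro: less_imp_le\<close>)
            then show ?thesis using True nn uJ by (simp add: g_def spline_kernel_eq)
          next
            case False
            have "u \<in> (\<Union>m. X m)" using uJ unfolding Un_X by (force simp: J_def PiE_iff)
            then obtain i where i: "i < d" "b i m < u i"
              using False unfolding Un_X by (force simp: X_def PiE_iff not_le)
            have "kern (n i) (x i) (u i) = 0" using i m[OF i(1)] n[OF i(1)] by (intro kern_zero) auto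
            then have "(\<Prod>j<d. kern (n j) (x j) (u j)) = 0" using i by (intro prod_zero) auto
            then have "g x u = 0" by (simp only: g_def spline_kernel_eq mult_zero_right)
            then show ?thesis by simp
          qed
        qed (simp add: g_def)
      qed
    qed
  qed
  define F where "F x = (\<integral>u. g x u \<partial>\<mu>)" for x
  \<comment> \<open>The remainder is a finite combination and passes under the integral. The
    indicator of \<open>?J\<close> can then be dropped, because \<open>\<Phi> x\<close> vanishes on
    the lower faces.\<close>
  have remF: "remainder d n t F x = (\<integral>u. \<Phi> x u \<partial>\<mu>)" if x: "x \<in> ?J" for x
  proof -
    let ?T = "PiE {..<d} (\<lambda>i. {..n i})"
    let ?c = "\<lambda>\<tau>. \<Prod>i<d. rem_coeff (n i) (t i) (x i) (\<tau> i)"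
    let ?p = "\<lambda>\<tau>. \<lambda>i\<in>{..<d}. rem_point (n i) (t i) (x i) (\<tau> i)"
    have pJ: "?p \<tau> i \<in> J i" if "i < d" for \<tau> i
      using x t(1)[OF that] that by (auto simp: rem_point_def J_def PiE_iff)
    have ip: "integrable \<mu> (g (?p \<tau>))" for \<tau> using pJ by (rule int)
    have "remainder d n t F x = (\<integral>u. (\<Sum>\<tau>\<in>?T. ?c \<tau> * g (?p \<tau>) u) \<partial>\<mu>)"
      unfolding remainder_def F_def
      by (subst Bochner_Integration.integral_sum) (simp_all only: integral_mult_right_zero integrable_mult_right ip)
    also have "\<dots> = (\<integral>u. \<Phi> x u \<partial>\<mu>)"
    proof (rule integral_cong_AE)
      show "(\<lambda>u. \<Sum>\<tau>\<in>?T. ?c \<tau> * g (?p \<tau>) u) \<in> borel_measurable \<mu>" unfolding g_def by measurable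
      have "\<Phi> x \<in> borel_measurable borel" using continuous_\<Phi> by (rule borel_measurable_continuous_onI)
      then show "\<Phi> x \<in> borel_measurable \<mu>" by measurable
      show "AE u in \<mu>. (\<Sum>\<tau>\<in>?T. ?c \<tau> * g (?p \<tau>) u) = \<Phi> x u"
        using AE_X
      proof eventually_elim
        fix u assume u: "u \<in> (\<Union>m. X m)"
        have "(\<Sum>\<tau>\<in>?T. ?c \<tau> * g (?p \<tau>) u) =
            indicator ?J u * remainder d n t (\<lambda>y. \<Prod>i<d. kern (n i) (y i) (u i)) x"
          unfolding remainder_def g_def spline_kernel_eq sum_distrib_left
          by (intro sum.cong refl) (simp add: algebra_simps)
        also have "\<dots> = indicator ?J u * \<Phi> x u"
          using remainder_prod[where \<phi> = "\<lambda>i z. kern (n i) z (u i)"] by (simp add: \<Phi>_def rem_kern_def)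
        also have "\<dots> = \<Phi> x u" using \<Phi>_boundary[OF x u] by (cases "u \<in> ?J") auto
        finally show "(\<Sum>\<tau>\<in>?T. ?c \<tau> * g (?p \<tau>) u) = \<Phi> x u" .
      qed
    qed
    finally show ?thesis .
  qed
  define \<nu> where "\<nu> = restrict_space \<mu> ?I"
  have Is: "?I \<inter> space \<mu> \<in> sets \<mu>" using I sets by (simp add: space)
  have ind: "indicator ?I u *\<^sub>R (indicator ?J u *\<^sub>R spline_kernel d n x u) = g x u" for x u
    using JI by (auto simp: g_def split: split_indicator)
  have "set_integrable \<nu> ?J (spline_kernel d n x) \<and> f x = (f x - F x) + (LINT u:?J|\<nu>. spline_kernel d n x u)"
    if "x \<in> ?J" for x
  proof -
    have "integrable \<mu> (g x)" using that by (intro int) auto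
    then show ?thesis
      unfolding set_integrable_def set_lebesgue_integral_def \<nu>_def integrable_restrict_space[OF Is]
        integral_restrict_space[OF Is] ind
      by (simp add: F_def)
  qed
  moreover have "pseudo_polynomial d (\<lambda>i. n i - 1) J (\<lambda>x. f x - F x)"
  proof (rule pseudo_polynomial_if_remainder_zero)
    fix x assume x: "x \<in> ?J"
    have "remainder d n t (\<lambda>x. f x - F x) x = remainder d n t f x - remainder d n t F x"
      by (simp add: remainder_def right_diff_distrib sum_subtractf)
    then show "remainder d n t (\<lambda>x. f x - F x) x = 0" using rep[OF x] remF[OF x] by simp
  qed
  moreover have "borel_measure_on ?I \<nu>"
    unfolding borel_measure_on_def \<nu>_def by (rule sets_restrict_space_cong[OF sets])
  moreover have "finite_on_compacts ?I \<nu>"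
    unfolding finite_on_compacts_def
  proof (intro allI impI)
    fix K assume K: "compact K \<and> K \<subseteq> ?I"
    \<comment> \<open>\<open>K\<close> may extend below the corner \<open>a\<close>, where \<mu> has
      no mass. Above it, the maxima of the coordinates on \<open>K\<close> lie in the open intervals
      and hence below some \<open>b i m\<close>.\<close>
    have "\<exists>m. K \<inter> (\<Union>m. X m) \<subseteq> X m"
    proof (cases "K = {}")
      case False
      have "\<exists>y\<in>K. \<forall>u\<in>K. u i \<le> y i" for i
        using K False by (intro continuous_attains_sup continuous_on_subset[OF continuous_on_product_coordinates]) auto
      then obtain y where y: "\<And>i. y i \<in> K" "\<And>i u. u \<in> K \<Longrightarrow> u i \<le> y i i" by metis
      have "y i i \<in> I i" if "i < d" for i using y(1)[of i] K that by (auto simp: PiE_iff)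
      then obtain m where m: "\<And>i. i < d \<Longrightarrow> y i i \<le> b i m" using level[of "\<lambda>i. y i i"] by blast
      have "u \<in> X m" if u: "u \<in> K" "u \<in> (\<Union>m. X m)" for u
      proof -
        have "u i \<le> b i m" if "i < d" for i using y(2)[OF u(1), of i] m[OF that] by (rule order_trans)
        then show ?thesis using u(2) unfolding Un_X by (auto simp: X_def PiE_iff)
      qed
      then show ?thesis by blast
    qed auto
    then obtain m where m: "K \<subseteq> X m \<union> - (\<Union>m. X m)" by blast
    have Kb: "K \<in> sets borel" using K by (intro borel_closed compact_imp_closed) simp
    have "emeasure \<nu> K = emeasure \<mu> K"
      unfolding \<nu>_def using K Is by (intro emeasure_restrict_space) auto
    also have "\<dots> \<le> emeasure \<mu> (X m \<union> - (\<Union>m. X m))"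
      using m X_borel borel_comp[OF UnX] sets by (intro emeasure_mono) auto
    also have "\<dots> \<le> emeasure \<mu> (X m) + emeasure \<mu> (- (\<Union>m. X m))"
      using X_borel borel_comp[OF UnX] sets by (intro emeasure_subadditive) auto
    also have "\<dots> < \<infinity>" using fin[of m] null by simp
    finally show "emeasure \<nu> K < \<infinity>" .
  qed
  ultimately show ?thesis by blast
qed

end

text \<open>Integrability is stated explicitly because the Bochner integral of a nonintegrable
  function is 0 by convention. The sufficiency proof uses it to move a finite sum under the
  integral.\<close>

theorem theorem38:
  fixes d :: nat and n :: "nat \<Rightarrow> nat" and I :: "nat \<Rightarrow> real set"
    and f :: "(nat \<Rightarrow> real) \<Rightarrow> real"
  assumes "1 \<le> d"
    and "\<And>i. i < d \<Longrightarrow> open (I i) \<and> is_interval (I i)"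
    and "\<And>i. i < d \<Longrightarrow> 2 \<le> n i"
  shows "box_convex d n I f \<longleftrightarrow>
    (\<forall>\<alpha> \<in> PiE {..<d} I.
       let J = (\<lambda>i. I i \<inter> {\<alpha> i<..}) in
       \<exists>W \<mu>. pseudo_polynomial d (\<lambda>i. n i - 1) J W \<and>
         borel_measure_on (PiE {..<d} I) \<mu> \<and> finite_on_compacts (PiE {..<d} I) \<mu> \<and>
         (\<forall>x \<in> PiE {..<d} J.
            set_integrable \<mu> (PiE {..<d} J) (spline_kernel d n x) \<and>
            f x = W x + (LINT u:PiE {..<d} J|\<mu>. spline_kernel d n x u)))"
proof
  assume convex: "box_convex d n I f"
  show "\<forall>\<alpha> \<in> PiE {..<d} I. let J = (\<lambda>i. I i \<inter> {\<alpha> i<..}) in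
       \<exists>W \<mu>. pseudo_polynomial d (\<lambda>i. n i - 1) J W \<and>
         borel_measure_on (PiE {..<d} I) \<mu> \<and> finite_on_compacts (PiE {..<d} I) \<mu> \<and>
         (\<forall>x \<in> PiE {..<d} J.
            set_integrable \<mu> (PiE {..<d} J) (spline_kernel d n x) \<and>
            f x = W x + (LINT u:PiE {..<d} J|\<mu>. spline_kernel d n x u))"
  proof
    fix \<alpha> assume \<alpha>: "\<alpha> \<in> PiE {..<d} I"
    have "\<exists>b :: nat \<Rightarrow> real. i < d \<longrightarrow> (\<forall>m. b m \<in> I i) \<and> (\<forall>m. \<alpha> i < b m) \<and> strict_mono b \<and> (\<forall>x\<in>I i. \<exists>m. x \<le> b m)" for i
    proof (cases "i < d")
      case True
      then have "\<alpha> i \<in> I i" using \<alpha> by auto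
      from open_exhaustion[of "I i" "\<alpha> i"] this assms(2)[OF True] show ?thesis by metis
    qed auto
    then have "\<exists>b :: nat \<Rightarrow> nat \<Rightarrow> real. \<forall>i. i < d \<longrightarrow> (\<forall>m. b i m \<in> I i) \<and> (\<forall>m. \<alpha> i < b i m) \<and>
      strict_mono (b i) \<and> (\<forall>x\<in>I i. \<exists>m. x \<le> b i m)" by (intro choice allI)
    then obtain b :: "nat \<Rightarrow> nat \<Rightarrow> real" where "\<forall>i. i < d \<longrightarrow> (\<forall>m. b i m \<in> I i) \<and> (\<forall>m. \<alpha> i < b i m) \<and>
      strict_mono (b i) \<and> (\<forall>x\<in>I i. \<exists>m. x \<le> b i m)" ..
    note b = this[THEN spec, THEN mp]
    have "\<exists>t :: nat \<Rightarrow> real. i < d \<longrightarrow> inj_on t {..<n i} \<and> t ` {..<n i} \<subseteq> I i \<inter> {\<alpha> i<..}" for i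
    proof (cases "i < d")
      case True
      then have "\<alpha> i \<in> I i" using \<alpha> by auto
      then have "infinite (I i \<inter> {\<alpha> i<..})" using assms(2)[OF True] open_interval_above by blast
      then obtain T where T: "finite T" "card T = n i" "T \<subseteq> I i \<inter> {\<alpha> i<..}"
        using infinite_arbitrarily_large by blast
      obtain t where "bij_betw t {0..<n i} T" using ex_bij_betw_nat_finite[OF T(1)] T(2) by auto
      then show ?thesis using T(3) by (intro exI[of _ t]) (auto simp: bij_betw_def atLeast0LessThan)
    qed auto
    then obtain t where t: "\<And>i. i < d \<Longrightarrow> inj_on (t i) {..<n i} \<and> t i ` {..<n i} \<subseteq> I i \<inter> {\<alpha> i<..}" by metis
    interpret taylor_setup d n I f \<alpha> b t
    proof
      show "1 \<le> d" by fact
      show "box_convex d n I f" by fact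
      fix i assume i: "i < d"
      show "2 \<le> n i" using assms(3)[OF i] .
      show "open (I i)" "is_interval (I i)" using assms(2)[OF i] by auto
      show "\<alpha> i \<in> I i" using \<alpha> i by auto
      show "strict_mono (b i)" "inj_on (t i) {..<n i}" using b[OF i] t[OF i] by auto
      show "b i m \<in> I i" "\<alpha> i < b i m" for m using b[OF i] by auto
      show "\<exists>m. x \<le> b i m" if "x \<in> I i" for x using b[OF i] that by blast
      show "t i j \<in> I i \<inter> {\<alpha> i<..}" if "j < n i" for j using t[OF i] that by blast
    qed
    have "J = (\<lambda>i. I i \<inter> {\<alpha> i<..})" by (simp add: J_def fun_eq_iff)
    then show "let J = (\<lambda>i. I i \<inter> {\<alpha> i<..}) in
       \<exists>W \<mu>. pseudo_polynomial d (\<lambda>i. n i - 1) J W \<and>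
         borel_measure_on (PiE {..<d} I) \<mu> \<and> finite_on_compacts (PiE {..<d} I) \<mu> \<and>
         (\<forall>x \<in> PiE {..<d} J.
            set_integrable \<mu> (PiE {..<d} J) (spline_kernel d n x) \<and>
            f x = W x + (LINT u:PiE {..<d} J|\<mu>. spline_kernel d n x u))"
      using representation by (simp add: Let_def)
  qed
next
  assume rep: "\<forall>\<alpha> \<in> PiE {..<d} I. let J = (\<lambda>i. I i \<inter> {\<alpha> i<..}) in
       \<exists>W \<mu>. pseudo_polynomial d (\<lambda>i. n i - 1) J W \<and>
         borel_measure_on (PiE {..<d} I) \<mu> \<and> finite_on_compacts (PiE {..<d} I) \<mu> \<and>
         (\<forall>x \<in> PiE {..<d} J.
            set_integrable \<mu> (PiE {..<d} J) (spline_kernel d n x) \<and>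
            f x = W x + (LINT u:PiE {..<d} J|\<mu>. spline_kernel d n x u))"
  show "box_convex d n I f"
    unfolding box_convex_def
  proof (intro allI impI)
    fix X :: "nat \<Rightarrow> nat \<Rightarrow> real" assume X: "\<forall>i<d. X i ` {..n i} \<subseteq> I i \<and> inj_on (X i) {..n i}"
    define S where "S i = X i ` {..n i}" for i
    have S: "finite (S i)" "S i \<subseteq> I i" "card (S i) = Suc (n i)" "S i \<noteq> {}" if "i < d" for i
      using X that by (auto simp: S_def card_image)
    \<comment> \<open>The corner is chosen below all nodes, so that a single representation covers
      every value of \<open>f\<close> in the divided difference.\<close>
    have "\<exists>\<alpha>. i < d \<longrightarrow> \<alpha> \<in> I i \<and> (\<forall>s\<in>S i. \<alpha> < s)" for i
    proof (cases "i < d")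
      case True
      have "Min (S i) \<in> I i" using S[OF True] Min_in by blast
      then have "I i \<inter> {..<Min (S i)} \<noteq> {}"
        using open_interval_below[of "I i" "Min (S i)"] assms(2)[OF True] by (metis finite.emptyI)
      then obtain \<alpha> where "\<alpha> \<in> I i" "\<alpha> < Min (S i)" by blast
      then show ?thesis using S[OF True] by auto
    qed auto
    then obtain \<beta> where \<beta>: "\<And>i. i < d \<Longrightarrow> \<beta> i \<in> I i \<and> (\<forall>s\<in>S i. \<beta> i < s)" by metis
    define \<alpha> where "\<alpha> = restrict \<beta> {..<d}"
    define J where "J i = I i \<inter> {\<alpha> i<..}" for i
    have J: "(\<lambda>i. I i \<inter> {\<alpha> i<..}) = J" by (simp add: J_def fun_eq_iff)
    have \<alpha>: "\<alpha> \<in> PiE {..<d} I" using \<beta> by (auto simp: \<alpha>_def)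
    have SJ: "S i \<subseteq> J i" if "i < d" for i using S(2)[OF that] \<beta>[OF that] that by (auto simp: J_def \<alpha>_def)
    have "\<exists>W \<mu>. pseudo_polynomial d (\<lambda>i. n i - 1) J W \<and>
         (\<forall>x \<in> PiE {..<d} J. set_integrable \<mu> (PiE {..<d} J) (spline_kernel d n x) \<and>
            f x = W x + (LINT u:PiE {..<d} J|\<mu>. spline_kernel d n x u))"
      using rep[rule_format, OF \<alpha>] unfolding J Let_def by blast
    then obtain W \<mu> where W: "pseudo_polynomial d (\<lambda>i. n i - 1) J W" and
      \<mu>: "\<And>x. x \<in> PiE {..<d} J \<Longrightarrow> set_integrable \<mu> (PiE {..<d} J) (spline_kernel d n x) \<and>
            f x = W x + (LINT u:PiE {..<d} J|\<mu>. spline_kernel d n x u)" by blast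
    let ?J = "PiE {..<d} J"
    let ?w = "\<lambda>y. \<Prod>i<d. dd_weight (S i) (y i)"
    have sub: "PiE {..<d} S \<subseteq> ?J" using SJ by (intro PiE_mono) auto
    have T: "tensor d (\<lambda>i. dd_weight (S i)) g = (\<Sum>y\<in>PiE {..<d} S. ?w y * g y)" for g
      using S(1) by (intro tensor_eq) (auto simp: dd_weight_outside)
    have "tensor d (\<lambda>i. dd_weight (S i)) W = 0"
    proof (rule tensor_pseudo_polynomial[OF W])
      fix i k assume i: "i < d" and "k \<le> n i - 1"
      then have "k + 1 < card (S i)" using S(3)[OF i] assms(3)[OF i] by simp
      then show "(\<Sum>x\<in>S i. dd_weight (S i) x * x ^ k) = 0" using S(1)[OF i] by (intro dd_sum_power)
    qed (use S SJ in \<open>auto simp: dd_weight_outside\<close>)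
    moreover have "0 \<le> tensor d (\<lambda>i. dd_weight (S i)) (\<lambda>x. LINT u:?J|\<mu>. spline_kernel d n x u)"
    proof -
      have int: "integrable \<mu> (\<lambda>u. indicator ?J u * spline_kernel d n y u)" if "y \<in> PiE {..<d} S" for y
        using \<mu>[of y] sub that by (auto simp: set_integrable_def)
      have "tensor d (\<lambda>i. dd_weight (S i)) (\<lambda>x. LINT u:?J|\<mu>. spline_kernel d n x u) =
          (\<integral>u. (\<Sum>y\<in>PiE {..<d} S. ?w y * (indicator ?J u * spline_kernel d n y u)) \<partial>\<mu>)"
        unfolding T set_lebesgue_integral_def using int
        by (subst Bochner_Integration.integral_sum) auto
      also have "\<dots> \<ge> 0"
      proof (rule Bochner_Integration.integral_nonneg)
        fix u
        have "(\<Sum>y\<in>PiE {..<d} S. ?w y * (indicator ?J u * spline_kernel d n y u)) =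
            indicator ?J u * tensor d (\<lambda>i. dd_weight (S i)) (\<lambda>y. \<Prod>i<d. kern (n i) (y i) (u i))"
          unfolding T spline_kernel_eq sum_distrib_left by (intro sum.cong refl) (simp add: algebra_simps)
        also have "tensor d (\<lambda>i. dd_weight (S i)) (\<lambda>y. \<Prod>i<d. kern (n i) (y i) (u i)) =
            (\<Prod>i<d. \<Sum>x\<in>S i. dd_weight (S i) x * kern (n i) x (u i))"
          using S(1) by (intro tensor_prod) (auto simp: dd_weight_outside)
        also have "indicator ?J u * \<dots> \<ge> 0"
        proof (intro mult_nonneg_nonneg prod_nonneg ballI)
          fix i assume i: "i \<in> {..<d}"
          have "0 \<le> (\<Sum>x\<in>S i. dd_weight (S i) x * max 0 (x - u i) ^ (n i - 1))"
            using S[of i] assms(3)[of i] i by (intro dd_sum_truncated_power_nonneg) auto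
          then have "0 \<le> (\<Sum>x\<in>S i. dd_weight (S i) x * max 0 (x - u i) ^ (n i - 1)) / fact (n i - 1)" by simp
          then show "0 \<le> (\<Sum>x\<in>S i. dd_weight (S i) x * kern (n i) x (u i))"
            by (simp add: kern_def sum_divide_distrib)
        qed simp
        finally show "0 \<le> (\<Sum>y\<in>PiE {..<d} S. ?w y * (indicator ?J u * spline_kernel d n y u))" .
      qed
      finally show ?thesis .
    qed
    moreover have "tensor d (\<lambda>i. dd_weight (S i)) f = tensor d (\<lambda>i. dd_weight (S i)) W +
        tensor d (\<lambda>i. dd_weight (S i)) (\<lambda>x. LINT u:?J|\<mu>. spline_kernel d n x u)"
      unfolding T sum.distrib[symmetric]
    proof (intro sum.cong refl)
      fix y assume "y \<in> PiE {..<d} S"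
      then have "f y = W y + (LINT u:?J|\<mu>. spline_kernel d n y u)" using \<mu>[of y] sub by blast
      then show "?w y * f y = ?w y * W y + ?w y * (LINT u:?J|\<mu>. spline_kernel d n y u)"
        by (simp add: algebra_simps)
    qed
    moreover have "multi_divdiff d n X f = tensor d (\<lambda>i. dd_weight (S i)) f"
      unfolding S_def using X by (intro multi_divdiff_eq_tensor) auto
    ultimately show "0 \<le> multi_divdiff d n X f" by simp
  qed
qed

end
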